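(* Let $q\in[1,+\infty)$, let $\Lambda=(\lambda_n)_{n\in\mathbb N}$ be a quasi-geometric sequence, and let $\mu$ be a positive finite measure on $[0,1)$. Assume that $\mu$ is a Carleson measure for $M_\Lambda^q$. Then $$\|i_\mu^q\|_e\approx\limsup_{n\to+\infty}\Big(\int_{[0,1)}\lambda_nt^{\lambda_n}d\mu\Big)^{\frac1q}\approx\Big(\limsup_{\varepsilon\to0}\frac{\mu([1-\varepsilon,1))}{\varepsilon}\Big)^{\frac1q}\approx\limsup_{n\to+\infty}D_n(q),$$ where the underlying constants depend only on $q$ and $\Lambda$. In particular, $i_\mu^q$ is compact if and only if $\mu$ is vanishing sublinear.
   Context: $A\approx B$ means that there are constants $c,c'>0$ with $cA\le B\le c'A$. A sequence $(\lambda_n)_n$ of positive numbers is quasi-geometric if there are constants $r,R$ with $1<r\le\frac{\lambda_{n+1}}{\lambda_n}\le R<+\infty$ for every $n$. $M_\Lambda^q$ is the closed linear span of the monomials $t^{\lambda_n}$ in $L^q([0,1],m)$, $m$ the Lebesgue measure, with norm $\|\cdot\|_q$; its elements have well-defined values $f(x)=\sum_na_nx^{\lambda_n}$ on $[0,1)$ (Clarkson–Erdős). $\mu$ is a Carleson measure for $M_\Lambda^q$ if there is a constant $C$ with $\|f\|_{L^q(\mu)}\le C\|f\|_q$ for every finite sum $f(t)=\sum_na_nt^{\lambda_n}$; then $i_\mu^q:M_\Lambda^q\to L^q(\mu)$, $f\mapsto f$, is bounded. The essential norm is $\|S\|_e=\inf\{\|S-K\|:K\text{ compact}\}$. $\mu$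 is vanishing sublinear if $\lim_{\varepsilon\to0}\frac{\mu([1-\varepsilon,1])}{\varepsilon}=0$ (with $\mu(\{1\})=0$). Finally $$D_n(q)=\Big(\int_{[0,1)}\lambda_n^{\frac1q}t^{\lambda_n}\Big(\sum_{k\in\mathbb N}\lambda_k^{\frac1q}t^{\lambda_k}\Big)^{q-1}d\mu\Big)^{\frac1q}.$$ *)

theory Defs
  imports "HOL-Analysis.Analysis"
begin

text \<open>
  The scalar type \<open>'a\<close> ranges over normed fields of class
  \<open>{real_normed_field, euclidean_space}\<close>, so that the real and the complex case are covered
  at the same time. Elements of \<open>L\<^sup>q(M)\<close> are represented by functions, i.e. two functions that agree
  almost everywhere stand for the same element; quantities that may be infinite live in
  \<^typ>\<open>ennreal\<close>.
\<close>

definition ennroot :: "real \<Rightarrow> ennreal \<Rightarrow> ennreal" where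
  "ennroot q x = (if x = \<infinity> then \<infinity> else ennreal (enn2real x powr (1 / q)))"

definition Lq_norm :: "real \<Rightarrow> 'b measure \<Rightarrow> ('b \<Rightarrow> 'a :: real_normed_vector) \<Rightarrow> ennreal" where
  "Lq_norm q M f = ennroot q (\<integral>\<^sup>+ x. ennreal (norm (f x) powr q) \<partial>M)"

definition Lq_space ::
    "real \<Rightarrow> 'b measure \<Rightarrow> ('b \<Rightarrow> 'a :: {real_normed_field, euclidean_space}) set" where
  "Lq_space q M = {f \<in> borel_measurable M. Lq_norm q M f < \<infinity>}"


text \<open>
  Operators from a linear subspace \<open>V\<close> of \<open>L\<^sup>q(M)\<close> to \<open>L\<^sup>q(N)\<close>. As elements are represented by
  functions, linearity is required up to null sets, and the operator has to respect almost
  everywhere equality.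
\<close>

definition Lq_linear_operator ::
    "real \<Rightarrow> 'b measure \<Rightarrow> ('b \<Rightarrow> 'a :: {real_normed_field, euclidean_space}) set \<Rightarrow> 'c measure \<Rightarrow>
     (('b \<Rightarrow> 'a) \<Rightarrow> ('c \<Rightarrow> 'a)) \<Rightarrow> bool" where
  "Lq_linear_operator q M V N T \<longleftrightarrow>
     (\<forall>f\<in>V. T f \<in> Lq_space q N) \<and>
     (\<forall>f\<in>V. \<forall>g\<in>V. (AE t in M. f t = g t) \<longrightarrow> (AE x in N. T f x = T g x)) \<and>
     (\<forall>f\<in>V. \<forall>g\<in>V. AE x in N. T (\<lambda>t. f t + g t) x = T f x + T g x) \<and>
     (\<forall>c. \<forall>f\<in>V. AE x in N. T (\<lambda>t. c * f t) x = c * T f x)"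

definition Lq_operator_norm ::
    "real \<Rightarrow> 'b measure \<Rightarrow> ('b \<Rightarrow> 'a :: {real_normed_field, euclidean_space}) set \<Rightarrow> 'c measure \<Rightarrow>
     (('b \<Rightarrow> 'a) \<Rightarrow> ('c \<Rightarrow> 'a)) \<Rightarrow> ennreal" where
  "Lq_operator_norm q M V N T = (SUP f\<in>{f \<in> V. Lq_norm q M f \<le> 1}. Lq_norm q N (T f))"

text \<open>
  Compactness: every sequence in the image of the unit ball has a subsequence that converges in
  \<open>L\<^sup>q(N)\<close>. This includes boundedness.
\<close>

definition Lq_compact_operator ::
    "real \<Rightarrow> 'b measure \<Rightarrow> ('b \<Rightarrow> 'a :: {real_normed_field, euclidean_space}) set \<Rightarrow> 'c measure \<Rightarrow>
     (('b \<Rightarrow> 'a) \<Rightarrow> ('c \<Rightarrow> 'a)) \<Rightarrow> bool" where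
  "Lq_compact_operator q M V N T \<longleftrightarrow>
     Lq_linear_operator q M V N T \<and>
     (\<forall>F :: nat \<Rightarrow> 'b \<Rightarrow> 'a. (\<forall>n. F n \<in> V \<and> Lq_norm q M (F n) \<le> 1) \<longrightarrow>
        (\<exists>g\<in>Lq_space q N. \<exists>s :: nat \<Rightarrow> nat. strict_mono s \<and>
           (\<lambda>n. Lq_norm q N (\<lambda>x. T (F (s n)) x - g x)) \<longlonglongrightarrow> 0))"

definition Lq_essential_norm ::
    "real \<Rightarrow> 'b measure \<Rightarrow> ('b \<Rightarrow> 'a :: {real_normed_field, euclidean_space}) set \<Rightarrow> 'c measure \<Rightarrow>
     (('b \<Rightarrow> 'a) \<Rightarrow> ('c \<Rightarrow> 'a)) \<Rightarrow> ennreal" where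
  "Lq_essential_norm q M V N T =
     (INF K\<in>{K. Lq_compact_operator q M V N K}. Lq_operator_norm q M V N (\<lambda>f x. T f x - K f x))"


definition quasi_geometric :: "(nat \<Rightarrow> real) \<Rightarrow> bool" where
  "quasi_geometric l \<longleftrightarrow>
     (\<forall>n. 0 < l n) \<and>
     (\<exists>r R. 1 < r \<and> (\<forall>n. r \<le> l (Suc n) / l n \<and> l (Suc n) / l n \<le> R))"

definition unit_interval_measure :: "real measure" where
  "unit_interval_measure = lebesgue_on {0..1}"

definition muntz_polynomials ::
    "(nat \<Rightarrow> real) \<Rightarrow> (real \<Rightarrow> 'a :: {real_normed_field, euclidean_space}) set" where
  "muntz_polynomials l = {p. \<exists>a N. p = (\<lambda>t. \<Sum>n<N. a n * of_real (t powr l n))}"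

definition muntz_space ::
    "real \<Rightarrow> (nat \<Rightarrow> real) \<Rightarrow> (real \<Rightarrow> 'a :: {real_normed_field, euclidean_space}) set" where
  "muntz_space q l =
     {f \<in> Lq_space q unit_interval_measure.
        \<forall>e>0. \<exists>p\<in>muntz_polynomials l. Lq_norm q unit_interval_measure (\<lambda>t. f t - p t) < e}"

text \<open>
  By the Clarkson--Erdos theorem, an element \<open>f\<close> of the Muntz space agrees almost everywhere with
  \<open>\<Sum>n. a n * x powr l n\<close>, where the series converges at every \<open>x \<in> [0,1)\<close>; the
  coefficients \<open>a\<close> are unique. The embedding maps (the class of) \<open>f\<close> to these values, which is needed
  as the target measure may charge Lebesgue null sets.
\<close>

definition muntz_coeffs ::
    "(nat \<Rightarrow> real) \<Rightarrow> (real \<Rightarrow> 'a :: {real_normed_field, euclidean_space}) \<Rightarrow> nat \<Rightarrow> 'a" where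
  "muntz_coeffs l f =
     (SOME a. (\<forall>x\<in>{0..<1}. summable (\<lambda>n. a n * of_real (x powr l n))) \<and>
              (AE x in unit_interval_measure. x < 1 \<longrightarrow> f x = (\<Sum>n. a n * of_real (x powr l n))))"

definition muntz_embedding ::
    "(nat \<Rightarrow> real) \<Rightarrow> (real \<Rightarrow> 'a :: {real_normed_field, euclidean_space}) \<Rightarrow> real \<Rightarrow> 'a" where
  "muntz_embedding l f x = (\<Sum>n. muntz_coeffs l f n * of_real (x powr l n))"

definition finite_borel_measure_on_unit_interval :: "real measure \<Rightarrow> bool" where
  "finite_borel_measure_on_unit_interval \<mu> \<longleftrightarrow>
     sets \<mu> = sets (restrict_space borel {0..<1}) \<and> finite_measure \<mu>"

text \<open>The first argument only fixes the scalar field.\<close>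

definition carleson_measure ::
    "'a :: {real_normed_field, euclidean_space} itself \<Rightarrow> real \<Rightarrow> (nat \<Rightarrow> real) \<Rightarrow> real measure \<Rightarrow> bool"
  where
  "carleson_measure _ q l \<mu> \<longleftrightarrow>
     (\<exists>C::real. \<forall>p \<in> (muntz_polynomials l :: (real \<Rightarrow> 'a) set).
        Lq_norm q \<mu> p \<le> ennreal C * Lq_norm q unit_interval_measure p)"

definition embedding_essential_norm ::
    "'a :: {real_normed_field, euclidean_space} itself \<Rightarrow> real \<Rightarrow> (nat \<Rightarrow> real) \<Rightarrow> real measure \<Rightarrow> ennreal"
  where
  "embedding_essential_norm _ q l \<mu> =
     Lq_essential_norm q unit_interval_measure (muntz_space q l) \<mu>
       (muntz_embedding l :: (real \<Rightarrow> 'a) \<Rightarrow> real \<Rightarrow> 'a)"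

definition embedding_compact ::
    "'a :: {real_normed_field, euclidean_space} itself \<Rightarrow> real \<Rightarrow> (nat \<Rightarrow> real) \<Rightarrow> real measure \<Rightarrow> bool"
  where
  "embedding_compact _ q l \<mu> \<longleftrightarrow>
     Lq_compact_operator q unit_interval_measure (muntz_space q l) \<mu>
       (muntz_embedding l :: (real \<Rightarrow> 'a) \<Rightarrow> real \<Rightarrow> 'a)"

text \<open>As \<open>\<mu>\<close> lives on \<open>[0,1)\<close>, there is no mass at \<open>1\<close>.\<close>

definition vanishing_sublinear :: "real measure \<Rightarrow> bool" where
  "vanishing_sublinear \<mu> \<longleftrightarrow>
     ((\<lambda>\<epsilon>. measure \<mu> {1 - \<epsilon>..<1} / \<epsilon>) \<longlongrightarrow> 0) (at_right 0)"

text \<open>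
  For \<open>q = 1\<close> and \<open>t = 0\<close> the last factor is \<open>0 powr 0 = 0\<close>; this is harmless because
  \<open>t powr l n = 0\<close> there.
\<close>

definition muntz_D :: "real \<Rightarrow> (nat \<Rightarrow> real) \<Rightarrow> real measure \<Rightarrow> nat \<Rightarrow> ennreal" where
  "muntz_D q l \<mu> n =
     ennroot q (\<integral>\<^sup>+ t. ennreal (l n powr (1 / q) * t powr l n *
                        (\<Sum>k. l k powr (1 / q) * t powr l k) powr (q - 1)) \<partial>\<mu>)"

text \<open>\<open>A \<approx> B\<close> with constants that are uniform over the index set \<open>S\<close>.\<close>

definition approx_uniformly :: "'i set \<Rightarrow> ('i \<Rightarrow> ennreal) \<Rightarrow> ('i \<Rightarrow> ennreal) \<Rightarrow> bool" where
  "approx_uniformly S A B \<longleftrightarrow>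
     (\<exists>c c'::real. 0 < c \<and> 0 < c' \<and>
        (\<forall>i\<in>S. ennreal c * A i \<le> B i \<and> B i \<le> ennreal c' * A i))"

end

theory Submission
  imports Defs "HOL-Library.Diagonal_Subsequence"
begin

text \<open>
  With \<open>V(a) = (\<Sum>n. norm (a n) powr q / l n)\<close>, the Gurariy--Macaev inequality bounds \<open>V(a)\<close> by the
  \<open>q\<close>-th power of the norm of \<open>\<Sum>n. a n * t powr l n\<close>. It is proved by evaluating the function at the points
  \<open>exp (- i * x / l n)\<close>, \<open>i = p, \<dots>, M\<close>, and combining the values by a polynomial that kills the exponents
  near \<open>l n\<close> and is small at those far from it; averaging over \<open>x\<close> turns the samples into
  integrals with bounded overlap. It yields the power series representation of the
  elements of the Muntz space and the compactness of restrictions of the embedding to \<open>[0, 1 - \<delta>)\<close>.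

  Near \<open>1\<close>, Jensen's inequality with weights \<open>l n powr (1 / q) * t powr l n\<close> bounds the \<open>q\<close>-th power of the norm in \<open>L\<^sup>q(\<mu>)\<close>
  by \<open>V(a)\<close> times the supremum of the integrals defining \<open>D\<^sub>n(q)\<close>, and a dyadic decomposition bounds the latter by
  \<open>sup \<mu>([1 - \<epsilon>, 1)) / \<epsilon>\<close>. Conversely, the normalised monomials
  tend to \<open>0\<close> pointwise, so by Fatou's lemma no compact operator can absorb more than a fixed fraction of
  their norms in \<open>L\<^sup>q(\<mu>)\<close>, and these dominate \<open>\<mu>([1 - 1 / l n, 1)) * l n\<close>.
\<close>

section \<open>Sums over lacunary sequences\<close>

text \<open>Every quantity of the theorem is compared with one number,
  \<open>boundary_density\<close>, and always through q-th powers, so that all comparisons are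
  linear; roots are taken once, at the end. The obstacle in the coefficient inequality is a ratio
  bound \<open>r\<close> close to 1: neighbouring monomials are then almost parallel, and diagonal
  dominance fails for the bare samples. Annihilating the k neighbours on either side of
  \<open>l n\<close> restores it, but the zeros placed there also shrink the diagonal entry, by a
  factor exponential in k. The far exponents must therefore be damped at a still faster exponential
  rate. The zeros of order p at 0 and 1 supply that rate, so p is chosen from \<open>r\<close> first
  and k afterwards. Point values are not controlled by an integral norm uniformly over all
  functions. The sampling inequality therefore has to hold for a whole interval of parameters x,
  with the same constant, before it can be integrated.\<close>

lemma powr_sum_le_weighted_pos:
  fixes w x :: "'b \<Rightarrow> real"
  assumes fin: "finite I" and q: "1 \<le> q"
    and w: "\<And>i. i \<in> I \<Longrightarrow> 0 \<le> w i" and x: "\<And>i. i \<in> I \<Longrightarrow> 0 < x i"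
  shows "(\<Sum>i\<in>I. w i * x i) powr q \<le> (\<Sum>i\<in>I. w i) powr (q - 1) * (\<Sum>i\<in>I. w i * x i powr q)"
proof (cases "(\<Sum>i\<in>I. w i) = 0")
  case True
  then have "w i = 0" if "i \<in> I" for i
    using sum_nonneg_eq_0_iff[OF fin] w that by blast
  then show ?thesis by simp
next
  case False
  define W where "W = (\<Sum>i\<in>I. w i)"
  have W: "W > 0" using False w sum_nonneg[of I w] unfolding W_def by fastforce
  have ne: "I \<noteq> {}" using False by auto
  \<comment> \<open>Jensen's inequality for the convex power, with the weights normalised by their
    sum W. Undoing the normalisation leaves \<open>W powr q / W\<close>, the source of the factor
    with exponent \<open>q - 1\<close>.\<close>
  have 1: "(\<Sum>i\<in>I. w i / W) = 1" using W by (simp add: W_def flip: sum_divide_distrib)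
  have "(\<Sum>i\<in>I. (w i / W) *\<^sub>R x i) powr q \<le> (\<Sum>i\<in>I. (w i / W) * (x i powr q))"
    using fin ne W w x 1
    by (intro convex_on_sum[where C="{0<..}" and f="\<lambda>x. x powr q"]) (auto intro: powr_convex q)
  then have "((\<Sum>i\<in>I. w i * x i) / W) powr q \<le> (\<Sum>i\<in>I. w i * x i powr q) / W"
    by (simp add: sum_divide_distrib)
  then have "(\<Sum>i\<in>I. w i * x i) powr q / W powr q \<le> (\<Sum>i\<in>I. w i * x i powr q) / W"
    using W w x by (simp add: powr_divide sum_nonneg less_imp_le)
  then have "(\<Sum>i\<in>I. w i * x i) powr q \<le> W powr q / W * (\<Sum>i\<in>I. w i * x i powr q)"
    using W by (simp add: field_simps)
  also have "W powr q / W = W powr (q - 1)" using W by (simp add: powr_diff)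
  finally show ?thesis by (simp add: W_def)
qed


text \<open>Indices with \<open>x i = 0\<close> contribute to neither weighted sum. Putting their
  weights back only enlarges the first factor on the right, because its exponent is
  non-negative.\<close>

lemma powr_sum_le_weighted:
  fixes w x :: "'b \<Rightarrow> real"
  assumes fin: "finite I" and q: "1 \<le> q"
    and w: "\<And>i. i \<in> I \<Longrightarrow> 0 \<le> w i" and x: "\<And>i. i \<in> I \<Longrightarrow> 0 \<le> x i"
  shows "(\<Sum>i\<in>I. w i * x i) powr q \<le> (\<Sum>i\<in>I. w i) powr (q - 1) * (\<Sum>i\<in>I. w i * x i powr q)"
proof -
  define J where "J = {i\<in>I. x i \<noteq> 0}"
  have J: "finite J" "J \<subseteq> I" using fin by (auto simp: J_def)
  have "(\<Sum>i\<in>J. w i * x i) = (\<Sum>i\<in>I. w i * x i)"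
    using fin by (intro sum.mono_neutral_left) (auto simp: J_def)
  moreover have "(\<Sum>i\<in>J. w i * x i powr q) = (\<Sum>i\<in>I. w i * x i powr q)"
    using fin by (intro sum.mono_neutral_left) (auto simp: J_def)
  moreover have "(\<Sum>i\<in>J. w i * x i) powr q
      \<le> (\<Sum>i\<in>J. w i) powr (q - 1) * (\<Sum>i\<in>J. w i * x i powr q)"
    using J q w x by (intro powr_sum_le_weighted_pos) (auto simp: J_def order_less_le)
  moreover have "\<dots> \<le> (\<Sum>i\<in>I. w i) powr (q - 1) * (\<Sum>i\<in>J. w i * x i powr q)"
    using J fin q w by (intro mult_right_mono powr_mono2 sum_mono2 sum_nonneg) auto
  ultimately show ?thesis by simp
qed

text \<open>Since only equivalence up to constants is at stake, this bound through
  \<open>2 * max a b\<close> does the work of Minkowski's inequality throughout.\<close>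

lemma powr_add_le:
  fixes a b :: real
  assumes q: "1 \<le> q" and "0 \<le> a" "0 \<le> b"
  shows "(a + b) powr q \<le> 2 powr q * (a powr q + b powr q)"
proof -
  have "(a + b) powr q \<le> (2 * max a b) powr q"
    using assms by (intro powr_mono2) auto
  also have "\<dots> = 2 powr q * max a b powr q" using assms by (simp add: powr_mult)
  also have "max a b powr q \<le> a powr q + b powr q" by (auto simp: max_def)
  finally show ?thesis by simp
qed

text \<open>Up to the factor \<gamma>, the derivative of
  \<open>x powr \<gamma> / (1 + x powr \<gamma>)\<close> with respect to \<open>ln x\<close>. It
  decays like a power both at 0 and at infinity, so its sums along lacunary sequences are bounded
  whatever the scale.\<close>

definition bump :: "real \<Rightarrow> real \<Rightarrow> real" where
  "bump \<gamma> x = x powr \<gamma> / (1 + x powr \<gamma>)\<^sup>2"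

lemma bump_nonneg: "0 \<le> bump \<gamma> x"
  by (simp add: bump_def)

lemma bump_le_1: "bump \<gamma> x \<le> 1"
proof -
  have "x powr \<gamma> \<le> (1 + x powr \<gamma>)\<^sup>2"
    using powr_ge_zero[of x \<gamma>] by (simp add: power2_eq_square algebra_simps)
  then show ?thesis by (simp add: bump_def divide_le_eq_1)
qed

lemma frac_le_shift:
  fixes a b :: real
  assumes "0 \<le> a" "a \<le> b"
  shows "a / (1 + a) \<le> b / (1 + b)"
  using assms by (simp add: divide_simps algebra_simps)

text \<open>The bump function is dominated by the increments of the bounded increasing function
  \<open>x powr \<gamma> / (1 + x powr \<gamma>)\<close>, so that its sums over lacunary sequences telescope.\<close>

lemma bump_le_increment:
  assumes "0 < \<gamma>" "1 < r" "0 < x" "r * x \<le> y"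
  shows "bump \<gamma> x \<le> r powr \<gamma> / (r powr \<gamma> - 1) * (y powr \<gamma> / (1 + y powr \<gamma>) - x powr \<gamma> / (1 + x powr \<gamma>))"
proof -
  define u where "u = x powr \<gamma>"
  define v where "v = y powr \<gamma>"
  define k where "k = r powr \<gamma>"
  have u: "0 < u" using assms by (simp add: u_def)
  have k: "1 < k" using assms by (simp add: k_def gr_one_powr)
  have v: "k * u \<le> v"
    using assms unfolding u_def v_def k_def by (simp flip: powr_mult add: powr_mono2)
  have "k * u / (1 + k * u) \<le> v / (1 + v)"
    using u k v mult_pos_pos[of k u] by (intro frac_le_shift) auto
  then have "k * u / (1 + k * u) - u / (1 + u) \<le> v / (1 + v) - u / (1 + u)" by simp
  moreover have "k * u / (1 + k * u) - u / (1 + u) = (k - 1) * u / ((1 + k * u) * (1 + u))"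
  proof -
    have "0 < 1 + k * u" using u k by (intro add_pos_pos mult_pos_pos) auto
    then show ?thesis using u by (subst diff_frac_eq) (auto simp: algebra_simps)
  qed
  moreover have "u / (1 + u)\<^sup>2 \<le> k / (k - 1) * ((k - 1) * u / ((1 + k * u) * (1 + u)))"
  proof -
    have "k / (k - 1) * ((k - 1) * u / ((1 + k * u) * (1 + u))) = k * u / ((1 + k * u) * (1 + u))"
      using k by simp
    moreover have "(1 + k * u) * (1 + u) \<le> k * (1 + u)\<^sup>2"
    proof -
      have "(1 + k * u) \<le> k * (1 + u)" using k by (simp add: algebra_simps)
      then show ?thesis using u unfolding power2_eq_square
        by (metis add_pos_pos less_eq_real_def mult.assoc mult_right_mono zero_less_one)
    qed
    moreover have "u / (1 + u)\<^sup>2 = k * u / (k * (1 + u)\<^sup>2)" using k by simp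
    ultimately show ?thesis
      using u k mult_pos_pos[of k u]
      by (simp only:) (intro divide_left_mono mult_pos_pos zero_less_power add_pos_pos, auto)
  qed
  moreover have "0 \<le> k / (k - 1)" using k by simp
  ultimately have "u / (1 + u)\<^sup>2 \<le> k / (k - 1) * (v / (1 + v) - u / (1 + u))"
    by (smt (verit) mult_left_mono)
  then show ?thesis by (simp add: bump_def u_def v_def k_def)
qed

lemma bump_sum_le:
  assumes "0 < \<gamma>" "1 < r" and pos: "\<And>n. 0 < x n" and step: "\<And>n. r * x n \<le> x (Suc n)"
  shows "(\<Sum>n<N. bump \<gamma> (x n)) \<le> r powr \<gamma> / (r powr \<gamma> - 1)"
proof -
  define k where "k = r powr \<gamma> / (r powr \<gamma> - 1)"
  define F where "F n = x n powr \<gamma> / (1 + x n powr \<gamma>)" for n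
  have k: "0 \<le> k" using assms(1,2) by (simp add: k_def gr_one_powr less_imp_le)
  have F: "0 \<le> F n" "F n \<le> 1" for n
    using pos[of n] by (auto simp: F_def divide_le_eq_1 add_pos_nonneg intro: add_nonneg_nonneg)
  have "(\<Sum>n<N. bump \<gamma> (x n)) \<le> (\<Sum>n<N. k * (F (Suc n) - F n))"
    unfolding k_def F_def using assms by (intro sum_mono bump_le_increment) auto
  also have "\<dots> = k * (F N - F 0)" by (simp add: sum_lessThan_telescope flip: sum_distrib_left)
  also have "\<dots> \<le> k * 1" using k F(2)[of N] F(1)[of 0] by (intro mult_left_mono) auto
  finally show ?thesis by (simp add: k_def)
qed

text \<open>Here each bump is charged to the increment between its point and the larger preceding
  one. The first point has no predecessor, so its bump is bounded by 1 separately, whence the extra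
  summand.\<close>

lemma bump_sum_le_decreasing:
  assumes "0 < \<gamma>" "1 < r" and pos: "\<And>n. 0 < x n" and step: "\<And>n. r * x (Suc n) \<le> x n"
  shows "(\<Sum>n<N. bump \<gamma> (x n)) \<le> r powr \<gamma> / (r powr \<gamma> - 1) + 1"
proof -
  define k where "k = r powr \<gamma> / (r powr \<gamma> - 1)"
  define F where "F n = x n powr \<gamma> / (1 + x n powr \<gamma>)" for n
  have k: "0 \<le> k" using assms(1,2) by (simp add: k_def gr_one_powr less_imp_le)
  have F: "0 \<le> F n" "F n \<le> 1" for n
    using pos[of n] by (auto simp: F_def divide_le_eq_1 add_pos_nonneg intro: add_nonneg_nonneg)
  have "(\<Sum>n<N. bump \<gamma> (x n)) \<le> (\<Sum>n<Suc N. bump \<gamma> (x n))" by (simp add: bump_nonneg)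
  also have "\<dots> = bump \<gamma> (x 0) + (\<Sum>n<N. bump \<gamma> (x (Suc n)))" by (rule sum.lessThan_Suc_shift)
  also have "\<dots> \<le> 1 + (\<Sum>n<N. k * (F n - F (Suc n)))"
    unfolding k_def F_def using assms
    by (intro add_mono sum_mono bump_le_increment bump_le_1) auto
  also have "(\<Sum>n<N. k * (F n - F (Suc n))) = k * (F 0 - F N)"
    by (simp add: sum_lessThan_telescope' flip: sum_distrib_left)
  also have "\<dots> \<le> k * 1" using k F(2)[of 0] F(1)[of N] by (intro mult_left_mono) auto
  finally show ?thesis by (simp add: k_def)
qed

text \<open>As \<gamma> is at most 1, \<open>x powr \<gamma> \<le> 1 + x\<close>. Hence the squared
  denominator of the bump is at most \<open>4 * (1 + x / 2)\<^sup>2\<close>, which is at most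
  \<open>4 * exp x\<close>.\<close>

lemma powr_times_exp_le_bump:
  assumes "0 < \<gamma>" "\<gamma> \<le> 1" "0 \<le> x"
  shows "x powr \<gamma> * exp (- x) \<le> 4 * bump \<gamma> x"
proof -
  have "x powr \<gamma> \<le> 1 + x"
  proof (cases "x \<le> 1")
    case True
    then have "x powr \<gamma> \<le> 1" using assms powr_le1 by auto
    then show ?thesis using assms by simp
  next
    case False
    then have "x powr \<gamma> \<le> x powr 1" using assms by (intro powr_mono) auto
    then show ?thesis using assms by simp
  qed
  then have "(1 + x powr \<gamma>)\<^sup>2 \<le> (2 + x)\<^sup>2" by (intro power_mono) (auto simp: add_nonneg_nonneg)
  also have "\<dots> = 4 * (1 + x / 2)\<^sup>2" by (simp add: power2_eq_square algebra_simps)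
  also have "\<dots> \<le> 4 * (exp (x / 2))\<^sup>2"
    using assms exp_ge_add_one_self[of "x/2"] by (intro mult_left_mono power_mono) auto
  also have "(exp (x / 2))\<^sup>2 = exp x" by (simp add: power2_eq_square flip: exp_add)
  finally have "(1 + x powr \<gamma>)\<^sup>2 * exp (- x) \<le> 4" by (simp add: exp_minus field_simps)
  then have "x powr \<gamma> * ((1 + x powr \<gamma>)\<^sup>2 * exp (- x)) \<le> x powr \<gamma> * 4" by (intro mult_left_mono) auto
  moreover have "0 < (1 + x powr \<gamma>)\<^sup>2" by (intro zero_less_power add_pos_nonneg) auto
  ultimately show ?thesis unfolding bump_def by (simp add: pos_le_divide_eq mult_ac)
qed

text \<open>Only the lower bound on the ratios is built in. The upper bound \<open>R\<close> appears
  as an explicit assumption of the lemmas that carry an estimate from the scales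
  \<open>1 / l n\<close> to all small \<epsilon>, and of those built on them.\<close>

locale lacunary =
  fixes l :: "nat \<Rightarrow> real" and r :: real
  assumes l_pos: "0 < l n" and r_gt_1: "1 < r" and l_step: "r * l n \<le> l (Suc n)"
begin

lemma l_growth: "r ^ d * l n \<le> l (n + d)"
proof (induction d)
  case (Suc d)
  have "r ^ Suc d * l n = r * (r ^ d * l n)" by simp
  also have "\<dots> \<le> r * l (n + d)" using Suc r_gt_1 by (intro mult_left_mono) auto
  also have "\<dots> \<le> l (n + Suc d)" using l_step[of "n + d"] by simp
  finally show ?case .
qed simp

lemma l_strict_mono: "m < n \<Longrightarrow> l m < l n"
proof (rule lift_Suc_mono_less[of l])
  fix n
  have "1 * l n < r * l n" using r_gt_1 l_pos by (intro mult_strict_right_mono) auto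
  then show "l n < l (Suc n)" using l_step[of n] by linarith
qed

lemma l_mono: "m \<le> n \<Longrightarrow> l m \<le> l n"
  using l_strict_mono[of m n] by (cases "m = n") auto

lemma l_at_top: "filterlim l at_top sequentially"
proof (rule filterlim_at_top_mono)
  show "filterlim (\<lambda>n. l 0 * r ^ n) at_top sequentially"
    using r_gt_1 l_pos
    by (intro filterlim_tendsto_pos_mult_at_top[OF tendsto_const] filterlim_at_infinity_imp_filterlim_at_top
        filterlim_realpow_sequentially_gt1) auto
  show "\<forall>\<^sub>F n in sequentially. l 0 * r ^ n \<le> l n"
    using l_growth[of _ 0] by (simp add: mult.commute)
qed

lemma sum_bump_le:
  assumes "0 < \<gamma>" "0 < x"
  shows "(\<Sum>n<N. bump \<gamma> (x * l n)) \<le> r powr \<gamma> / (r powr \<gamma> - 1)"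
  using assms l_pos r_gt_1 l_step by (intro bump_sum_le) (auto simp: mult_ac)

definition lac_const :: "real \<Rightarrow> real" where
  "lac_const \<gamma> = 4 * (r powr \<gamma> / (r powr \<gamma> - 1))"

lemma lac_const_pos: "0 < \<gamma> \<Longrightarrow> 0 < lac_const \<gamma>"
  using r_gt_1 by (simp add: lac_const_def gr_one_powr)

text \<open>With \<open>t = exp (- x)\<close>, the sum times \<open>x powr \<gamma>\<close> consists
  of the terms \<open>(x * l n) powr \<gamma> * exp (- (x * l n))\<close>, which bumps dominate
  uniformly in x. Since \<open>- ln t \<ge> 1 - t\<close>, the negative power of x may then be
  replaced by that of \<open>1 - t\<close>.\<close>

lemma sum_powr_le:
  assumes "0 < \<gamma>" "\<gamma> \<le> 1" "0 \<le> t" "t < 1"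
  shows "(\<Sum>n<N. l n powr \<gamma> * t powr l n) \<le> lac_const \<gamma> * (1 - t) powr - \<gamma>"
proof (cases "t = 0")
  case True
  then show ?thesis using lac_const_pos[of \<gamma>] assms by simp
next
  case False
  define x where "x = - ln t"
  have x: "0 < x" and t: "t = exp (- x)" using False assms by (auto simp: x_def)
  have "x powr \<gamma> * (\<Sum>n<N. l n powr \<gamma> * t powr l n) = (\<Sum>n<N. (x * l n) powr \<gamma> * exp (- (x * l n)))"
    unfolding sum_distrib_left
  proof (intro sum.cong refl)
    fix n
    have "t powr l n = exp (- (x * l n))" by (simp add: t powr_def mult.commute)
    then show "x powr \<gamma> * (l n powr \<gamma> * t powr l n) = (x * l n) powr \<gamma> * exp (- (x * l n))"
      using x l_pos[of n] by (simp add: powr_mult)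
  qed
  also have "\<dots> \<le> (\<Sum>n<N. 4 * bump \<gamma> (x * l n))"
    using assms x l_pos by (intro sum_mono powr_times_exp_le_bump) (auto simp: less_imp_le)
  also have "\<dots> \<le> lac_const \<gamma>"
    unfolding lac_const_def sum_distrib_left[symmetric]
    by (intro mult_left_mono sum_bump_le assms x) auto
  finally have "(\<Sum>n<N. l n powr \<gamma> * t powr l n) \<le> lac_const \<gamma> * x powr - \<gamma>"
    using x by (simp add: powr_minus field_simps)
  also have "\<dots> \<le> lac_const \<gamma> * (1 - t) powr - \<gamma>"
    using lac_const_pos[of \<gamma>] assms False x ln_le_minus_one[of t]
    by (intro mult_left_mono powr_mono2') (auto simp: x_def)
  finally show ?thesis .
qed

lemma summable_powr:
  assumes "0 < \<gamma>" "\<gamma> \<le> 1" "0 \<le> t" "t < 1"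
  shows "summable (\<lambda>n. l n powr \<gamma> * t powr l n)"
  by (rule summableI_nonneg_bounded[OF _ sum_powr_le[OF assms]]) simp

lemma suminf_powr_le:
  assumes "0 < \<gamma>" "\<gamma> \<le> 1" "0 \<le> t" "t < 1"
  shows "(\<Sum>n. l n powr \<gamma> * t powr l n) \<le> lac_const \<gamma> * (1 - t) powr - \<gamma>"
  by (rule suminf_le_const[OF summable_powr[OF assms] sum_powr_le[OF assms]])

end

text \<open>Multiplying by a factor \<open>y m - e\<close> acts on the moments
  \<open>\<Sum>m<N. a m * of_real (y m ^ i)\<close> as the shift in i minus e times the identity.
  Each factor therefore at most doubles the bound and widens the window of moments by one; the
  polynomial need not be expanded.\<close>

lemma norm_sum_prod_list_le:
  fixes a :: "nat \<Rightarrow> 'a :: real_normed_field"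
  assumes "\<forall>e\<in>set es. \<bar>e\<bar> \<le> 1"
  shows "norm (\<Sum>m<N. a m * of_real (y m ^ j * prod_list (map (\<lambda>e. y m - e) es)))
    \<le> 2 ^ length es * (\<Sum>i=j..j + length es. norm (\<Sum>m<N. a m * of_real (y m ^ i)))"
  using assms
proof (induction es arbitrary: j)
  case (Cons e es)
  define u where "u i = norm (\<Sum>m<N. a m * of_real (y m ^ i))" for i
  define P where "P m = prod_list (map (\<lambda>e. y m - e) es)" for m
  have u: "0 \<le> u i" for i by (simp add: u_def)
  have IH: "norm (\<Sum>m<N. a m * of_real (y m ^ i * P m)) \<le> 2 ^ length es * sum u {i..i + length es}" for i
    using Cons unfolding u_def P_def by auto
  have "(\<Sum>m<N. a m * of_real (y m ^ j * prod_list (map (\<lambda>e. y m - e) (e # es))))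
      = (\<Sum>m<N. a m * of_real (y m ^ Suc j * P m)) - of_real e * (\<Sum>m<N. a m * of_real (y m ^ j * P m))"
    by (simp add: P_def sum_distrib_left algebra_simps flip: sum_subtractf)
  also have "norm \<dots> \<le> norm (\<Sum>m<N. a m * of_real (y m ^ Suc j * P m))
      + \<bar>e\<bar> * norm (\<Sum>m<N. a m * of_real (y m ^ j * P m))"
    by (rule order_trans[OF norm_triangle_ineq4]) (simp add: norm_mult)
  also have "\<dots> \<le> norm (\<Sum>m<N. a m * of_real (y m ^ Suc j * P m))
      + 1 * norm (\<Sum>m<N. a m * of_real (y m ^ j * P m))"
    using Cons.prems by (intro add_left_mono mult_right_mono) auto
  also have "\<dots> \<le> 2 ^ length es * sum u {Suc j..Suc j + length es} + 1 * (2 ^ length es * sum u {j..j + length es})"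
    by (intro add_mono mult_left_mono IH) auto
  also have "\<dots> \<le> 2 ^ length es * sum u {j..j + length (e # es)} + 1 * (2 ^ length es * sum u {j..j + length (e # es)})"
    using u by (intro add_mono mult_left_mono sum_mono2) auto
  finally show ?case by (simp add: u_def)
qed simp

lemma abs_prod_list_le_1:
  fixes es :: "real list"
  assumes "\<forall>e\<in>set es. \<bar>y - e\<bar> \<le> 1"
  shows "\<bar>prod_list (map (\<lambda>e. y - e) es)\<bar> \<le> 1"
  using assms by (induction es) (simp_all add: abs_mult mult_le_one)

lemma abs_prod_list_ge_power:
  fixes es :: "real list"
  assumes "\<forall>e\<in>set es. \<kappa> \<le> \<bar>y - e\<bar>" "0 \<le> \<kappa>"
  shows "\<kappa> ^ length es \<le> \<bar>prod_list (map (\<lambda>e. y - e) es)\<bar>"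
  using assms by (induction es) (simp_all add: abs_mult mult_mono)

text \<open>Jensen's inequality in each row costs \<open>\<eta> powr (q - 1)\<close>; after
  exchanging the sums, the weighted column bound supplies the last factor \<eta>.\<close>

lemma schur_test:
  fixes K :: "nat \<Rightarrow> nat \<Rightarrow> real"
  assumes q: "1 \<le> q" and \<eta>: "0 < \<eta>"
    and K: "\<And>n m. 0 \<le> K n m" and w: "\<And>n. 0 \<le> w n" and a: "\<And>n. 0 \<le> a n"
    and rows: "\<And>n. n < N \<Longrightarrow> (\<Sum>m<N. K n m) \<le> \<eta>"
    and cols: "\<And>m. m < N \<Longrightarrow> (\<Sum>n<N. w n * K n m) \<le> \<eta> * w m"
  shows "(\<Sum>n<N. w n * (\<Sum>m<N. K n m * a m) powr q) \<le> \<eta> powr q * (\<Sum>m<N. w m * a m powr q)"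
proof -
  have "(\<Sum>n<N. w n * (\<Sum>m<N. K n m * a m) powr q)
      \<le> (\<Sum>n<N. w n * (\<eta> powr (q - 1) * (\<Sum>m<N. K n m * a m powr q)))"
  proof (intro sum_mono mult_left_mono w)
    fix n assume n: "n \<in> {..<N}"
    have "(\<Sum>m<N. K n m * a m) powr q \<le> (\<Sum>m<N. K n m) powr (q - 1) * (\<Sum>m<N. K n m * a m powr q)"
      by (rule powr_sum_le_weighted) (use q K a in auto)
    also have "\<dots> \<le> \<eta> powr (q - 1) * (\<Sum>m<N. K n m * a m powr q)"
      using rows[of n] n q K by (intro mult_right_mono powr_mono2 sum_nonneg) auto
    finally show "(\<Sum>m<N. K n m * a m) powr q \<le> \<eta> powr (q - 1) * (\<Sum>m<N. K n m * a m powr q)" .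
  qed
  also have "\<dots> = \<eta> powr (q - 1) * (\<Sum>n<N. \<Sum>m<N. w n * K n m * a m powr q)"
    by (simp add: sum_distrib_left mult_ac)
  also have "(\<Sum>n<N. \<Sum>m<N. w n * K n m * a m powr q) = (\<Sum>m<N. (\<Sum>n<N. w n * K n m) * a m powr q)"
    by (subst sum.swap) (simp add: sum_distrib_right)
  also have "\<dots> \<le> (\<Sum>m<N. (\<eta> * w m) * a m powr q)"
    using cols by (intro sum_mono mult_right_mono) auto
  also have "\<eta> powr (q - 1) * (\<Sum>m<N. (\<eta> * w m) * a m powr q) = \<eta> powr q * (\<Sum>m<N. w m * a m powr q)"
    using \<eta> by (simp add: powr_diff sum_distrib_left mult_ac)
  finally show ?thesis by (simp add: mult_left_mono)
qed

text \<open>Model for the entries that survive off the diagonal: geometric decay in the distance of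
  the indices, and nothing within distance k, where the polynomial vanishes.\<close>

definition far_kernel :: "real \<Rightarrow> nat \<Rightarrow> nat \<Rightarrow> nat \<Rightarrow> real" where
  "far_kernel s k n m = (if n + k < m then s ^ (m - n) else if m + k < n then s ^ (n - m) else 0)"

lemma far_kernel_commute: "far_kernel s k n m = far_kernel s k m n"
  by (simp add: far_kernel_def)

lemma sum_far_kernel_le:
  assumes s: "0 \<le> s" "s \<le> 1/2"
  shows "(\<Sum>m<N. far_kernel s k n m) \<le> 4 * s ^ Suc k"
proof -
  \<comment> \<open>The subtracted term makes the induction close: it shrinks from
    \<open>2 * s ^ (M - n)\<close> to s times this, and for \<open>s \<le> 1 / 2\<close> that
    releases at least the new summand.\<close>
  have up: "(\<Sum>m<M. if n + k < m then s ^ (m - n) else 0)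
      \<le> (if n + k < M then 2 * s ^ Suc k - 2 * s ^ (M - n) else 0)" for M
  proof (induction M)
    case (Suc M)
    show ?case
    proof (cases "n + k < M")
      case True
      then have "Suc M - n = Suc (M - n)" by simp
      moreover have "2 * s * s ^ (M - n) \<le> 1 * s ^ (M - n)" using s by (intro mult_right_mono) auto
      ultimately show ?thesis using Suc True by simp
    next
      case False
      then show ?thesis using Suc by (auto simp: not_less_less_Suc_eq)
    qed
  qed simp
  have low: "(\<Sum>m<M. s ^ (n - m)) \<le> 2 * s ^ (Suc n - M)" if "M \<le> n" for M
    using that
  proof (induction M)
    case (Suc M)
    have "s ^ (Suc n - M) = s * s ^ (n - M)" using Suc.prems by (simp add: Suc_diff_le)
    moreover have "2 * s * s ^ (n - M) \<le> 1 * s ^ (n - M)" using s by (intro mult_right_mono) auto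
    ultimately show ?case using Suc by simp
  qed (use s in simp)
  have "(\<Sum>m<N. far_kernel s k n m) \<le> (\<Sum>m<N. (if n + k < m then s ^ (m - n) else 0)) +
      (\<Sum>m<N. if m + k < n then s ^ (n - m) else 0)"
    unfolding sum.distrib[symmetric] by (intro sum_mono) (auto simp: far_kernel_def)
  also have "(\<Sum>m<N. if m + k < n then s ^ (n - m) else 0) = (\<Sum>m\<in>{m\<in>{..<N}. m + k < n}. s ^ (n - m))"
    by (rule sum.inter_filter[symmetric]) simp
  also have "\<dots> \<le> (\<Sum>m<n - k. s ^ (n - m))"
    using s by (intro sum_mono2) auto
  also have "\<dots> \<le> 2 * s ^ Suc k"
  proof (cases "k < n")
    case True
    then have "Suc n - (n - k) = Suc k" by simp
    then show ?thesis using low[of "n - k"] by (simp del: power_Suc)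
  qed (use s in simp)
  also have "(\<Sum>m<N. (if n + k < m then s ^ (m - n) else 0)) \<le> 2 * s ^ Suc k"
    using up[of N] s by (smt (verit) zero_le_power)
  finally show ?thesis by simp
qed

section \<open>The Gurariy--Macaev inequality\<close>

text \<open>For a fixed index \<open>n\<close> the exponentials \<open>y m = exp (- x * l m / l n)\<close> are separated by the polynomial
  with a zero of order \<open>p\<close> at \<open>0\<close> and at \<open>1\<close>, which suppresses the exponents far away from
  \<open>l n\<close>, and a simple zero at \<open>y m\<close> for each neighbouring exponent.\<close>

definition gm_nodes :: "(nat \<Rightarrow> real) \<Rightarrow> nat \<Rightarrow> nat \<Rightarrow> nat \<Rightarrow> real \<Rightarrow> real list" where
  "gm_nodes l p k n x = replicate p 1 @
     map (\<lambda>m. exp (- (x * l m / l n))) (filter (\<lambda>m. m \<noteq> n) [n - k..<n + k + 1])"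

text \<open>The zero at 0 is kept as the factor \<open>y ^ p\<close> instead of p further nodes. It
  is then absorbed by starting the moments at \<open>i = p\<close>, so for \<open>p \<ge> 1\<close>
  the sample i = 0, which would be the value at t = 1, never occurs.\<close>

definition gm_poly :: "(nat \<Rightarrow> real) \<Rightarrow> nat \<Rightarrow> nat \<Rightarrow> nat \<Rightarrow> real \<Rightarrow> real \<Rightarrow> real" where
  "gm_poly l p k n x y = y ^ p * prod_list (map (\<lambda>e. y - e) (gm_nodes l p k n x))"

lemma gm_poly_eq:
  "gm_poly l p k n x y = y ^ p * (y - 1) ^ p *
     prod_list (map (\<lambda>e. y - e) (map (\<lambda>m. exp (- (x * l m / l n))) (filter (\<lambda>m. m \<noteq> n) [n - k..<n + k + 1])))"
  by (simp add: gm_poly_def gm_nodes_def)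

lemma length_neighbours_le: "length (filter (\<lambda>m. m \<noteq> n) [n - k..<n + k + 1]) \<le> 2 * k + 1"
  by (rule order_trans[OF length_filter_le]) (simp del: upt_Suc)

lemma length_gm_nodes_le: "length (gm_nodes l p k n x) \<le> p + 2 * k + 1"
  unfolding gm_nodes_def length_append length_map length_replicate
  using length_neighbours_le[of n k] by linarith

section \<open>Size of the separating polynomial on and off the diagonal\<close>

context lacunary
begin

lemma ratio_ge: "m < n \<Longrightarrow> r ^ (n - m) \<le> l n / l m"
  using l_growth[of "n - m" m] l_pos[of m] by (simp add: le_divide_eq)

lemma gm_poly_zero:
  assumes "m \<noteq> n" "m \<le> n + k" "n \<le> m + k"
  shows "gm_poly l p k n x (exp (- (x * l m / l n))) = 0"
  unfolding gm_poly_eq mult_eq_0_iff prod_list_zero_iff using assms by auto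

text \<open>On [0,1] all factors have modulus at most 1, so either multiple zero can be kept alone.
  The zero at 0 serves exponents far above \<open>l n\<close>, for which y is near 0; the zero at 1
  serves those far below.\<close>

lemma abs_gm_poly_le:
  assumes x: "0 \<le> x" and y: "0 \<le> y" "y \<le> 1"
  shows "\<bar>gm_poly l p k n x y\<bar> \<le> y ^ p" "\<bar>gm_poly l p k n x y\<bar> \<le> (1 - y) ^ p"
proof -
  define Q where "Q = prod_list (map (\<lambda>e. y - e) (map (\<lambda>m. exp (- (x * l m / l n))) (filter (\<lambda>m. m \<noteq> n) [n - k..<n + k + 1])))"
  have Q: "\<bar>Q\<bar> \<le> 1"
    unfolding Q_def
  proof (rule abs_prod_list_le_1, safe)
    fix e assume "e \<in> set (map (\<lambda>m. exp (- (x * l m / l n))) (filter (\<lambda>m. m \<noteq> n) [n - k..<n + k + 1]))"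
    then obtain m where "e = exp (- (x * l m / l n))" by auto
    moreover have "0 \<le> x * l m / l n" using x l_pos[of m] l_pos[of n] by simp
    ultimately have "0 \<le> e" "e \<le> 1" by auto
    then show "\<bar>y - e\<bar> \<le> 1" using y by auto
  qed
  have eq: "\<bar>gm_poly l p k n x y\<bar> = y ^ p * (1 - y) ^ p * \<bar>Q\<bar>"
    using y by (simp add: gm_poly_eq Q_def abs_mult power_abs abs_minus_commute)
  have 1: "y ^ p \<le> 1" "(1 - y) ^ p \<le> 1" using y by (auto intro: power_le_one)
  have "y ^ p * (1 - y) ^ p * \<bar>Q\<bar> \<le> y ^ p * 1 * 1"
    using 1 y Q by (intro mult_mono) auto
  then show "\<bar>gm_poly l p k n x y\<bar> \<le> y ^ p" by (simp add: eq)
  have "y ^ p * (1 - y) ^ p * \<bar>Q\<bar> \<le> 1 * (1 - y) ^ p * 1"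
    using 1 y Q by (intro mult_mono) auto
  then show "\<bar>gm_poly l p k n x y\<bar> \<le> (1 - y) ^ p" by (simp add: eq)
qed

text \<open>The two bounds feed the rows and the weighted columns of the Schur test;
  \<open>l m / l n\<close> is the quotient of the weights \<open>1 / l n\<close> and
  \<open>1 / l m\<close>. Writing \<rho> for this quotient, y is at most \<open>1 / \<rho>\<close>
  when m is beyond n, and \<open>1 - y\<close> is at most \<open>2 * \<rho>\<close> when m is before
  n. One of the p powers is spent on the weight, leaving \<open>p - 1\<close>.\<close>

lemma gm_poly_far:
  fixes p k n m :: nat and x :: real
  assumes x: "1 \<le> x" "x \<le> 2" and p: "1 \<le> p" and mn: "m \<noteq> n"
  defines "P \<equiv> \<bar>gm_poly l p k n x (exp (- (x * l m / l n)))\<bar>"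
  shows "P \<le> 2 ^ p * far_kernel ((1 / r) ^ (p - 1)) k n m"
    and "P * (l m / l n) \<le> 2 ^ p * far_kernel ((1 / r) ^ (p - 1)) k n m"
proof -
  define \<rho> where "\<rho> = l m / l n"
  have \<rho>: "0 < \<rho>" using l_pos by (simp add: \<rho>_def)
  define y where "y = exp (- (x * l m / l n))"
  have y: "0 \<le> y" "y \<le> 1" "y = exp (- (x * \<rho>))"
    using x l_pos[of m] l_pos[of n] by (auto simp: y_def \<rho>_def)
  note P_le = abs_gm_poly_le[of x y p k n, folded P_def[folded y_def]]
  have P0: "0 \<le> P" by (simp add: P_def)
  have "max P (P * \<rho>) \<le> 2 ^ p * far_kernel ((1 / r) ^ (p - 1)) k n m"
  proof -
    consider "n + k < m" | "m + k < n" | "m \<le> n + k" "n \<le> m + k" by linarith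
    then show ?thesis
    proof cases
      case 1
      have rho: "r ^ (m - n) \<le> \<rho>" using ratio_ge[of n m] 1 by (simp add: \<rho>_def)
      moreover have "1 \<le> r ^ (m - n)" using r_gt_1 by simp
      ultimately have \<rho>1: "1 \<le> \<rho>" by linarith
      have "y \<le> exp (- \<rho>)" using x \<rho> by (simp add: y)
      also have "\<dots> \<le> 1 / \<rho>"
      proof -
        have "\<rho> \<le> exp \<rho>" using exp_ge_add_one_self[of \<rho>] by linarith
        then show ?thesis using \<rho> by (simp add: exp_minus field_simps)
      qed
      finally have "P \<le> (1 / \<rho>) ^ p"
        using P_le(1) x y power_mono[of y "1 / \<rho>" p] by simp
      then have "P * \<rho> \<le> (1 / \<rho>) ^ p * \<rho>" using \<rho> by (intro mult_right_mono) auto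
      also have "\<dots> = (1 / \<rho>) ^ (p - 1)" using p \<rho> by (cases p) auto
      also have "\<dots> \<le> (1 / r ^ (m - n)) ^ (p - 1)"
        using rho r_gt_1 \<rho> by (intro power_mono divide_left_mono) auto
      also have "\<dots> = ((1 / r) ^ (p - 1)) ^ (m - n)"
        by (simp add: power_one_over mult.commute flip: power_mult)
      also have "\<dots> \<le> 2 ^ p * ((1 / r) ^ (p - 1)) ^ (m - n)"
        using r_gt_1 by (intro mult_le_cancel_right1[THEN iffD2]) (auto simp: one_le_power)
      finally have "P * \<rho> \<le> 2 ^ p * ((1 / r) ^ (p - 1)) ^ (m - n)" .
      moreover have "P \<le> P * \<rho>" using \<rho>1 P0 mult_left_mono[of 1 \<rho> P] by simp
      ultimately show ?thesis using 1 by (simp add: far_kernel_def)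
    next
      case 2
      have rho: "\<rho> \<le> (1 / r) ^ (n - m)"
        using ratio_ge[of m n] 2 r_gt_1 l_pos[of n] l_pos[of m] by (simp add: \<rho>_def field_simps)
      moreover have "(1 / r) ^ (n - m) \<le> 1" using r_gt_1 by (intro power_le_one) auto
      ultimately have \<rho>1: "\<rho> \<le> 1" by linarith
      have "1 - y \<le> x * \<rho>" using exp_ge_add_one_self[of "- (x * \<rho>)"] by (simp add: y)
      also have "\<dots> \<le> 2 * \<rho>" using x \<rho> by simp
      finally have "P \<le> (2 * \<rho>) ^ p"
        using P_le(2) x y power_mono[of "1 - y" "2 * \<rho>" p] by simp
      also have "\<dots> = 2 ^ p * \<rho> ^ p" by (simp add: power_mult_distrib)
      also have "\<dots> \<le> 2 ^ p * \<rho> ^ (p - 1)"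
        using \<rho> \<rho>1 by (intro mult_left_mono power_decreasing) auto
      also have "\<dots> \<le> 2 ^ p * ((1 / r) ^ (n - m)) ^ (p - 1)"
        using \<rho> rho by (intro mult_left_mono power_mono) auto
      also have "\<dots> = 2 ^ p * ((1 / r) ^ (p - 1)) ^ (n - m)"
        by (simp add: mult.commute flip: power_mult)
      finally have "P \<le> 2 ^ p * ((1 / r) ^ (p - 1)) ^ (n - m)" .
      moreover have "P * \<rho> \<le> P" using \<rho>1 P0 mult_left_mono[of \<rho> 1 P] by simp
      ultimately show ?thesis using 2 by (simp add: far_kernel_def)
    next
      case 3
      then have "P = 0" using gm_poly_zero[OF mn] by (simp add: P_def)
      then show ?thesis using r_gt_1 by (simp add: far_kernel_def)
    qed
  qed
  then show "P \<le> 2 ^ p * far_kernel ((1 / r) ^ (p - 1)) k n m"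
    and "P * (l m / l n) \<le> 2 ^ p * far_kernel ((1 / r) ^ (p - 1)) k n m"
    by (auto simp: \<rho>_def)
qed

text \<open>A lower bound for the distance between \<open>exp (- x)\<close> and
  \<open>exp (- (x * \<rho>))\<close>, uniform for x in [1,2]. The first term of the minimum belongs
  to \<open>\<rho> \<ge> r\<close>, the second to \<open>\<rho> \<le> 1 / r\<close>, and
  \<open>exp (- 2)\<close> bounds the common factor \<open>exp (- x)\<close> from below.\<close>

definition gm_gap :: real where
  "gm_gap = exp (- 2) * min (1 - exp (- (r - 1))) (1 - 1 / r)"

lemma gm_gap_bounds: "0 < gm_gap" "gm_gap \<le> 1"
proof -
  show "0 < gm_gap" using r_gt_1 by (simp add: gm_gap_def)
  have "exp (- 2) * min (1 - exp (- (r - 1))) (1 - 1 / r) \<le> 1 * 1"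
    using r_gt_1 by (intro mult_mono) (auto simp: min_def)
  then show "gm_gap \<le> 1" by (simp add: gm_gap_def)
qed

lemma gm_gap_le:
  assumes x: "1 \<le> x" "x \<le> 2" and mn: "m \<noteq> n"
  shows "gm_gap \<le> \<bar>exp (- x) - exp (- (x * l m / l n))\<bar>"
proof -
  define \<rho> where "\<rho> = l m / l n"
  have \<rho>: "0 < \<rho>" using l_pos by (simp add: \<rho>_def)
  have e2: "exp (- 2) \<le> exp (- x)" using x by simp
  show ?thesis
  proof (cases "n < m")
    case True
    have "r \<le> r ^ (m - n)" using True r_gt_1 by (intro self_le_power) auto
    then have "r \<le> \<rho>" using ratio_ge[OF True] by (simp add: \<rho>_def)
    then have "r - 1 \<le> x * (\<rho> - 1)" using x r_gt_1 mult_mono[of 1 x "r - 1" "\<rho> - 1"] by simp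
    then have "1 - exp (- (r - 1)) \<le> 1 - exp (- (x * (\<rho> - 1)))" by simp
    then have "gm_gap \<le> exp (- x) * (1 - exp (- (x * (\<rho> - 1))))"
      unfolding gm_gap_def using e2 r_gt_1 by (intro mult_mono min.coboundedI1) auto
    also have "\<dots> = exp (- x) - exp (- (x * \<rho>))"
      by (simp add: algebra_simps flip: exp_add)
    finally show ?thesis by (simp add: \<rho>_def)
  next
    case False
    then have nm: "m < n" using mn by simp
    have "r \<le> r ^ (n - m)" using nm r_gt_1 by (intro self_le_power) auto
    then have "r \<le> l n / l m" using ratio_ge[OF nm] by simp
    then have "\<rho> \<le> 1 / r" using r_gt_1 l_pos[of m] l_pos[of n] by (simp add: \<rho>_def field_simps)
    moreover have "1 / r \<le> 1" using r_gt_1 by simp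
    ultimately have "1 - 1 / r \<le> x * (1 - \<rho>)" using x mult_mono[of 1 x "1 - 1 / r" "1 - \<rho>"] by simp
    also have "\<dots> \<le> exp (x * (1 - \<rho>)) - 1" using exp_ge_add_one_self[of "x * (1 - \<rho>)"] by linarith
    finally have "gm_gap \<le> exp (- x) * (exp (x * (1 - \<rho>)) - 1)"
      unfolding gm_gap_def using e2 r_gt_1 by (intro mult_mono min.coboundedI2) auto
    also have "\<dots> = exp (- (x * \<rho>)) - exp (- x)"
      by (simp add: algebra_simps flip: exp_add)
    finally show ?thesis by (simp add: \<rho>_def)
  qed
qed

text \<open>For x in [1,2] the diagonal node \<open>exp (- x)\<close> stays away from 0 and 1, and
  each of the at most \<open>2 * k + 1\<close> neighbour factors is at least \<open>gm_gap\<close>.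
  Since the gap is at most 1, the exponent may be rounded up.\<close>

lemma gm_poly_diag:
  assumes x: "1 \<le> x" "x \<le> 2"
  shows "(exp (- 2) * (1 - exp (- 1))) ^ p * gm_gap ^ (2 * k + 1) \<le> \<bar>gm_poly l p k n x (exp (- x))\<bar>"
proof -
  define y where "y = exp (- x)"
  define es where "es = map (\<lambda>m. exp (- (x * l m / l n))) (filter (\<lambda>m. m \<noteq> n) [n - k..<n + k + 1])"
  have len: "length es \<le> 2 * k + 1"
    unfolding es_def length_map by (rule length_neighbours_le)
  have "gm_gap ^ (2 * k + 1) \<le> gm_gap ^ length es"
    using len gm_gap_bounds by (intro power_decreasing) auto
  also have "\<dots> \<le> \<bar>prod_list (map (\<lambda>e. y - e) es)\<bar>"
    using gm_gap_le[OF x] gm_gap_bounds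
    by (intro abs_prod_list_ge_power) (auto simp: es_def y_def)
  finally have 1: "gm_gap ^ (2 * k + 1) \<le> \<bar>prod_list (map (\<lambda>e. y - e) es)\<bar>" .
  have 2: "exp (- 2) \<le> y" "1 - exp (- 1) \<le> 1 - y" "0 \<le> 1 - y" "0 \<le> y" using x by (auto simp: y_def)
  have "(exp (- 2) * (1 - exp (- 1))) ^ p * gm_gap ^ (2 * k + 1)
      \<le> (y * (1 - y)) ^ p * \<bar>prod_list (map (\<lambda>e. y - e) es)\<bar>"
    using 1 2 gm_gap_bounds by (intro mult_mono power_mono) auto
  also have "\<dots> = \<bar>gm_poly l p k n x y\<bar>"
    using 2 by (simp add: gm_poly_eq es_def abs_mult power_abs abs_minus_commute power_mult_distrib)
  finally show ?thesis by (simp add: y_def)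
qed

text \<open>The far sum decays like the power \<open>Suc k\<close> of
  \<open>(1 / r) ^ (p - 1)\<close>, while the diagonal loses \<open>gm_gap ^ (2 * k + 1)\<close>.
  Taking p so large that the former base is at most half the square of the gap leaves a surplus of
  \<open>(1 / 2) ^ k\<close>. Then k is taken so large that this surplus beats the constants
  depending on p.\<close>

lemma gm_parameters:
  obtains p k where "1 \<le> p" "(1 / r) ^ (p - 1) \<le> 1 / 2"
    "4 * (2 ^ p * (4 * ((1 / r) ^ (p - 1)) ^ Suc k)) \<le> (exp (- 2) * (1 - exp (- 1))) ^ p * gm_gap ^ (2 * k + 1)"
proof -
  define g where "g = gm_gap"
  have g: "0 < g" "g \<le> 1" using gm_gap_bounds by (auto simp: g_def)
  have "0 < g\<^sup>2 / 2" "1 / r < 1" using g r_gt_1 by auto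
  then obtain j where j: "(1 / r) ^ j < g\<^sup>2 / 2" using real_arch_pow_inv by blast
  define p where "p = Suc j"
  define s where "s = (1 / r) ^ (p - 1)"
  have s: "0 \<le> s" "s \<le> g\<^sup>2 / 2" using j r_gt_1 by (auto simp: s_def p_def)
  define c where "c = (exp (- 2) * (1 - exp (- 1 :: real))) ^ p"
  have c: "0 < c" by (simp add: c_def)
  have "0 < c / (16 * 2 ^ p)" using c by simp
  then obtain k where k: "(1 / 2) ^ k < c / (16 * 2 ^ p)" using real_arch_pow_inv[of _ "1/2"] by auto
  have "s ^ Suc k \<le> (g\<^sup>2 / 2) ^ Suc k" using s by (intro power_mono) auto
  also have "\<dots> = g ^ (2 * k + 2) * (1 / 2) ^ Suc k"
  proof -
    have "g\<^sup>2 ^ Suc k = g ^ (2 * k + 2)" by (simp only: power_mult[symmetric]) simp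
    then show ?thesis by (simp add: power_divide)
  qed
  also have "\<dots> \<le> g ^ (2 * k + 1) * (1 / 2) ^ k"
    using g by (intro mult_mono power_decreasing) auto
  also have "\<dots> \<le> g ^ (2 * k + 1) * (c / (16 * 2 ^ p))"
    using k g by (intro mult_left_mono) auto
  finally have "4 * (2 ^ p * (4 * s ^ Suc k)) \<le> c * g ^ (2 * k + 1)"
    by (simp add: field_simps)
  moreover have "g\<^sup>2 \<le> 1" using g by (intro power_le_one) auto
  then have "s \<le> 1 / 2" using s by linarith
  ultimately show ?thesis using that[of p k] by (simp add: s_def c_def g_def p_def)
qed

text \<open>For each n, the polynomial applied to the samples returns the diagonal entry times
  \<open>a n\<close> plus far terms. By the Schur test with weights \<open>1 / l n\<close> the far
  terms form a small operator, so they can be absorbed. The constants precede N, the coefficients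
  and x, which permits integration over x.\<close>

lemma coefficients_le_samples:
  assumes q: "1 \<le> q"
  shows "\<exists>C p M. 0 < C \<and> 1 \<le> (p::nat) \<and>
    (\<forall>N (a :: nat \<Rightarrow> 'a :: real_normed_field) x. 1 \<le> x \<longrightarrow> x \<le> 2 \<longrightarrow>
      (\<Sum>n<N. norm (a n) powr q / l n) \<le>
      C * (\<Sum>n<N. \<Sum>i=p..M. norm (\<Sum>m<N. a m * of_real (exp (- (real i * x / l n) * l m))) powr q / l n))"
proof -
  obtain p k where p: "1 \<le> p" and s2: "(1 / r) ^ (p - 1) \<le> 1 / 2"
    and small: "4 * (2 ^ p * (4 * ((1 / r) ^ (p - 1)) ^ Suc k)) \<le> (exp (- 2) * (1 - exp (- 1))) ^ p * gm_gap ^ (2 * k + 1)"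
    by (rule gm_parameters)
  define s where "s = (1 / r) ^ (p - 1)"
  define A where "A = (2::real) ^ p"
  define B where "B = (exp (- 2) * (1 - exp (- 1))) ^ p * gm_gap ^ (2 * k + 1)"
  define L where "L = p + 2 * k + 1"
  define \<eta> where "\<eta> = A * (4 * s ^ Suc k)"
  define C1 where "C1 = (2 ^ L) powr q * (real (Suc L)) powr (q - 1)"
  have s: "0 < s" "s \<le> 1 / 2" using s2 r_gt_1 by (auto simp: s_def)
  have \<eta>: "0 < \<eta>" "4 * \<eta> \<le> B" using s small by (auto simp: \<eta>_def A_def B_def s_def)
  have B: "0 < B" using \<eta> by linarith
  have A: "0 < A" by (simp add: A_def)
  have C1: "0 < C1" by (simp add: C1_def)
  define C where "C = 2 * 2 powr q * C1 / B powr q"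
  have C: "0 < C" using C1 B by (simp add: C_def)
  have "(\<Sum>n<N. norm (a n) powr q / l n) \<le>
      C * (\<Sum>n<N. \<Sum>i=p..p + L. norm (\<Sum>m<N. a m * of_real (exp (- (real i * x / l n) * l m))) powr q / l n)"
    if x: "1 \<le> x" "x \<le> 2" for N and a :: "nat \<Rightarrow> 'a" and x
  proof -
    define y where "y n m = exp (- (x * l m / l n))" for n m
    define P where "P n m = gm_poly l p k n x (y n m)" for n m
    define b where "b n = norm (\<Sum>m<N. a m * of_real (P n m))" for n
    define u where "u n i = norm (\<Sum>m<N. a m * of_real (exp (- (real i * x / l n) * l m)))" for n i
    define K where "K n m = (if m = n then 0 else \<bar>P n m\<bar>)" for n m
    define F where "F n = (\<Sum>m<N. K n m * norm (a m))" for n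
    define V where "V = (\<Sum>n<N. norm (a n) powr q / l n)"
    define U where "U = (\<Sum>n<N. \<Sum>i=p..p + L. u n i powr q / l n)"
    have K0: "0 \<le> K n m" for n m by (simp add: K_def)
    have fk: "0 \<le> far_kernel s k n m" for n m using s by (simp add: far_kernel_def)
    have K1: "K n m \<le> A * far_kernel s k n m" for n m
      using gm_poly_far(1)[OF x p, of m n k] A fk[of n m] by (auto simp: K_def P_def y_def A_def s_def)
    have K2: "1 / l n * K n m \<le> A * far_kernel s k m n * (1 / l m)" for n m
    proof -
      have "K n m * (l m / l n) \<le> A * far_kernel s k n m"
        using gm_poly_far(2)[OF x p, of m n k] A fk[of n m] by (auto simp: K_def P_def y_def A_def s_def)
      then show ?thesis
        using l_pos[of m] l_pos[of n] by (simp add: far_kernel_commute[of s k n m] field_simps)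
    qed
    have V0: "0 \<le> V" unfolding V_def using l_pos by (intro sum_nonneg) (auto simp: less_imp_le)
    have rows: "(\<Sum>m<N. K n m) \<le> \<eta>" for n
    proof -
      have "(\<Sum>m<N. K n m) \<le> A * (\<Sum>m<N. far_kernel s k n m)"
        unfolding sum_distrib_left by (intro sum_mono K1)
      also have "\<dots> \<le> \<eta>"
        unfolding \<eta>_def using s A by (intro mult_left_mono sum_far_kernel_le) auto
      finally show ?thesis .
    qed
    have cols: "(\<Sum>n<N. 1 / l n * K n m) \<le> \<eta> * (1 / l m)" for m
    proof -
      have "(\<Sum>n<N. 1 / l n * K n m) \<le> A * (\<Sum>n<N. far_kernel s k m n) * (1 / l m)"
        unfolding sum_distrib_left sum_distrib_right by (intro sum_mono K2)
      also have "\<dots> \<le> \<eta> * (1 / l m)"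
        unfolding \<eta>_def using s A l_pos[of m]
        by (intro mult_right_mono mult_left_mono sum_far_kernel_le) auto
      finally show ?thesis .
    qed
    have far: "(\<Sum>n<N. 1 / l n * F n powr q) \<le> \<eta> powr q * V"
      using schur_test[of q \<eta> K "\<lambda>n. 1 / l n" "\<lambda>n. norm (a n)" N] q \<eta>(1) K0 rows cols l_pos
      by (simp add: F_def V_def less_imp_le)
    have diag: "B * norm (a n) \<le> b n + F n" if n: "n < N" for n
    proof -
      have yn: "y n n = exp (- x)" using l_pos[of n] by (simp add: y_def)
      have "B * norm (a n) \<le> \<bar>P n n\<bar> * norm (a n)"
        using gm_poly_diag[OF x, of p k n] by (intro mult_right_mono) (auto simp: B_def P_def yn)
      also have "\<dots> = norm (a n * of_real (P n n))" by (simp add: norm_mult mult.commute)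
      also have "a n * of_real (P n n) = (\<Sum>m<N. a m * of_real (P n m)) - (\<Sum>m\<in>{..<N} - {n}. a m * of_real (P n m))"
        using n by (subst (1) sum.remove[of _ n]) auto
      also have "norm \<dots> \<le> b n + norm (\<Sum>m\<in>{..<N} - {n}. a m * of_real (P n m))"
        unfolding b_def by (rule norm_triangle_ineq4)
      also have "norm (\<Sum>m\<in>{..<N} - {n}. a m * of_real (P n m)) \<le> (\<Sum>m\<in>{..<N} - {n}. K n m * norm (a m))"
        by (rule sum_norm_le) (auto simp: K_def norm_mult)
      also have "\<dots> \<le> F n"
        unfolding F_def using K0 by (intro sum_mono2) auto
      finally show ?thesis by simp
    qed
    have near: "b n powr q \<le> C1 * (\<Sum>i=p..p + L. u n i powr q)" for n
    proof -
      define es where "es = gm_nodes l p k n x"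
      have es: "\<forall>e\<in>set es. \<bar>e\<bar> \<le> 1"
        using x l_pos by (auto simp: es_def gm_nodes_def less_imp_le)
      have len: "length es \<le> L" using length_gm_nodes_le[of l p k n x] by (simp add: es_def L_def)
      have pow: "y n m ^ i = exp (- (real i * x / l n) * l m)" for m i
        by (simp add: y_def flip: exp_of_nat_mult)
      have "b n \<le> 2 ^ length es * (\<Sum>i=p..p + length es. u n i)"
        unfolding b_def u_def P_def gm_poly_def pow[symmetric] es_def[symmetric]
        by (rule norm_sum_prod_list_le[OF es])
      also have "\<dots> \<le> 2 ^ L * (\<Sum>i=p..p + L. u n i)"
        using len by (intro mult_mono power_increasing sum_mono2) (auto simp: u_def intro!: sum_nonneg)
      finally have "b n powr q \<le> (2 ^ L * (\<Sum>i=p..p + L. u n i)) powr q"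
        using q by (intro powr_mono2) (auto simp: b_def)
      also have "\<dots> = (2 ^ L) powr q * (\<Sum>i=p..p + L. 1 * u n i) powr q"
        by (simp add: powr_mult sum_nonneg u_def)
      also have "\<dots> \<le> (2 ^ L) powr q * ((\<Sum>i=p..p + L. 1) powr (q - 1) * (\<Sum>i=p..p + L. 1 * u n i powr q))"
        using q by (intro mult_left_mono powr_sum_le_weighted) (auto simp: u_def)
      finally show ?thesis by (simp add: C1_def mult.assoc)
    qed
    have "B powr q * V = (\<Sum>n<N. (B * norm (a n)) powr q / l n)"
      using B by (simp add: V_def sum_distrib_left powr_mult)
    also have "\<dots> \<le> (\<Sum>n<N. (2 powr q * (C1 * (\<Sum>i=p..p + L. u n i powr q) + F n powr q)) / l n)"
    proof (intro sum_mono divide_right_mono)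
      fix n assume "n \<in> {..<N}"
      have F0: "0 \<le> F n" unfolding F_def using K0 by (intro sum_nonneg mult_nonneg_nonneg) auto
      have "(B * norm (a n)) powr q \<le> (b n + F n) powr q"
        using diag[of n] \<open>n \<in> {..<N}\<close> B q by (intro powr_mono2) auto
      also have "\<dots> \<le> 2 powr q * (b n powr q + F n powr q)"
        using q F0 by (intro powr_add_le) (auto simp: b_def)
      also have "\<dots> \<le> 2 powr q * (C1 * (\<Sum>i=p..p + L. u n i powr q) + F n powr q)"
        using near by (intro mult_left_mono add_right_mono) auto
      finally show "(B * norm (a n)) powr q \<le> 2 powr q * (C1 * (\<Sum>i=p..p + L. u n i powr q) + F n powr q)" .
    qed (use l_pos in \<open>auto simp: less_imp_le\<close>)
    also have "\<dots> = 2 powr q * C1 * U + 2 powr q * (\<Sum>n<N. 1 / l n * F n powr q)"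
      by (simp add: U_def sum_distrib_left sum_divide_distrib add_divide_distrib distrib_left sum.distrib mult_ac)
    also have "\<dots> \<le> 2 powr q * C1 * U + 2 powr q * (\<eta> powr q * V)"
      using far by (intro add_left_mono mult_left_mono) auto
    also have "2 powr q * (\<eta> powr q * V) = (2 * \<eta>) powr q * V" using \<eta> by (simp add: powr_mult)
    \<comment> \<open>The choice \<open>4 * \<eta> \<le> B\<close> was made for this:
      \<open>2 * \<eta>\<close> is at most half of B, and \<open>q \<ge> 1\<close> turns this into a
      factor at most 1/2 on the q-th power. Half of the left-hand side survives; V is a finite sum,
      so the subtraction is legitimate.\<close>
    also have "\<dots> \<le> (B powr q / 2) * V"
    proof (intro mult_right_mono V0)
      have "(2 * \<eta>) powr q \<le> (B * (1 / 2)) powr q" using \<eta> q by (intro powr_mono2) auto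
      also have "\<dots> = B powr q * (1 / 2) powr q" by (rule powr_mult)
      also have "\<dots> \<le> B powr q * (1 / 2) powr 1" using q by (intro mult_left_mono powr_mono') auto
      finally show "(2 * \<eta>) powr q \<le> B powr q / 2" by simp
    qed
    finally have "B powr q * V \<le> 2 * 2 powr q * C1 * U" by simp
    then have "V \<le> C * U" using B by (simp add: C_def field_simps)
    then show ?thesis by (simp add: V_def U_def u_def)
  qed
  with C p show ?thesis by blast
qed
end

text \<open>The substitution \<open>t = exp (- y)\<close> turns dy into dt / t, and 1 / t is at most
  \<open>exp b\<close> on the range in question. This is affordable because the samples occupy a
  bounded range of y.\<close>

lemma nn_integral_exp_substitution_le:
  fixes f :: "real \<Rightarrow> ennreal"
  assumes [measurable]: "f \<in> borel_measurable borel" and b: "0 < b"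
  shows "(\<integral>\<^sup>+y. f (exp (- y)) * indicator {0..b} y \<partial>lborel)
    \<le> ennreal (exp b) * (\<integral>\<^sup>+t. f t * indicator {0..1} t \<partial>lborel)"
proof -
  have "(\<integral>\<^sup>+y. f (exp (- y)) * indicator {0..b} y \<partial>lborel)
      \<le> (\<integral>\<^sup>+y. ennreal (exp b) * (f (exp (- y)) * ennreal (exp (- y)) * indicator {- b..0} (- y)) \<partial>lborel)"
  proof (intro nn_integral_mono)
    fix y
    show "f (exp (- y)) * indicator {0..b} y
      \<le> ennreal (exp b) * (f (exp (- y)) * ennreal (exp (- y)) * indicator {- b..0} (- y))"
    proof (cases "y \<in> {0..b}")
      case True
      have "1 \<le> ennreal (exp b * exp (- y))" using True by (simp flip: exp_add)
      then have "f (exp (- y)) * 1 \<le> f (exp (- y)) * ennreal (exp b * exp (- y))"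
        by (intro mult_left_mono) auto
      then show ?thesis using True by (simp add: ennreal_mult mult_ac)
    qed simp
  qed
  also have "\<dots> = ennreal (exp b) * (\<integral>\<^sup>+y. f (exp (- y)) * ennreal (exp (- y)) * indicator {- b..0} (- y) \<partial>lborel)"
    by (rule nn_integral_cmult) measurable
  also have "(\<integral>\<^sup>+y. f (exp (- y)) * ennreal (exp (- y)) * indicator {- b..0} (- y) \<partial>lborel)
      = (\<integral>\<^sup>+x. f (exp x) * ennreal (exp x) * indicator {- b..0} x \<partial>lborel)"
    by (subst (2) nn_integral_real_affine[where c="-1" and t=0]) simp_all
  also have "\<dots> = (\<integral>\<^sup>+t. f t * indicator {exp (- b)..exp 0} t \<partial>lborel)"
    using b by (intro nn_integral_substitution_aux[symmetric]) (auto intro!: derivative_eq_intros continuous_intros)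
  also have "\<dots> \<le> (\<integral>\<^sup>+t. f t * indicator {0..1} t \<partial>lborel)"
    by (intro nn_integral_mono mult_left_mono) (auto simp: indicator_def intro: order_trans[OF exp_ge_zero])
  finally show ?thesis by (simp add: mult_left_mono)
qed

section \<open>Averaging the samples over the parameter\<close>

context lacunary
begin

text \<open>Bounded overlap: few n can put \<open>y * l n / real i\<close> into [1,2], because l is
  lacunary. The count is read off from \<open>sum_bump_le\<close>, since
  \<open>(1 + z)\<^sup>2 \<le> 9 * z\<close> on [1,2] bounds the indicator by
  \<open>9 * bump 1 z\<close>.\<close>

lemma sum_indicator_le:
  assumes i: "1 \<le> i" "i \<le> M"
  shows "(\<Sum>n<N. indicator {1..2} (y * l n / real i)) \<le> 9 * (r / (r - 1)) * indicator {0..2 * real M / l 0} y"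
proof (cases "\<exists>n. y * l n / real i \<in> {1..2}")
  case True
  then obtain n where n: "1 \<le> y * l n / real i" "y * l n / real i \<le> 2" by auto
  have y: "0 < y"
  proof (rule ccontr)
    assume "\<not> 0 < y"
    then have "y * l n / real i \<le> 0" using l_pos[of n] i by (simp add: divide_nonpos_nonneg mult_nonpos_nonneg)
    then show False using n by simp
  qed
  have "y * l 0 \<le> y * l n" using y l_mono[of 0 n] by simp
  also have "\<dots> \<le> 2 * real i" using n i by (simp add: field_simps)
  also have "\<dots> \<le> 2 * real M" using i by simp
  finally have yb: "y \<le> 2 * real M / l 0" using l_pos[of 0] by (simp add: field_simps)
  have ind: "indicator {1..2} z \<le> 9 * bump 1 z" for z
  proof (cases "z \<in> {1..2}")
    case True
    then have "(1 + z)\<^sup>2 \<le> 3\<^sup>2" by (intro power_mono) auto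
    then have "(1 + z)\<^sup>2 \<le> 9 * z" using True by auto
    moreover have "0 < (1 + z)\<^sup>2" using True by (intro zero_less_power) auto
    ultimately show ?thesis using True by (simp add: bump_def)
  qed (simp add: bump_nonneg)
  have "(\<Sum>n<N. indicator {1..2} (y * l n / real i)) \<le> (\<Sum>n<N. 9 * bump 1 (y / real i * l n))"
    by (intro sum_mono) (simp add: ind)
  also have "\<dots> \<le> 9 * (r powr 1 / (r powr 1 - 1))"
    unfolding sum_distrib_left[symmetric] using y i by (intro mult_left_mono sum_bump_le) auto
  finally show ?thesis using y yb r_gt_1 by simp
next
  case False
  then have "(\<Sum>n<N. indicator {1..2} (y * l n / real i)) = (0::real)" by (intro sum.neutral) (auto simp: indicator_def)
  then show ?thesis using r_gt_1 by simp
qed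

text \<open>The weight \<open>1 / l n\<close> is, up to the factor \<open>i \<ge> 1\<close>, the
  scale of the substitution \<open>y = i * x / l n\<close>. So every sample becomes an integral of
  the same G over an interval, and the overlap bound sums them.\<close>

lemma nn_integral_samples_le:
  fixes G :: "real \<Rightarrow> real"
  assumes [measurable]: "G \<in> borel_measurable borel" and G: "\<And>y. 0 \<le> G y" and i: "1 \<le> i" "i \<le> M"
  shows "(\<Sum>n<N. \<integral>\<^sup>+x. ennreal (G (real i * x / l n) / l n) * indicator {1..2} x \<partial>lborel)
    \<le> ennreal (9 * (r / (r - 1))) * (\<integral>\<^sup>+y. ennreal (G y) * indicator {0..2 * real M / l 0} y \<partial>lborel)"
proof -
  have "(\<integral>\<^sup>+x. ennreal (G (real i * x / l n) / l n) * indicator {1..2} x \<partial>lborel)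
      \<le> (\<integral>\<^sup>+y. ennreal (G y) * indicator {1..2} (y * l n / real i) \<partial>lborel)" for n
  proof -
    define c where "c = real i / l n"
    have c: "0 < c" "1 / l n \<le> c" using l_pos[of n] i by (auto simp: c_def field_simps)
    have "(\<integral>\<^sup>+x. ennreal (G (real i * x / l n) / l n) * indicator {1..2} x \<partial>lborel)
        \<le> (\<integral>\<^sup>+x. ennreal c * (ennreal (G (c * x)) * indicator {1..2} x) \<partial>lborel)"
    proof (intro nn_integral_mono)
      fix x
      have "G (real i * x / l n) / l n = 1 / l n * G (c * x)" by (simp add: c_def)
      also have "\<dots> \<le> c * G (c * x)" using c G by (intro mult_right_mono) auto
      finally have "ennreal (G (real i * x / l n) / l n) \<le> ennreal c * ennreal (G (c * x))"
        using c G by (simp add: ennreal_leI flip: ennreal_mult)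
      then show "ennreal (G (real i * x / l n) / l n) * indicator {1..2} x
          \<le> ennreal c * (ennreal (G (c * x)) * indicator {1..2} x)"
        by (simp add: mult_right_mono flip: mult.assoc)
    qed
    also have "\<dots> = ennreal c * (\<integral>\<^sup>+x. ennreal (G (c * x)) * indicator {1..2} x \<partial>lborel)"
      by (rule nn_integral_cmult) measurable
    also have "\<dots> = (\<integral>\<^sup>+y. ennreal (G y) * indicator {1..2} (y * l n / real i) \<partial>lborel)"
      using c l_pos[of n] i by (subst (2) nn_integral_real_affine[where c=c and t=0]) (simp_all add: c_def)
    finally show ?thesis .
  qed
  then have "(\<Sum>n<N. \<integral>\<^sup>+x. ennreal (G (real i * x / l n) / l n) * indicator {1..2} x \<partial>lborel)
      \<le> (\<Sum>n<N. \<integral>\<^sup>+y. ennreal (G y) * indicator {1..2} (y * l n / real i) \<partial>lborel)"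
    by (intro sum_mono)
  also have "\<dots> = (\<integral>\<^sup>+y. (\<Sum>n<N. ennreal (G y) * indicator {1..2} (y * l n / real i)) \<partial>lborel)"
    by (rule nn_integral_sum[symmetric]) measurable
  also have "\<dots> \<le> (\<integral>\<^sup>+y. ennreal (9 * (r / (r - 1))) * (ennreal (G y) * indicator {0..2 * real M / l 0} y) \<partial>lborel)"
  proof (intro nn_integral_mono)
    fix y
    have "(\<Sum>n<N. ennreal (G y) * indicator {1..2} (y * l n / real i))
        = ennreal (G y) * ennreal (\<Sum>n<N. indicator {1..2} (y * l n / real i))"
      by (simp add: sum_distrib_left flip: ennreal_indicator sum_ennreal)
    also have "\<dots> \<le> ennreal (G y) * ennreal (9 * (r / (r - 1)) * indicator {0..2 * real M / l 0} y)"
      by (intro mult_left_mono ennreal_leI sum_indicator_le i) auto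
    also have "\<dots> = ennreal (9 * (r / (r - 1))) * (ennreal (G y) * indicator {0..2 * real M / l 0} y)"
      by (cases "y \<in> {0..2 * real M / l 0}") (simp_all add: mult.commute)
    finally show "(\<Sum>n<N. ennreal (G y) * indicator {1..2} (y * l n / real i))
        \<le> ennreal (9 * (r / (r - 1))) * (ennreal (G y) * indicator {0..2 * real M / l 0} y)" .
  qed
  also have "\<dots> = ennreal (9 * (r / (r - 1))) * (\<integral>\<^sup>+y. ennreal (G y) * indicator {0..2 * real M / l 0} y \<partial>lborel)"
    by (rule nn_integral_cmult) measurable
  finally show ?thesis .
qed

lemma gurariy_macaev_lborel:
  assumes q: "1 \<le> q"
  shows "\<exists>C>0. \<forall>N (a :: nat \<Rightarrow> 'a :: {real_normed_field, euclidean_space}).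
      ennreal (\<Sum>n<N. norm (a n) powr q / l n) \<le>
      ennreal C * (\<integral>\<^sup>+t. ennreal (norm (\<Sum>m<N. a m * of_real (t powr l m)) powr q) * indicator {0..1} t \<partial>lborel)"
proof -
  obtain C p M where C: "0 < C" and p: "1 \<le> (p::nat)" and
    samples: "\<And>N (a :: nat \<Rightarrow> 'a) x. 1 \<le> x \<Longrightarrow> x \<le> 2 \<Longrightarrow>
      (\<Sum>n<N. norm (a n) powr q / l n) \<le>
      C * (\<Sum>n<N. \<Sum>i=p..M. norm (\<Sum>m<N. a m * of_real (exp (- (real i * x / l n) * l m))) powr q / l n)"
    using coefficients_le_samples[OF q, where 'a='a] by blast
  define b where "b = 2 * real (Suc M) / l 0"
  have b: "0 < b" using l_pos by (simp add: b_def)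
  define K where "K = C * real (Suc M) * (9 * (r / (r - 1)))"
  define D where "D = K * exp b"
  have K: "0 < K" using C r_gt_1 by (simp add: K_def)
  then have D: "0 < D" by (simp add: D_def)
  have "ennreal (\<Sum>n<N. norm (a n) powr q / l n) \<le>
      ennreal D * (\<integral>\<^sup>+t. ennreal (norm (\<Sum>m<N. a m * of_real (t powr l m)) powr q) * indicator {0..1} t \<partial>lborel)"
    (is "ennreal ?V \<le> _ * ?I") for N and a :: "nat \<Rightarrow> 'a"
  proof -
    define G where "G y = norm (\<Sum>m<N. a m * of_real (exp (- y * l m))) powr q" for y
    have G0: "0 \<le> G y" for y by (simp add: G_def)
    have [measurable]: "G \<in> borel_measurable borel" unfolding G_def by measurable
    \<comment> \<open>The interval [1,2] has length 1, so the left-hand side, which does not involve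
      x, equals its own average.\<close>
    have "ennreal ?V = (\<integral>\<^sup>+x. ennreal ?V * indicator {1..2::real} x \<partial>lborel)"
      by (subst nn_integral_cmult_indicator) auto
    also have "\<dots> \<le> (\<integral>\<^sup>+x. ennreal C * (\<Sum>i=p..M. \<Sum>n<N. ennreal (G (real i * x / l n) / l n) * indicator {1..2} x) \<partial>lborel)"
    proof (intro nn_integral_mono)
      fix x :: real
      show "ennreal ?V * indicator {1..2} x
          \<le> ennreal C * (\<Sum>i=p..M. \<Sum>n<N. ennreal (G (real i * x / l n) / l n) * indicator {1..2} x)"
      proof (cases "x \<in> {1..2}")
        case True
        have "?V \<le> C * (\<Sum>n<N. \<Sum>i=p..M. G (real i * x / l n) / l n)"
          using samples[where x=x and N=N and a=a] True by (simp add: G_def)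
        also have "(\<Sum>n<N. \<Sum>i=p..M. G (real i * x / l n) / l n) = (\<Sum>i=p..M. \<Sum>n<N. G (real i * x / l n) / l n)"
          by (rule sum.swap)
        finally have "ennreal ?V \<le> ennreal (C * (\<Sum>i=p..M. \<Sum>n<N. G (real i * x / l n) / l n))"
          by (rule ennreal_leI)
        also have "\<dots> = ennreal C * (\<Sum>i=p..M. \<Sum>n<N. ennreal (G (real i * x / l n) / l n))"
          using C G0 l_pos by (simp add: ennreal_mult sum_nonneg less_imp_le)
        finally show ?thesis using True by simp
      qed simp
    qed
    also have "\<dots> = ennreal C * (\<Sum>i=p..M. \<Sum>n<N. \<integral>\<^sup>+x. ennreal (G (real i * x / l n) / l n) * indicator {1..2} x \<partial>lborel)"
      by (subst nn_integral_cmult, measurable, subst nn_integral_sum, measurable,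
          intro arg_cong2[where f="(*)"] sum.cong refl nn_integral_sum, measurable)
    also have "\<dots> \<le> ennreal C * (\<Sum>i=p..M. ennreal (9 * (r / (r - 1))) * (\<integral>\<^sup>+y. ennreal (G y) * indicator {0..b} y \<partial>lborel))"
      unfolding b_def using p G0 by (intro mult_left_mono sum_mono nn_integral_samples_le) auto
    also have "\<dots> \<le> ennreal C * (\<Sum>i\<le>M. ennreal (9 * (r / (r - 1))) * (\<integral>\<^sup>+y. ennreal (G y) * indicator {0..b} y \<partial>lborel))"
      by (intro mult_left_mono sum_mono2) auto
    also have "\<dots> = ennreal K * (\<integral>\<^sup>+y. ennreal (G y) * indicator {0..b} y \<partial>lborel)"
    proof -
      have "ennreal K = ennreal C * of_nat (Suc M) * ennreal (9 * (r / (r - 1)))"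
        using C r_gt_1 by (simp add: K_def ennreal_mult ennreal_of_nat_eq_real_of_nat del: of_nat_Suc times_divide_eq_right)
      then show ?thesis by (simp add: mult.assoc)
    qed
    also have "(\<integral>\<^sup>+y. ennreal (G y) * indicator {0..b} y \<partial>lborel) \<le> ennreal (exp b) * ?I"
      using nn_integral_exp_substitution_le[OF _ b, of "\<lambda>t. ennreal (norm (\<Sum>m<N. a m * of_real (t powr l m)) powr q)"]
      by (simp add: G_def exp_powr_real)
    finally show ?thesis using K by (simp add: D_def ennreal_mult mult_left_mono mult.assoc)
  qed
  with D show ?thesis by blast
qed
end

section \<open>Coefficients of functions in a Muntz space\<close>

lemma ennroot_ennreal: "0 \<le> x \<Longrightarrow> ennroot q (ennreal x) = ennreal (x powr (1 / q))"
  by (simp add: ennroot_def)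

lemma ennroot_top [simp]: "ennroot q top = top"
  by (simp add: ennroot_def)

lemma ennroot_0 [simp]: "ennroot q 0 = 0"
  by (simp add: ennroot_def)

lemma ennroot_1 [simp]: "ennroot q 1 = 1"
  by (simp add: ennroot_def)

text \<open>\<open>ennroot (1 / q)\<close> is the q-th power, so one function serves both for
  passing to norms and for returning to integrals, infinite values included.\<close>

lemma ennroot_inverse:
  assumes "0 < q"
  shows "ennroot (1 / q) (ennroot q x) = x" "ennroot q (ennroot (1 / q) x) = x"
  using assms by (cases x; simp add: ennroot_ennreal powr_powr)+

lemma ennroot_mono:
  assumes "0 < q" "x \<le> y"
  shows "ennroot q x \<le> ennroot q y"
  using assms
  by (cases x; cases y; simp add: ennroot_ennreal ennreal_leI powr_mono2 top_unique)

lemma ennroot_le_iff: "0 < q \<Longrightarrow> ennroot q x \<le> ennroot q y \<longleftrightarrow> x \<le> y"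
  using ennroot_mono[of q x y] ennroot_mono[of "1 / q" "ennroot q x" "ennroot q y"]
  by (auto simp: ennroot_inverse)

lemma ennroot_mult:
  assumes "0 < q" "0 < c"
  shows "ennroot q (ennreal c * x) = ennreal (c powr (1 / q)) * ennroot q x"
  using assms
  by (cases x; simp add: ennroot_ennreal powr_mult ennreal_mult_top flip: ennreal_mult)

text \<open>A monotone map between linear orders whose range is open is continuous, and here the map
  is onto.\<close>

lemma continuous_on_ennroot: "0 < q \<Longrightarrow> continuous_on UNIV (ennroot q)"
proof (rule continuous_onI_mono)
  assume "0 < q"
  then have "surj (ennroot q)" using ennroot_inverse(2)[of q] by (metis surjI)
  then show "open (ennroot q ` UNIV)" by simp
qed (rule ennroot_mono)

lemma tendsto_ennroot: "0 < q \<Longrightarrow> (f \<longlongrightarrow> x) F \<Longrightarrow> ((\<lambda>n. ennroot q (f n)) \<longlongrightarrow> ennroot q x) F"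
  using continuous_on_tendsto_compose[OF continuous_on_ennroot] by auto

lemma tendsto_ennroot_0_iff: "0 < q \<Longrightarrow> ((\<lambda>n. ennroot q (f n)) \<longlongrightarrow> 0) F \<longleftrightarrow> (f \<longlongrightarrow> 0) F"
  using tendsto_ennroot[of q f 0 F] tendsto_ennroot[of "1 / q" "\<lambda>n. ennroot q (f n)" 0 F]
  by (auto simp: ennroot_inverse)

lemma Limsup_ennroot: "0 < q \<Longrightarrow> F \<noteq> bot \<Longrightarrow> Limsup F (\<lambda>n. ennroot q (f n)) = ennroot q (Limsup F f)"
  by (intro Limsup_compose_continuous_mono continuous_on_ennroot) (auto simp: mono_def ennroot_mono)

definition Lq_int :: "real \<Rightarrow> 'b measure \<Rightarrow> ('b \<Rightarrow> 'a :: real_normed_vector) \<Rightarrow> ennreal" where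
  "Lq_int q M f = (\<integral>\<^sup>+ x. ennreal (norm (f x) powr q) \<partial>M)"

abbreviation Lq_int_on :: "real \<Rightarrow> 'b measure \<Rightarrow> 'b set \<Rightarrow> ('b \<Rightarrow> 'a :: real_normed_vector) \<Rightarrow> ennreal" where
  "Lq_int_on q M A f \<equiv> (\<integral>\<^sup>+ x. ennreal (norm (f x) powr q) * indicator A x \<partial>M)"

lemma Lq_norm_eq: "Lq_norm q M f = ennroot q (Lq_int q M f)"
  by (simp add: Lq_norm_def Lq_int_def)

lemma Lq_norm_le_1_iff: "0 < q \<Longrightarrow> Lq_norm q M f \<le> 1 \<longleftrightarrow> Lq_int q M f \<le> 1"
  using ennroot_le_iff[of q "Lq_int q M f" 1] by (simp add: Lq_norm_eq)

lemma Lq_norm_finite_iff: "0 < q \<Longrightarrow> Lq_norm q M f < top \<longleftrightarrow> Lq_int q M f < top"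
  using ennroot_le_iff[of q top "Lq_int q M f"] by (auto simp: Lq_norm_eq less_top[symmetric] top_unique)

text \<open>Quasi-triangle inequality for q-th powers. Asking only for pointwise domination of
  \<open>norm (h x)\<close> covers sums, differences and rearrangements of them alike.\<close>

lemma Lq_int_add_le:
  fixes f g :: "'b \<Rightarrow> 'a :: {real_normed_vector, second_countable_topology}"
  assumes q: "1 \<le> q" and [measurable]: "f \<in> borel_measurable M" "g \<in> borel_measurable M"
    and h: "\<And>x. x \<in> space M \<Longrightarrow> norm (h x) \<le> norm (f x) + norm (g x)"
  shows "Lq_int q M h \<le> ennreal (2 powr q) * (Lq_int q M f + Lq_int q M g)"
proof -
  have "Lq_int q M h \<le> (\<integral>\<^sup>+ x. ennreal (2 powr q) * (ennreal (norm (f x) powr q) + ennreal (norm (g x) powr q)) \<partial>M)"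
    unfolding Lq_int_def
  proof (intro nn_integral_mono)
    fix x assume "x \<in> space M"
    then have "norm (h x) powr q \<le> (norm (f x) + norm (g x)) powr q" using q h by (intro powr_mono2) auto
    also have "\<dots> \<le> 2 powr q * (norm (f x) powr q + norm (g x) powr q)" using q by (intro powr_add_le) auto
    finally show "ennreal (norm (h x) powr q) \<le> ennreal (2 powr q) * (ennreal (norm (f x) powr q) + ennreal (norm (g x) powr q))"
      by (simp add: ennreal_leI flip: ennreal_mult ennreal_plus)
  qed
  also have "\<dots> = ennreal (2 powr q) * (Lq_int q M f + Lq_int q M g)"
    unfolding Lq_int_def by (subst nn_integral_cmult, measurable, subst nn_integral_add, measurable)
  finally show ?thesis .
qed

lemma space_unit_interval_measure [simp]: "space unit_interval_measure = {0..1}"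
  by (simp add: unit_interval_measure_def)

lemma measurable_unit_interval [measurable (raw)]:
  "f \<in> borel_measurable borel \<Longrightarrow> f \<in> borel_measurable unit_interval_measure"
  by (simp add: unit_interval_measure_def measurable_restrict_space1 measurable_completion)

lemma nn_integral_unit_interval:
  "(\<integral>\<^sup>+ t. f t \<partial>unit_interval_measure) = (\<integral>\<^sup>+ t. f t * indicator {0..1} t \<partial>lborel)"
  by (simp add: unit_interval_measure_def nn_integral_restrict_space nn_integral_completion)

definition muntz_sum :: "(nat \<Rightarrow> real) \<Rightarrow> nat \<Rightarrow> (nat \<Rightarrow> 'a :: real_normed_field) \<Rightarrow> real \<Rightarrow> 'a" where
  "muntz_sum l N a t = (\<Sum>n<N. a n * of_real (t powr l n))"

lemma measurable_muntz_sum [measurable]: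
  "muntz_sum l N (a :: nat \<Rightarrow> 'a :: {real_normed_field, euclidean_space}) \<in> borel_measurable borel"
  unfolding muntz_sum_def by measurable

lemma muntz_sum_diff: "muntz_sum l N (\<lambda>n. a n - b n) t = muntz_sum l N a t - muntz_sum l N b t"
  by (simp add: muntz_sum_def sum_subtractf algebra_simps)

text \<open>Padding the coefficients with zeros lets two polynomials be written with a common number
  of terms, so that the coefficient inequality applies to their difference.\<close>

lemma muntz_polynomialsE:
  assumes "p \<in> muntz_polynomials l"
  obtains a N where "\<And>n. N \<le> n \<Longrightarrow> a n = 0" "\<And>M. N \<le> M \<Longrightarrow> p = muntz_sum l M a"
proof -
  obtain b N where p: "p = (\<lambda>t. \<Sum>n<N. b n * of_real (t powr l n))"
    using assms by (auto simp: muntz_polynomials_def)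
  define a where "a n = (if n < N then b n else 0)" for n
  have "p = muntz_sum l M a" if "N \<le> M" for M
    unfolding p muntz_sum_def fun_eq_iff using that
    by (intro allI sum.mono_neutral_cong_left) (auto simp: a_def)
  then show ?thesis using that[of N a] by (simp add: a_def)
qed

section \<open>Series representations and uniqueness of their coefficients\<close>

abbreviation muntz_series :: "(nat \<Rightarrow> real) \<Rightarrow> (nat \<Rightarrow> 'a :: {real_normed_field, banach}) \<Rightarrow> real \<Rightarrow> 'a" where
  "muntz_series l a t \<equiv> (\<Sum>n. a n * of_real (t powr l n))"

text \<open>Stated for all finite sections, so that the inequality for polynomials applies directly
  and the bound survives coefficientwise limits.\<close>

definition coeff_bound :: "(nat \<Rightarrow> real) \<Rightarrow> real \<Rightarrow> real \<Rightarrow> (nat \<Rightarrow> 'a :: real_normed_vector) \<Rightarrow> bool" where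
  "coeff_bound l q V a \<longleftrightarrow> (\<forall>N. (\<Sum>n<N. norm (a n) powr q / l n) \<le> V)"

text \<open>The condition under the choice operator of \<open>muntz_coeffs\<close>; once it is shown
  to determine a, the choice can be evaluated.\<close>

definition muntz_rep ::
    "(nat \<Rightarrow> real) \<Rightarrow> (real \<Rightarrow> 'a :: {real_normed_field, euclidean_space}) \<Rightarrow> (nat \<Rightarrow> 'a) \<Rightarrow> bool" where
  "muntz_rep l f a \<longleftrightarrow>
     (\<forall>x\<in>{0..<1}. summable (\<lambda>n. a n * of_real (x powr l n))) \<and>
     (AE x in unit_interval_measure. x < 1 \<longrightarrow> f x = muntz_series l a x)"

lemma muntz_rep_add:
  assumes "muntz_rep l f a" "muntz_rep l g b"
  shows "muntz_rep l (\<lambda>x. f x + g x) (\<lambda>n. a n + b n)"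
  unfolding muntz_rep_def
proof
  show "\<forall>x\<in>{0..<1}. summable (\<lambda>n. (a n + b n) * of_real (x powr l n))"
    using assms by (auto simp: muntz_rep_def distrib_right intro: summable_add)
  have "AE x in unit_interval_measure. x \<in> {0..1}" by (rule AE_I2) simp
  moreover have "AE x in unit_interval_measure. x < 1 \<longrightarrow> f x = muntz_series l a x"
    "AE x in unit_interval_measure. x < 1 \<longrightarrow> g x = muntz_series l b x"
    using assms by (auto simp: muntz_rep_def)
  ultimately show "AE x in unit_interval_measure. x < 1 \<longrightarrow> f x + g x = (\<Sum>n. (a n + b n) * of_real (x powr l n))"
  proof eventually_elim
    case (elim x)
    then show ?case using assms by (auto simp: muntz_rep_def distrib_right suminf_add)
  qed
qed

lemma muntz_rep_mult:
  assumes "muntz_rep l f a"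
  shows "muntz_rep l (\<lambda>x. c * f x) (\<lambda>n. c * a n)"
  unfolding muntz_rep_def
proof
  show "\<forall>x\<in>{0..<1}. summable (\<lambda>n. c * a n * of_real (x powr l n))"
    using assms by (auto simp: muntz_rep_def mult.assoc intro: summable_mult)
  have "AE x in unit_interval_measure. x \<in> {0..1}" by (rule AE_I2) simp
  moreover have "AE x in unit_interval_measure. x < 1 \<longrightarrow> f x = muntz_series l a x"
    using assms by (auto simp: muntz_rep_def)
  ultimately show "AE x in unit_interval_measure. x < 1 \<longrightarrow> c * f x = (\<Sum>n. c * a n * of_real (x powr l n))"
  proof eventually_elim
    case (elim x)
    then show ?case using assms by (auto simp: muntz_rep_def mult.assoc suminf_mult)
  qed
qed

lemma muntz_rep_cong_AE:
  assumes "muntz_rep l f a" "AE x in unit_interval_measure. f x = g x"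
  shows "muntz_rep l g a"
proof -
  have "AE x in unit_interval_measure. x < 1 \<longrightarrow> f x = muntz_series l a x"
    using assms(1) by (simp add: muntz_rep_def)
  with assms(2) have "AE x in unit_interval_measure. x < 1 \<longrightarrow> g x = muntz_series l a x"
    by eventually_elim simp
  then show ?thesis using assms(1) by (simp add: muntz_rep_def)
qed

context lacunary
begin

lemma gurariy_macaev:
  assumes q: "1 \<le> q"
  shows "\<exists>C>0. \<forall>N (a :: nat \<Rightarrow> 'a :: {real_normed_field, euclidean_space}).
      ennreal (\<Sum>n<N. norm (a n) powr q / l n) \<le>
      ennreal C * Lq_int q unit_interval_measure (muntz_sum l N a)"
  using gurariy_macaev_lborel[OF q, where 'a='a] 
  by (simp add: Lq_int_def nn_integral_unit_interval muntz_sum_def)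

text \<open>Abel's lemma for real exponents: the terms at y are bounded, and passing to x multiplies
  them by \<open>(x / y) powr l n\<close>. The factor \<open>l n / l 0 \<ge> 1\<close> is inserted
  to match \<open>summable_powr\<close> with exponent 1.\<close>

lemma summable_norm_below:
  fixes c :: "nat \<Rightarrow> 'a :: {real_normed_field, banach}"
  assumes "summable (\<lambda>n. c n * of_real (y powr l n))" "0 \<le> x" "x < y"
  shows "summable (\<lambda>n. norm (c n) * x powr l n)"
proof -
  obtain B where B: "\<And>n. norm (c n * of_real (y powr l n)) \<le> B"
    using assms(1) summable_imp_Bseq[unfolded Bseq_def] by blast
  define t where "t = x / y"
  have t: "0 \<le> t" "t < 1" using assms by (auto simp: t_def)
  have "summable (\<lambda>n. B / l 0 * (l n powr 1 * t powr l n))"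
    by (intro summable_mult summable_powr t) auto
  then show ?thesis
  proof (rule summable_comparison_test'[where N=0])
    fix n :: nat
    have B0: "0 \<le> B" using order_trans[OF norm_ge_zero B[of 0]] .
    have "x powr l n = y powr l n * t powr l n"
      using assms by (simp add: t_def powr_divide)
    then have "norm (c n) * x powr l n = norm (c n * of_real (y powr l n)) * t powr l n"
      by (simp add: norm_mult)
    also have "\<dots> \<le> B * t powr l n" by (intro mult_right_mono B) simp
    also have "\<dots> \<le> B * (l n / l 0) * t powr l n"
    proof -
      have "1 \<le> l n / l 0" using l_mono[of 0 n] l_pos[of 0] by simp
      then show ?thesis using B0 mult_left_mono[of 1 "l n / l 0" B] by (intro mult_right_mono) auto
    qed
    finally show "norm (norm (c n) * x powr l n) \<le> B / l 0 * (l n powr 1 * t powr l n)"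
      using l_pos[of n] by simp
  qed
qed

text \<open>Dividing by the first surviving power and letting \<open>x\<close> tend to \<open>0\<close> along a set of points at which
  the series vanishes shows that no coefficient survives.\<close>

lemma muntz_series_zero:
  fixes c :: "nat \<Rightarrow> 'a :: {real_normed_field, banach}"
  assumes sum: "\<And>x. 0 \<le> x \<Longrightarrow> x < 1 \<Longrightarrow> summable (\<lambda>n. c n * of_real (x powr l n))"
    and zero: "\<And>e. 0 < e \<Longrightarrow> \<exists>x. 0 < x \<and> x < e \<and> (muntz_series l c x) = 0"
  shows "c n = 0"
proof (induction n rule: less_induct)
  case (less n)
  define y :: real where "y = 1 / 2"
  have y: "0 < y" "y < 1" by (auto simp: y_def)
  have sy: "summable (\<lambda>m. norm (c m) * y powr l m)"
    using sum[of "3 / 4"] by (intro summable_norm_below[of c "3/4"]) (auto simp: y_def)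
  define S where "S = (\<Sum>m. norm (c (m + Suc n)) * y powr l (m + Suc n))"
  define \<delta> where "\<delta> = l (Suc n) - l n"
  have \<delta>: "0 < \<delta>" using l_strict_mono[of n "Suc n"] by (simp add: \<delta>_def)
  have S0: "0 \<le> S" unfolding S_def using sy by (intro suminf_nonneg summable_ignore_initial_segment) auto
  have bound: "norm (c n) \<le> S * y powr - l n * (x / y) powr \<delta>"
    if x: "0 < x" "x < y" and z: "(muntz_series l c x) = 0" for x
  proof -
    have sx: "summable (\<lambda>m. c m * of_real (x powr l m))" using sum x y by auto
    have "(muntz_series l c x) = (\<Sum>m. c (m + Suc n) * of_real (x powr l (m + Suc n))) + (\<Sum>m<Suc n. c m * of_real (x powr l m))"
      by (rule suminf_split_initial_segment[OF sx])
    also have "(\<Sum>m<Suc n. c m * of_real (x powr l m)) = c n * of_real (x powr l n)"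
      using less by simp
    finally have "c n * of_real (x powr l n) = - (\<Sum>m. c (m + Suc n) * of_real (x powr l (m + Suc n)))"
      using z by (simp add: eq_neg_iff_add_eq_0 add.commute)
    then have "norm (c n * of_real (x powr l n)) = norm (\<Sum>m. c (m + Suc n) * of_real (x powr l (m + Suc n)))"
      by (simp only: norm_minus_cancel)
    then have "norm (c n) * x powr l n = norm (\<Sum>m. c (m + Suc n) * of_real (x powr l (m + Suc n)))"
      by (simp add: norm_mult)
    \<comment> \<open>All remaining exponents are at least \<open>l (Suc n)\<close>, so the tail at
      x is at most \<open>(x / y) powr l (Suc n)\<close> times the tail S at y. Against
      \<open>x powr l n\<close> this gains the positive power \<delta>.\<close>
    also have "\<dots> \<le> (\<Sum>m. norm (c (m + Suc n)) * y powr l (m + Suc n) * (x / y) powr l (Suc n))"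
    proof (rule norm_suminf_le)
      fix m
      have "x powr l (m + Suc n) = y powr l (m + Suc n) * (x / y) powr l (m + Suc n)"
        using x y by (simp add: powr_divide)
      also have "\<dots> \<le> y powr l (m + Suc n) * (x / y) powr l (Suc n)"
        using x y l_mono[of "Suc n" "m + Suc n"] by (intro mult_left_mono powr_mono') auto
      finally show "norm (c (m + Suc n) * of_real (x powr l (m + Suc n)))
          \<le> norm (c (m + Suc n)) * y powr l (m + Suc n) * (x / y) powr l (Suc n)"
        by (simp add: norm_mult mult.assoc mult_left_mono)
      show "summable (\<lambda>m. norm (c (m + Suc n)) * y powr l (m + Suc n) * (x / y) powr l (Suc n))"
        using sy by (intro summable_mult2 summable_ignore_initial_segment[where f="\<lambda>m. norm (c m) * y powr l m"])
    qed
    also have "\<dots> = S * (x / y) powr l (Suc n)"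
      unfolding S_def using sy
      by (intro suminf_mult2[symmetric] summable_ignore_initial_segment[where f="\<lambda>m. norm (c m) * y powr l m"])
    also have "(x / y) powr l (Suc n) = (x / y) powr \<delta> * (x powr l n * y powr - l n)"
      using x y by (simp add: \<delta>_def powr_diff powr_divide powr_minus field_simps)
    finally have "norm (c n) * x powr l n \<le> (S * y powr - l n * (x / y) powr \<delta>) * x powr l n"
      by (simp add: mult_ac)
    then show ?thesis using x by simp
  qed
  have "((\<lambda>x. S * y powr - l n * (x / y) powr \<delta>) \<longlongrightarrow> S * y powr - l n * (0 / y) powr \<delta>) (at_right 0)"
    using \<delta> y by (intro tendsto_intros tendsto_powr') (auto simp: eventually_at_filter)
  then have lim: "((\<lambda>x. S * y powr - l n * (x / y) powr \<delta>) \<longlongrightarrow> 0) (at_right 0)" by simp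
  show "c n = 0"
  proof (rule ccontr)
    assume "c n \<noteq> 0"
    then have "\<forall>\<^sub>F x in at_right 0. S * y powr - l n * (x / y) powr \<delta> < norm (c n)"
      by (intro order_tendstoD(2)[OF lim]) auto
    then obtain e where e: "0 < e" "\<And>x. 0 < x \<Longrightarrow> x < e \<Longrightarrow> S * y powr - l n * (x / y) powr \<delta> < norm (c n)"
      by (auto simp: eventually_at_right_field)
    obtain x where "0 < x" "x < min e y" "(muntz_series l c x) = 0"
      using zero[of "min e y"] e(1) y by auto
    then show False using bound[of x] e(2)[of x] by auto
  qed
qed

text \<open>The difference of the two series vanishes almost everywhere. Every interval next to 0
  has positive Lebesgue measure, so there are zeros arbitrarily close to 0.\<close>

lemma muntz_rep_unique:
  assumes "muntz_rep l f a" "muntz_rep l f b"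
  shows "a = b"
proof -
  have rep: "muntz_rep l (\<lambda>x. f x + (-1) * f x) (\<lambda>n. a n + (-1) * b n)"
    by (intro muntz_rep_add muntz_rep_mult assms)
  have "a n + (-1) * b n = 0" for n
  proof (rule muntz_series_zero)
    show "summable (\<lambda>n. (a n + (-1) * b n) * of_real (x powr l n))" if "0 \<le> x" "x < 1" for x
      using rep that by (auto simp: muntz_rep_def)
    fix e :: real assume e: "0 < e"
    define J where "J = {0<..<min e 1}"
    have ae: "AE x in unit_interval_measure. x < 1 \<longrightarrow> (\<Sum>n. (a n + (-1) * b n) * of_real (x powr l n)) = 0"
      using rep by (auto simp: muntz_rep_def elim!: eventually_mono)
    show "\<exists>x. 0 < x \<and> x < e \<and> (\<Sum>n. (a n + (-1) * b n) * of_real (x powr l n)) = 0"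
    proof (rule ccontr)
      assume *: "\<not> ?thesis"
      have "AE x in unit_interval_measure. x \<notin> J"
        using ae by eventually_elim (use * in \<open>auto simp: J_def\<close>)
      then have "AE x in unit_interval_measure. indicator J x = (0::ennreal)"
        by eventually_elim simp
      then have "(\<integral>\<^sup>+x. indicator J x \<partial>unit_interval_measure) = (\<integral>\<^sup>+x. 0 \<partial>unit_interval_measure)"
        by (rule nn_integral_cong_AE)
      moreover have "(\<integral>\<^sup>+x. indicator J x \<partial>unit_interval_measure) = (\<integral>\<^sup>+x. indicator J x \<partial>lborel)"
        unfolding nn_integral_unit_interval by (intro nn_integral_cong) (auto simp: J_def indicator_def)
      moreover have "\<dots> = ennreal (min e 1)" using e by (simp add: J_def)
      ultimately show False using e by (simp add: min_def split: if_splits)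
    qed
  qed
  then show ?thesis by (simp add: fun_eq_iff)
qed

lemma muntz_coeffs_eq:
  assumes "muntz_rep l f a"
  shows "muntz_coeffs l f = a"
proof -
  have "muntz_coeffs l f = (SOME a. muntz_rep l f a)" by (simp add: muntz_coeffs_def muntz_rep_def)
  then show ?thesis using someI[of "muntz_rep l f" a] muntz_rep_unique assms by metis
qed

end

section \<open>Bounded coefficient sequences and the representation of Muntz functions\<close>

locale lacunary_exponent = lacunary +
  fixes q :: real
  assumes q_ge_1: "1 \<le> q"
begin

lemma coeff_bound_nonneg: "coeff_bound l q V a \<Longrightarrow> 0 \<le> V"
  unfolding coeff_bound_def by (metis lessThan_0 sum.empty)

lemma coeff_bound_mono: "coeff_bound l q V a \<Longrightarrow> V \<le> W \<Longrightarrow> coeff_bound l q W a"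
  unfolding coeff_bound_def by (meson order_trans)

lemma coeff_bound_norm_le:
  assumes "coeff_bound l q V a"
  shows "norm (a n) \<le> V powr (1 / q) * l n powr (1 / q)"
proof -
  have "norm (a n) powr q / l n \<le> (\<Sum>n<Suc n. norm (a n) powr q / l n)"
    by (simp add: sum_nonneg l_pos less_imp_le)
  also have "\<dots> \<le> V" using assms unfolding coeff_bound_def by blast
  finally have "norm (a n) powr q \<le> V * l n" using l_pos[of n] by (simp add: divide_le_eq)
  then have "(norm (a n) powr q) powr (1 / q) \<le> (V * l n) powr (1 / q)"
    using q_ge_1 by (intro powr_mono2) auto
  then show ?thesis using q_ge_1 by (simp add: powr_powr powr_mult)
qed

lemma coeff_bound_diff:
  fixes a b :: "nat \<Rightarrow> 'a :: real_normed_vector"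
  assumes "coeff_bound l q V a" "coeff_bound l q W b"
  shows "coeff_bound l q (2 powr q * (V + W)) (\<lambda>n. a n - b n)"
  unfolding coeff_bound_def
proof
  fix N
  have "(\<Sum>n<N. norm (a n - b n) powr q / l n) \<le> (\<Sum>n<N. 2 powr q * (norm (a n) powr q / l n + norm (b n) powr q / l n))"
  proof (intro sum_mono)
    fix n
    have "norm (a n - b n) powr q \<le> (norm (a n) + norm (b n)) powr q"
      using q_ge_1 by (intro powr_mono2 norm_triangle_ineq4) auto
    also have "\<dots> \<le> 2 powr q * (norm (a n) powr q + norm (b n) powr q)"
      using q_ge_1 by (intro powr_add_le) auto
    finally show "norm (a n - b n) powr q / l n \<le> 2 powr q * (norm (a n) powr q / l n + norm (b n) powr q / l n)"
      using l_pos[of n] by (simp add: field_simps)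
  qed
  also have "\<dots> = 2 powr q * ((\<Sum>n<N. norm (a n) powr q / l n) + (\<Sum>n<N. norm (b n) powr q / l n))"
    by (simp add: sum_distrib_left sum.distrib distrib_left)
  also have "\<dots> \<le> 2 powr q * (V + W)"
    using assms by (intro mult_left_mono add_mono) (auto simp: coeff_bound_def)
  finally show "(\<Sum>n<N. norm (a n - b n) powr q / l n) \<le> 2 powr q * (V + W)" .
qed

lemma coeff_bound_limit:
  fixes a :: "nat \<Rightarrow> 'a :: real_normed_vector"
  assumes bound: "\<forall>\<^sub>F k in sequentially. coeff_bound l q V (b k)" and lim: "\<And>n. (\<lambda>k. b k n) \<longlonglongrightarrow> a n"
  shows "coeff_bound l q V a"
  unfolding coeff_bound_def
proof
  fix N
  have "(\<lambda>k. \<Sum>n<N. norm (b k n) powr q / l n) \<longlonglongrightarrow> (\<Sum>n<N. norm (a n) powr q / l n)"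
    using l_pos q_ge_1 by (intro tendsto_sum tendsto_divide tendsto_powr' tendsto_norm lim tendsto_const)
      (auto simp: less_imp_neq[symmetric])
  then show "(\<Sum>n<N. norm (a n) powr q / l n) \<le> V"
  proof (rule tendsto_upperbound)
    show "\<forall>\<^sub>F k in sequentially. (\<Sum>n<N. norm (b k n) powr q / l n) \<le> V"
      using bound by eventually_elim (simp add: coeff_bound_def)
  qed simp
qed

lemma coeff_bound_terms:
  fixes a :: "nat \<Rightarrow> 'a :: {real_normed_field, banach}"
  assumes a: "coeff_bound l q V a" and x: "0 \<le> x" "x < 1"
  shows "norm (a n * of_real (x powr l n)) \<le> V powr (1 / q) * (l n powr (1 / q) * x powr l n)"
  using mult_right_mono[OF coeff_bound_norm_le[OF a, of n], of "x powr l n"]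
  by (simp add: norm_mult mult.assoc)

lemma summable_majorant:
  assumes "0 \<le> x" "x < 1"
  shows "summable (\<lambda>n. V * (l n powr (1 / q) * x powr l n))"
  using assms q_ge_1 by (intro summable_mult summable_powr) auto

text \<open>The bound V forces \<open>norm (a n)\<close> to grow at most like
  \<open>l n powr (1 / q)\<close>, and the lacunary sums with exponent 1 / q control exactly this
  growth.\<close>

lemma coeff_bound_summable:
  fixes a :: "nat \<Rightarrow> 'a :: {real_normed_field, banach}"
  assumes a: "coeff_bound l q V a" and x: "0 \<le> x" "x < 1"
  shows "summable (\<lambda>n. a n * of_real (x powr l n))"
    and "norm (muntz_series l a x) \<le> V powr (1 / q) * lac_const (1 / q) * (1 - x) powr - (1 / q)"
proof -
  show "summable (\<lambda>n. a n * of_real (x powr l n))"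
    by (rule summable_comparison_test'[OF summable_majorant[OF x], where N=0]) (rule coeff_bound_terms[OF a x])
  have "norm (muntz_series l a x) \<le> (\<Sum>n. V powr (1 / q) * (l n powr (1 / q) * x powr l n))"
    by (rule norm_suminf_le[OF coeff_bound_terms[OF a x] summable_majorant[OF x]])
  also have "\<dots> = V powr (1 / q) * (\<Sum>n. l n powr (1 / q) * x powr l n)"
    using x q_ge_1 by (intro suminf_mult summable_powr) auto
  also have "\<dots> \<le> V powr (1 / q) * (lac_const (1 / q) * (1 - x) powr - (1 / q))"
    using x q_ge_1 by (intro mult_left_mono suminf_powr_le) auto
  finally show "norm (muntz_series l a x) \<le> V powr (1 / q) * lac_const (1 / q) * (1 - x) powr - (1 / q)"
    by (simp add: mult.assoc)
qed

text \<open>One summable majorant, depending on V and x but not on k, serves all the series, so the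
  limit may be taken term by term.\<close>

lemma muntz_series_tendsto:
  fixes a :: "nat \<Rightarrow> 'a :: {real_normed_field, banach}"
  assumes bound: "\<And>k. coeff_bound l q V (b k)" and lim: "\<And>n. (\<lambda>k. b k n) \<longlonglongrightarrow> a n"
    and x: "0 \<le> x" "x < 1"
  shows "(\<lambda>k. \<Sum>n. b k n * of_real (x powr l n)) \<longlonglongrightarrow> muntz_series l a x"
proof -
  have "\<forall>\<^sub>F (n, k) in sequentially \<times>\<^sub>F sequentially.
      norm (b k n * of_real (x powr l n)) \<le> V powr (1 / q) * (l n powr (1 / q) * x powr l n)"
    by (intro always_eventually allI) (use coeff_bound_terms[OF bound x] in \<open>simp add: case_prod_beta\<close>)
  from tannerys_theorem[OF _ this summable_majorant[OF x], of "\<lambda>n. a n * of_real (x powr l n)"]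
  show ?thesis using lim by (simp add: tendsto_mult tendsto_const)
qed

lemma muntz_sum_eq_suminf:
  assumes "\<And>n. N \<le> n \<Longrightarrow> a n = 0"
  shows "(muntz_series l a x) = muntz_sum l N a x"
  unfolding muntz_sum_def using assms by (intro suminf_finite) (auto simp: not_less)

lemma muntz_space_approx:
  fixes f :: "real \<Rightarrow> 'a :: {real_normed_field, euclidean_space}"
  assumes "f \<in> muntz_space q l" "0 < e"
  obtains a N where "\<And>n. N \<le> n \<Longrightarrow> a n = 0"
    "\<And>M. N \<le> M \<Longrightarrow> Lq_int q unit_interval_measure (\<lambda>t. f t - muntz_sum l M a t) \<le> ennreal e"
proof -
  have "0 < ennreal (e powr (1 / q))" using assms by simp
  then obtain p where p: "p \<in> muntz_polynomials l"
    and "Lq_norm q unit_interval_measure (\<lambda>t. f t - p t) < ennreal (e powr (1 / q))"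
    using assms unfolding muntz_space_def by blast
  then have "ennroot q (Lq_int q unit_interval_measure (\<lambda>t. f t - p t)) \<le> ennroot q (ennreal e)"
    using assms by (simp add: Lq_norm_eq ennroot_ennreal)
  then have le: "Lq_int q unit_interval_measure (\<lambda>t. f t - p t) \<le> ennreal e"
    using q_ge_1 by (simp add: ennroot_le_iff)
  obtain a N where "\<And>n. N \<le> n \<Longrightarrow> a n = 0" "\<And>M. N \<le> M \<Longrightarrow> p = muntz_sum l M a"
    using muntz_polynomialsE[OF p] by blast
  with le show ?thesis using that[of N a] by metis
qed

text \<open>The coefficient inequality applied to differences of approximating polynomials makes
  each coefficient a Cauchy sequence. The limits inherit the bound, hence define a convergent
  series, and Fatou's lemma identifies this series with f almost everywhere.\<close>

lemma muntz_space_rep: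
  "\<exists>C>0. \<forall>(f :: real \<Rightarrow> 'a :: {real_normed_field, euclidean_space})\<in>muntz_space q l. \<forall>B\<ge>0.
     Lq_int q unit_interval_measure f \<le> ennreal B \<longrightarrow> (\<exists>a. muntz_rep l f a \<and> coeff_bound l q (C * B) a)"
proof -
  obtain C where C: "0 < C" and gm: "\<And>N (a :: nat \<Rightarrow> 'a).
      ennreal (\<Sum>n<N. norm (a n) powr q / l n) \<le> ennreal C * Lq_int q unit_interval_measure (muntz_sum l N a)"
    using gurariy_macaev[OF q_ge_1, where 'a='a] by blast
  let ?U = unit_interval_measure
  have "\<exists>a. muntz_rep l f a \<and> coeff_bound l q (C * 2 powr q * B) a"
    if f: "f \<in> muntz_space q l" and B: "0 \<le> B" and fB: "Lq_int q ?U f \<le> ennreal B"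
    for f :: "real \<Rightarrow> 'a" and B
  proof -
    have fm [measurable]: "f \<in> borel_measurable ?U" using f by (simp add: muntz_space_def Lq_space_def)
    define e where "e k = 1 / real (Suc k)" for k
    have e: "0 < e k" for k by (simp add: e_def)
    have e_lim: "e \<longlonglongrightarrow> 0" unfolding e_def by (rule LIMSEQ_inverse_real_of_nat[unfolded inverse_eq_divide])
    have "\<forall>k. \<exists>a N. (\<forall>n. N \<le> n \<longrightarrow> a n = 0) \<and>
        (\<forall>M. N \<le> M \<longrightarrow> Lq_int q ?U (\<lambda>t. f t - muntz_sum l M a t) \<le> ennreal (e k))"
      using muntz_space_approx[OF f e] by metis
    then obtain b N where b0: "\<And>k n. N k \<le> n \<Longrightarrow> b k n = 0"
      and bN: "\<And>k M. N k \<le> M \<Longrightarrow> Lq_int q ?U (\<lambda>t. f t - muntz_sum l M (b k) t) \<le> ennreal (e k)"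
      by metis
    have bound: "coeff_bound l q (C * 2 powr q * (B + e k)) (b k)" for k
      unfolding coeff_bound_def
    proof
      fix M
      define M' where "M' = max M (N k)"
      have "ennreal (\<Sum>n<M'. norm (b k n) powr q / l n) \<le> ennreal C * Lq_int q ?U (muntz_sum l M' (b k))"
        by (rule gm)
      also have "\<dots> \<le> ennreal C * (ennreal (2 powr q) * (Lq_int q ?U f + Lq_int q ?U (\<lambda>t. f t - muntz_sum l M' (b k) t)))"
        using norm_triangle_ineq4[of "f x" "f x - muntz_sum l M' (b k) x" for x]
        by (intro mult_left_mono Lq_int_add_le q_ge_1) (auto simp: algebra_simps)
      also have "\<dots> \<le> ennreal C * (ennreal (2 powr q) * (ennreal B + ennreal (e k)))"
        by (intro mult_left_mono add_mono fB bN) (auto simp: M'_def)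
      also have "\<dots> = ennreal (C * 2 powr q * (B + e k))"
        using C B e[of k] by (simp add: ennreal_mult mult.assoc flip: ennreal_plus)
      finally have "(\<Sum>n<M'. norm (b k n) powr q / l n) \<le> C * 2 powr q * (B + e k)"
        using C B e[of k] by (subst (asm) ennreal_le_iff) auto
      moreover have "(\<Sum>n<M. norm (b k n) powr q / l n) \<le> (\<Sum>n<M'. norm (b k n) powr q / l n)"
        using l_pos by (intro sum_mono2) (auto simp: M'_def less_imp_le)
      ultimately show "(\<Sum>n<M. norm (b k n) powr q / l n) \<le> C * 2 powr q * (B + e k)" by simp
    qed
    have diff: "norm (b k n - b j n) powr q \<le> l n * (C * 2 powr q * (e k + e j))" for k j n
    proof -
      \<comment> \<open>Large enough to contain the index n and to write both polynomials with M
        terms.\<close>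
      define M where "M = max (Suc n) (max (N k) (N j))"
      have "norm (b k n - b j n) powr q / l n \<le> (\<Sum>n<M. norm (b k n - b j n) powr q / l n)"
        using l_pos by (intro member_le_sum) (auto simp: M_def less_imp_le)
      then have "ennreal (norm (b k n - b j n) powr q / l n) \<le> ennreal (\<Sum>n<M. norm (b k n - b j n) powr q / l n)"
        by (rule ennreal_leI)
      also have "\<dots> \<le> ennreal C * Lq_int q ?U (muntz_sum l M (\<lambda>n. b k n - b j n))"
        by (rule gm)
      also have "\<dots> \<le> ennreal C * (ennreal (2 powr q) *
          (Lq_int q ?U (\<lambda>t. f t - muntz_sum l M (b k) t) + Lq_int q ?U (\<lambda>t. f t - muntz_sum l M (b j) t)))"
      proof (intro mult_left_mono Lq_int_add_le q_ge_1)
        fix x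
        have "muntz_sum l M (\<lambda>n. b k n - b j n) x = (f x - muntz_sum l M (b j) x) - (f x - muntz_sum l M (b k) x)"
          by (simp add: muntz_sum_diff)
        then show "norm (muntz_sum l M (\<lambda>n. b k n - b j n) x)
            \<le> norm (f x - muntz_sum l M (b k) x) + norm (f x - muntz_sum l M (b j) x)"
          using norm_triangle_ineq4[of "f x - muntz_sum l M (b j) x" "f x - muntz_sum l M (b k) x"] by simp
      qed auto
      also have "\<dots> \<le> ennreal C * (ennreal (2 powr q) * (ennreal (e k) + ennreal (e j)))"
        by (intro mult_left_mono add_mono bN) (auto simp: M_def)
      also have "\<dots> = ennreal (C * 2 powr q * (e k + e j))"
        using C e[of k] e[of j] by (simp add: ennreal_mult mult.assoc flip: ennreal_plus)
      finally have "norm (b k n - b j n) powr q / l n \<le> C * 2 powr q * (e k + e j)"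
        using C e[of k] e[of j] by (subst (asm) ennreal_le_iff) auto
      then show ?thesis using l_pos[of n] by (simp add: divide_le_eq mult.commute)
    qed
    have "convergent (\<lambda>k. b k n)" for n
    proof (rule Cauchy_convergent, rule metric_CauchyI)
      fix \<epsilon> :: real assume \<epsilon>: "0 < \<epsilon>"
      define c where "c = l n * (C * 2 powr q)"
      have c: "0 < c" using C l_pos by (simp add: c_def)
      have "0 < \<epsilon> powr q / (2 * c)" using \<epsilon> c by simp
      then obtain K where K: "\<And>k. K \<le> k \<Longrightarrow> e k < \<epsilon> powr q / (2 * c)"
        using order_tendstoD(2)[OF e_lim] unfolding eventually_sequentially by blast
      show "\<exists>M. \<forall>k\<ge>M. \<forall>j\<ge>M. dist (b k n) (b j n) < \<epsilon>"
      proof (intro exI[of _ K] allI impI)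
        fix k j assume kj: "K \<le> k" "K \<le> j"
        have "norm (b k n - b j n) powr q \<le> c * (e k + e j)" using diff[of k n j] by (simp add: c_def mult_ac)
        also have "\<dots> < c * (\<epsilon> powr q / (2 * c) + \<epsilon> powr q / (2 * c))"
          using K[OF kj(1)] K[OF kj(2)] c by (intro mult_strict_left_mono add_strict_mono)
        also have "\<dots> = \<epsilon> powr q" using c by (simp add: field_simps)
        finally show "dist (b k n) (b j n) < \<epsilon>"
          using \<epsilon> q_ge_1 powr_mono2[of q \<epsilon> "norm (b k n - b j n)"] by (force simp: dist_norm)
      qed
    qed
    then obtain a where lim: "\<And>n. (\<lambda>k. b k n) \<longlonglongrightarrow> a n" unfolding convergent_def by metis
    have aB: "coeff_bound l q (C * 2 powr q * B) a"
      unfolding coeff_bound_def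
    proof
      fix M
      \<comment> \<open>From index j on, all approximants obey the bound with \<open>e j\<close>, so
        the limit obeys it for every j. Letting j grow then removes the error and leaves a bound
        linear in B.\<close>
      have "(\<Sum>n<M. norm (a n) powr q / l n) \<le> C * 2 powr q * (B + e j)" for j
      proof -
        have "\<forall>\<^sub>F k in sequentially. coeff_bound l q (C * 2 powr q * (B + e j)) (b k)"
          using eventually_ge_at_top[of j]
        proof eventually_elim
          case (elim k)
          then have "e k \<le> e j" by (simp add: e_def field_simps)
          then show ?case using C by (intro coeff_bound_mono[OF bound[of k]] mult_left_mono) auto
        qed
        from coeff_bound_limit[OF this lim] show ?thesis by (simp add: coeff_bound_def)
      qed
      moreover have "(\<lambda>j. C * 2 powr q * (B + e j)) \<longlonglongrightarrow> C * 2 powr q * (B + 0)"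
        by (intro tendsto_intros e_lim)
      ultimately show "(\<Sum>n<M. norm (a n) powr q / l n) \<le> C * 2 powr q * B"
        by (intro tendsto_lowerbound[where f="\<lambda>j. C * 2 powr q * (B + e j)" and F=sequentially]) auto
    qed
    define V where "V = C * 2 powr q * (B + 1)"
    have bV: "coeff_bound l q V (b k)" for k
      unfolding V_def using C by (intro coeff_bound_mono[OF bound[of k]] mult_left_mono) (auto simp: e_def)
    define p where "p k = muntz_sum l (N k) (b k)" for k
    have p_lim: "(\<lambda>k. p k x) \<longlonglongrightarrow> muntz_series l a x" if "0 \<le> x" "x < 1" for x
      using muntz_series_tendsto[OF bV lim that] muntz_sum_eq_suminf[OF b0] by (simp add: p_def)
    \<comment> \<open>The approximants converge pointwise to the series and in the norm to f.
      Fatou's lemma reconciles the two limits without extracting an almost everywhere convergent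
      subsequence.\<close>
    have "(\<integral>\<^sup>+x. liminf (\<lambda>k. ennreal (norm (f x - p k x) powr q)) \<partial>?U)
        \<le> liminf (\<lambda>k. Lq_int q ?U (\<lambda>x. f x - p k x))"
      unfolding Lq_int_def p_def by (rule nn_integral_liminf) measurable
    also have "\<dots> \<le> liminf (\<lambda>k. ennreal (e k))"
      unfolding p_def by (intro Liminf_mono always_eventually allI bN) simp
    also have "\<dots> = 0" using tendsto_ennrealI[OF e_lim] by (intro lim_imp_Liminf) auto
    finally have "(\<integral>\<^sup>+x. liminf (\<lambda>k. ennreal (norm (f x - p k x) powr q)) \<partial>?U) = 0" by simp
    then have ae: "AE x in ?U. liminf (\<lambda>k. ennreal (norm (f x - p k x) powr q)) = 0"
      by (subst (asm) nn_integral_0_iff_AE) (auto simp: p_def)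
    have "AE x in ?U. x \<in> {0..1}" by (rule AE_I2) simp
    with ae have "AE x in ?U. x < 1 \<longrightarrow> f x = muntz_series l a x"
    proof eventually_elim
      case (elim x)
      show ?case
      proof
        assume "x < 1"
        then have "(\<lambda>k. ennreal (norm (f x - p k x) powr q)) \<longlonglongrightarrow> ennreal (norm (f x - (muntz_series l a x)) powr q)"
          using elim q_ge_1 by (intro tendsto_ennrealI tendsto_powr' tendsto_norm tendsto_diff tendsto_const p_lim) auto
        then have "ennreal (norm (f x - (muntz_series l a x)) powr q) = 0"
          using lim_imp_Liminf[of sequentially] elim by fastforce
        then show "f x = muntz_series l a x"
          by (simp add: ennreal_eq_0_iff)
      qed
    qed
    then have "muntz_rep l f a"
      using coeff_bound_summable(1)[OF aB] by (simp add: muntz_rep_def)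
    with aB show ?thesis by blast
  qed
  moreover have "0 < C * 2 powr q" using C by simp
  ultimately show ?thesis by blast
qed

end

section \<open>Measures on the unit interval\<close>

definition boundary_density :: "real measure \<Rightarrow> ennreal" where
  "boundary_density \<mu> = Limsup (at_right 0) (\<lambda>\<epsilon>. emeasure \<mu> {1 - \<epsilon>..<1} / ennreal \<epsilon>)"

text \<open>The bracket is the constant of \<open>bump_sum_le_decreasing\<close> for ratio 2 and
  exponent 1 - \<beta>. The factor 8 is 2, from intervals of length \<open>2 * \<theta> j\<close>,
  times 4, from \<open>powr_times_exp_le_bump\<close>.\<close>

definition shell_const :: "real \<Rightarrow> real" where
  "shell_const \<beta> = 8 * (2 powr (1 - \<beta>) / (2 powr (1 - \<beta>) - 1) + 1)"

locale borel_measure_unit_interval =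
  fixes \<mu> :: "real measure"
  assumes finite_borel: "finite_borel_measure_on_unit_interval \<mu>"
begin

lemma sets_mu: "sets \<mu> = sets (restrict_space borel {0..<1})"
  using finite_borel by (simp add: finite_borel_measure_on_unit_interval_def)

sublocale finite_measure \<mu>
  using finite_borel by (simp add: finite_borel_measure_on_unit_interval_def)

lemma space_mu [simp]: "space \<mu> = {0..<1}"
  using sets_eq_imp_space_eq[OF sets_mu] by (simp add: space_restrict_space)

lemma measurable_mu [measurable (raw)]: "f \<in> borel_measurable borel \<Longrightarrow> f \<in> borel_measurable \<mu>"
  using measurable_restrict_space1[of f borel borel "{0..<1}"] measurable_cong_sets[OF sets_mu refl] by blast

lemma Ico_in_sets_mu: "0 \<le> a \<Longrightarrow> {a..<1} \<in> sets \<mu>"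
  unfolding sets_mu by (subst sets_restrict_space_iff) auto

definition sublinear_upto :: "real \<Rightarrow> real \<Rightarrow> bool" where
  "sublinear_upto \<delta> s \<longleftrightarrow> (\<forall>\<epsilon>. 0 < \<epsilon> \<longrightarrow> \<epsilon> \<le> \<delta> \<longrightarrow> emeasure \<mu> {1 - \<epsilon>..<1} \<le> ennreal (s * \<epsilon>))"

lemma sublinear_uptoD:
  "sublinear_upto \<delta> s \<Longrightarrow> 0 < \<epsilon> \<Longrightarrow> \<epsilon> \<le> \<delta> \<Longrightarrow> emeasure \<mu> {1 - \<epsilon>..<1} \<le> ennreal (s * \<epsilon>)"
  by (simp add: sublinear_upto_def)

text \<open>Decomposition into dyadic shells \<open>1 - t \<approx> \<delta> / 2 ^ j\<close>.\<close>

lemma nn_integral_shells_le: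
  assumes \<delta>: "0 < \<delta>" "\<delta> < 1" and s: "0 \<le> s"
    and sub: "sublinear_upto \<delta> s"
    and \<beta>: "0 \<le> \<beta>" "\<beta> < 1" and x: "0 < x"
  shows "(\<integral>\<^sup>+ t. ennreal (t powr x * (1 - t) powr - \<beta>) * indicator {1 - \<delta>..<1} t \<partial>\<mu>)
    \<le> ennreal (shell_const \<beta> * s * x powr (\<beta> - 1))"
proof -
  define \<theta> where "\<theta> j = \<delta> / 2 ^ Suc j" for j
  define c where "c j = exp (- (x * \<theta> j)) * \<theta> j powr - \<beta>" for j
  \<comment> \<open>Whole intervals up to 1 are used in place of the shells, because the hypothesis
    measures only these. The resulting overcount is harmless, as the sum of the upper bounds still
    converges.\<close>
  define I where "I j = {1 - 2 * \<theta> j..<1}" for j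
  have \<theta>: "0 < \<theta> j" for j using \<delta> by (simp add: \<theta>_def)
  have \<theta>2: "2 * \<theta> j \<le> \<delta>" for j using \<delta> by (simp add: \<theta>_def divide_le_eq)
  have c0: "0 \<le> c j" for j by (simp add: c_def)
  have I: "I j \<in> sets \<mu>" for j unfolding I_def using \<theta>2[of j] \<delta> by (intro Ico_in_sets_mu) auto
  have "(\<integral>\<^sup>+ t. ennreal (t powr x * (1 - t) powr - \<beta>) * indicator {1 - \<delta>..<1} t \<partial>\<mu>)
      \<le> (\<integral>\<^sup>+ t. (\<Sum>j. ennreal (c j) * indicator (I j) t) \<partial>\<mu>)"
  proof (intro nn_integral_mono)
    fix t
    show "ennreal (t powr x * (1 - t) powr - \<beta>) * indicator {1 - \<delta>..<1} t \<le> (\<Sum>j. ennreal (c j) * indicator (I j) t)"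
    proof (cases "t \<in> {1 - \<delta>..<1}")
      case True
      then have t: "0 < t" "t < 1" "1 - t \<le> \<delta>" using \<delta> by auto
      obtain m where "(1 / 2) ^ m < (1 - t) / \<delta>"
        using real_arch_pow_inv[of "(1 - t) / \<delta>" "1 / 2"] t \<delta> by auto
      then have ex: "\<delta> / 2 ^ m < 1 - t" using \<delta> by (simp add: field_simps)
      \<comment> \<open>The first dyadic scale below \<open>1 - t\<close> is not the zeroth, as
        \<open>1 - t \<le> \<delta>\<close>. Its predecessor j is therefore a shell index, with
        \<open>1 - t\<close> between \<open>\<theta> j\<close> and
        \<open>2 * \<theta> j\<close>.\<close>
      define k where "k = (LEAST m. \<delta> / 2 ^ m < 1 - t)"
      have k: "\<delta> / 2 ^ k < 1 - t" unfolding k_def using ex by (rule LeastI)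
      then have "k \<noteq> 0" using t by (auto intro: ccontr)
      then obtain j where j: "k = Suc j" by (cases k) auto
      have "\<not> \<delta> / 2 ^ j < 1 - t" using not_less_Least[of j "\<lambda>m. \<delta> / 2 ^ m < 1 - t"] by (simp add: k_def[symmetric] j)
      then have tj: "\<theta> j < 1 - t" "1 - t \<le> 2 * \<theta> j" using k j by (auto simp: \<theta>_def)
      have "t powr x \<le> exp (- (x * \<theta> j))"
      proof -
        have "ln t \<le> - \<theta> j" using ln_le_minus_one[of t] t tj by linarith
        then have "x * ln t \<le> - (x * \<theta> j)" using x mult_left_mono[of "ln t" "- \<theta> j" x] by simp
        then show ?thesis using t by (simp add: powr_def)
      qed
      moreover have "(1 - t) powr - \<beta> \<le> \<theta> j powr - \<beta>"
        using tj \<theta>[of j] \<beta> by (intro powr_mono2') auto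
      ultimately have "t powr x * (1 - t) powr - \<beta> \<le> c j"
        unfolding c_def by (intro mult_mono) auto
      then have "ennreal (t powr x * (1 - t) powr - \<beta>) \<le> ennreal (c j) * indicator (I j) t"
        using tj t by (simp add: I_def ennreal_leI)
      also have "\<dots> \<le> (\<Sum>j. ennreal (c j) * indicator (I j) t)"
      proof -
        define g where "g i = ennreal (c i) * indicator (I i) t" for i
        have "sum g {j} \<le> suminf g" by (rule sum_le_suminf) auto
        then have "g j \<le> suminf g" by simp
        then show ?thesis unfolding g_def .
      qed
      finally show ?thesis using True by simp
    qed simp
  qed
  also have "\<dots> = (\<Sum>j. ennreal (c j) * emeasure \<mu> (I j))"
    using I by (subst nn_integral_suminf) (auto simp: nn_integral_cmult_indicator)
  also have "\<dots> \<le> ennreal (shell_const \<beta> * s * x powr (\<beta> - 1))"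
  proof (rule suminf_le_const)
    fix N
    define \<gamma> where "\<gamma> = 1 - \<beta>"
    have \<gamma>: "0 < \<gamma>" "\<gamma> \<le> 1" using \<beta> by (auto simp: \<gamma>_def)
    have "(\<Sum>j<N. ennreal (c j) * emeasure \<mu> (I j)) \<le> (\<Sum>j<N. ennreal (2 * s * x powr - \<gamma> * (4 * bump \<gamma> (x * \<theta> j))))"
    proof (intro sum_mono)
      fix j
      have "ennreal (c j) * emeasure \<mu> (I j) \<le> ennreal (c j) * ennreal (s * (2 * \<theta> j))"
        unfolding I_def using \<theta>[of j] \<theta>2[of j] by (intro mult_left_mono sublinear_uptoD[OF sub]) auto
      also have "\<dots> = ennreal (c j * (s * (2 * \<theta> j)))"
        using c0[of j] s \<theta>[of j] by (simp add: ennreal_mult)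
      also have "c j * (s * (2 * \<theta> j)) = 2 * s * x powr - \<gamma> * ((x * \<theta> j) powr \<gamma> * exp (- (x * \<theta> j)))"
      proof -
        have "\<theta> j powr - \<beta> * \<theta> j = \<theta> j powr \<gamma>"
          using \<theta>[of j] powr_add[of "\<theta> j" "- \<beta>" 1] by (simp add: \<gamma>_def)
        moreover have "x powr - \<gamma> * (x * \<theta> j) powr \<gamma> = \<theta> j powr \<gamma>"
          using x \<theta>[of j] by (simp add: powr_mult powr_minus)
        ultimately show ?thesis by (simp add: c_def mult_ac)
      qed
      also have "ennreal \<dots> \<le> ennreal (2 * s * x powr - \<gamma> * (4 * bump \<gamma> (x * \<theta> j)))"
        using s x \<theta>[of j] \<gamma> by (intro ennreal_leI mult_left_mono powr_times_exp_le_bump) auto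
      finally show "ennreal (c j) * emeasure \<mu> (I j) \<le> ennreal (2 * s * x powr - \<gamma> * (4 * bump \<gamma> (x * \<theta> j)))" .
    qed
    also have "\<dots> = ennreal (8 * s * x powr - \<gamma> * (\<Sum>j<N. bump \<gamma> (x * \<theta> j)))"
      using s by (subst sum_ennreal) (auto simp: bump_nonneg sum_distrib_left mult_ac)
    also have "\<dots> \<le> ennreal (8 * s * x powr - \<gamma> * (2 powr \<gamma> / (2 powr \<gamma> - 1) + 1))"
    proof -
      have "0 < x * \<theta> j" for j using x \<theta>[of j] by simp
      moreover have "2 * (x * \<theta> (Suc j)) \<le> x * \<theta> j" for j by (simp add: \<theta>_def mult.commute)
      ultimately have "(\<Sum>j<N. bump \<gamma> (x * \<theta> j)) \<le> 2 powr \<gamma> / (2 powr \<gamma> - 1) + 1"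
        using \<gamma>(1) by (intro bump_sum_le_decreasing) auto
      then show ?thesis using s by (intro ennreal_leI mult_left_mono) auto
    qed
    also have "8 * s * x powr - \<gamma> * (2 powr \<gamma> / (2 powr \<gamma> - 1) + 1) = shell_const \<beta> * s * x powr (\<beta> - 1)"
      by (simp add: shell_const_def \<gamma>_def algebra_simps)
    finally show "(\<Sum>j<N. ennreal (c j) * emeasure \<mu> (I j)) \<le> ennreal (shell_const \<beta> * s * x powr (\<beta> - 1))" .
  qed simp
  finally show ?thesis .
qed

lemma boundary_density_leI:
  assumes "\<And>e. 0 < e \<Longrightarrow> \<forall>\<^sub>F \<epsilon> in at_right 0. measure \<mu> {1 - \<epsilon>..<1} \<le> (x + e) * \<epsilon>" "0 \<le> x"
  shows "boundary_density \<mu> \<le> ennreal x"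
proof (rule ennreal_le_epsilon)
  fix e :: real assume e: "0 < e"
  have "\<forall>\<^sub>F \<epsilon> in at_right (0::real). 0 < \<epsilon>" by (simp add: eventually_at_filter)
  with assms(1)[OF e] have "\<forall>\<^sub>F \<epsilon> in at_right 0. emeasure \<mu> {1 - \<epsilon>..<1} / ennreal \<epsilon> \<le> ennreal (x + e)"
  proof eventually_elim
    case (elim \<epsilon>)
    then show ?case by (simp add: emeasure_eq_measure divide_ennreal ennreal_leI divide_le_eq)
  qed
  then have "boundary_density \<mu> \<le> ennreal (x + e)" unfolding boundary_density_def by (rule Limsup_bounded)
  then show "boundary_density \<mu> \<le> ennreal x + ennreal e" using e assms(2) by simp
qed

lemma boundary_density_lessD:
  assumes "boundary_density \<mu> < ennreal s"
  obtains \<delta> where "0 < \<delta>" "\<delta> < 1"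
    "sublinear_upto \<delta> s"
proof -
  have s: "0 < s" using assms by (metis ennreal_neg leI not_less_zero)
  have "\<forall>\<^sub>F \<epsilon> in at_right 0. emeasure \<mu> {1 - \<epsilon>..<1} / ennreal \<epsilon> < ennreal s"
    using assms unfolding boundary_density_def by (rule Limsup_lessD)
  then obtain b where b: "0 < b" "\<And>\<epsilon>. 0 < \<epsilon> \<Longrightarrow> \<epsilon> < b \<Longrightarrow> emeasure \<mu> {1 - \<epsilon>..<1} / ennreal \<epsilon> < ennreal s"
    by (auto simp: eventually_at_right_field)
  \<comment> \<open>Halving b turns the strict range of \<epsilon> into a closed one, and 1 / 2
    keeps the interval inside [0,1).\<close>
  have "sublinear_upto (min (b / 2) (1 / 2)) s"
    unfolding sublinear_upto_def
  proof (intro allI impI)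
    fix \<epsilon> :: real assume \<epsilon>: "0 < \<epsilon>" "\<epsilon> \<le> min (b / 2) (1 / 2)"
    then have "ennreal (measure \<mu> {1 - \<epsilon>..<1} / \<epsilon>) < ennreal s"
      using b(1) b(2)[of \<epsilon>] by (simp add: emeasure_eq_measure divide_ennreal)
    then have "measure \<mu> {1 - \<epsilon>..<1} / \<epsilon> < s" using \<epsilon> s by (subst (asm) ennreal_less_iff) auto
    then show "emeasure \<mu> {1 - \<epsilon>..<1} \<le> ennreal (s * \<epsilon>)"
      using \<epsilon> by (simp add: emeasure_eq_measure ennreal_leI divide_less_eq less_imp_le)
  qed
  then show ?thesis using b by (intro that[of "min (b / 2) (1 / 2)"]) auto
qed

lemma vanishing_sublinear_iff: "vanishing_sublinear \<mu> \<longleftrightarrow> boundary_density \<mu> = 0"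
proof
  assume "vanishing_sublinear \<mu>"
  then have lim: "((\<lambda>\<epsilon>. measure \<mu> {1 - \<epsilon>..<1} / \<epsilon>) \<longlongrightarrow> 0) (at_right 0)"
    by (simp add: vanishing_sublinear_def)
  have "boundary_density \<mu> \<le> ennreal 0"
  proof (rule boundary_density_leI)
    fix e :: real assume "0 < e"
    then have "\<forall>\<^sub>F \<epsilon> in at_right 0. measure \<mu> {1 - \<epsilon>..<1} / \<epsilon> < e" by (rule order_tendstoD(2)[OF lim])
    moreover have "\<forall>\<^sub>F \<epsilon> in at_right (0::real). 0 < \<epsilon>" by (simp add: eventually_at_filter)
    ultimately show "\<forall>\<^sub>F \<epsilon> in at_right 0. measure \<mu> {1 - \<epsilon>..<1} \<le> (0 + e) * \<epsilon>"
      by eventually_elim (simp add: divide_less_eq less_imp_le)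
  qed simp
  then show "boundary_density \<mu> = 0" by simp
next
  assume zero: "boundary_density \<mu> = 0"
  show "vanishing_sublinear \<mu>"
    unfolding vanishing_sublinear_def
  proof (rule order_tendstoI)
    fix a :: real assume "a < 0"
    have "\<forall>\<^sub>F \<epsilon> in at_right (0::real). 0 < \<epsilon>" by (simp add: eventually_at_filter)
    then show "\<forall>\<^sub>F \<epsilon> in at_right 0. a < measure \<mu> {1 - \<epsilon>..<1} / \<epsilon>"
      by eventually_elim (use \<open>a < 0\<close> in \<open>auto intro: less_le_trans\<close>)
  next
    fix a :: real assume a: "0 < a"
    have "boundary_density \<mu> < ennreal (a / 2)" using zero a by simp
    then obtain \<delta> where \<delta>: "0 < \<delta>" "sublinear_upto \<delta> (a / 2)"
      by (rule boundary_density_lessD) blast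
    show "\<forall>\<^sub>F \<epsilon> in at_right 0. measure \<mu> {1 - \<epsilon>..<1} / \<epsilon> < a"
      unfolding eventually_at_right_field
    proof (intro exI[of _ \<delta>] conjI allI impI \<delta>(1))
      fix \<epsilon> :: real assume \<epsilon>: "0 < \<epsilon>" "\<epsilon> < \<delta>"
      then have "measure \<mu> {1 - \<epsilon>..<1} \<le> a / 2 * \<epsilon>"
        using sublinear_uptoD[OF \<delta>(2), of \<epsilon>] a by (simp add: emeasure_eq_measure)
      also have "\<dots> < a * \<epsilon>" using a \<epsilon> by simp
      finally show "measure \<mu> {1 - \<epsilon>..<1} / \<epsilon> < a" using \<epsilon> by (simp add: divide_less_eq)
    qed
  qed
qed

text \<open>Common frame of the upper estimates: s stands for any number above the density and pays
  for the mass near 1, while e pays for the rest of the interval. Both slacks are sent to 0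
  here.\<close>

lemma Limsup_le_boundary_density:
  fixes J :: "nat \<Rightarrow> ennreal"
  assumes C: "0 < C" and J: "\<And>\<delta> s e. 0 < \<delta> \<Longrightarrow> \<delta> < 1 \<Longrightarrow> 0 \<le> s \<Longrightarrow>
      sublinear_upto \<delta> s \<Longrightarrow>
      0 < e \<Longrightarrow> \<forall>\<^sub>F n in sequentially. J n \<le> ennreal (C * s + e)"
  shows "limsup J \<le> ennreal C * boundary_density \<mu>"
proof (cases "boundary_density \<mu>")
  case (real x)
  have "limsup J \<le> ennreal (C * x)"
  proof (rule ennreal_le_epsilon)
    fix e :: real assume e: "0 < e"
    define s where "s = x + e / (2 * C)"
    have s: "0 < s" "x < s" using real e C by (auto simp: s_def add_nonneg_pos)
    then have "boundary_density \<mu> < ennreal s" using real by (simp add: ennreal_less_iff)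
    then obtain \<delta> where \<delta>: "0 < \<delta>" "\<delta> < 1"
      "sublinear_upto \<delta> s"
      by (rule boundary_density_lessD) blast
    have "\<forall>\<^sub>F n in sequentially. J n \<le> ennreal (C * s + e / 2)"
      by (rule J[OF \<delta>(1,2) _ \<delta>(3)]) (use s e in auto)
    then have "limsup J \<le> ennreal (C * s + e / 2)" by (rule Limsup_bounded)
    also have "C * s + e / 2 = C * x + e" using C by (simp add: s_def field_simps)
    finally show "limsup J \<le> ennreal (C * x) + ennreal e" using real C e by simp
  qed
  then show ?thesis using real C by (simp add: ennreal_mult)
next
  case top
  then show ?thesis using C by (simp add: ennreal_mult_top)
qed

end

lemma shell_const_pos: "\<beta> < 1 \<Longrightarrow> 0 < shell_const \<beta>"
  using gr_one_powr[of 2 "1 - \<beta>"] by (simp add: shell_const_def add_pos_pos)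

section \<open>The kernel of the integrals D_n(q)\<close>

context lacunary_exponent
begin

definition weight :: "real \<Rightarrow> real" where
  "weight t = (\<Sum>k. l k powr (1 / q) * t powr l k)"

definition kernel :: "nat \<Rightarrow> real \<Rightarrow> real" where
  "kernel n t = l n powr (1 / q) * t powr l n * weight t powr (q - 1)"

definition kernel_const :: real where
  "kernel_const = lac_const (1 / q) powr (q - 1) * shell_const ((q - 1) / q)"

lemma kernel_const_pos: "0 < kernel_const"
  using lac_const_pos[of "1 / q"] shell_const_pos[of "(q - 1) / q"] q_ge_1 by (simp add: kernel_const_def)

lemma measurable_weight [measurable]: "weight \<in> borel_measurable borel"
  unfolding weight_def by measurable

lemma measurable_kernel [measurable]: "kernel n \<in> borel_measurable borel"
  unfolding kernel_def by measurable

lemma kernel_nonneg: "0 \<le> kernel n t"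
  by (simp add: kernel_def)

lemma sum_le_weight:
  assumes "0 \<le> t" "t < 1"
  shows "(\<Sum>n<N. l n powr (1 / q) * t powr l n) \<le> weight t"
  unfolding weight_def using assms q_ge_1 by (intro sum_le_suminf summable_powr) auto

lemma weight_nonneg: "0 \<le> t \<Longrightarrow> t < 1 \<Longrightarrow> 0 \<le> weight t"
  using sum_le_weight[of t 0] by simp

lemma weight_le:
  assumes "0 \<le> t" "t < 1"
  shows "weight t \<le> lac_const (1 / q) * (1 - t) powr - (1 / q)"
  unfolding weight_def using assms q_ge_1 by (intro suminf_powr_le) auto

lemma weight_powr_le:
  assumes "0 \<le> t" "t < 1"
  shows "weight t powr (q - 1) \<le> lac_const (1 / q) powr (q - 1) * (1 - t) powr - ((q - 1) / q)"
proof -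
  have "weight t powr (q - 1) \<le> (lac_const (1 / q) * (1 - t) powr - (1 / q)) powr (q - 1)"
    using weight_le[OF assms] weight_nonneg[OF assms] q_ge_1 by (intro powr_mono2) auto
  also have "\<dots> = lac_const (1 / q) powr (q - 1) * (1 - t) powr - ((q - 1) / q)"
    using q_ge_1 by (simp add: powr_mult powr_powr diff_divide_distrib algebra_simps)
  finally show ?thesis .
qed

text \<open>Keeping only the n-th term w of the weight gives
  \<open>w * w powr (q - 1) = w powr q\<close>, the q-th power of the normalised monomial.\<close>

lemma kernel_ge:
  assumes t: "0 \<le> t" "t < 1"
  shows "l n * t powr (q * l n) \<le> kernel n t"
proof -
  define w where "w = l n powr (1 / q) * t powr l n"
  have w0: "0 \<le> w" by (simp add: w_def)
  have "w \<le> (\<Sum>n<Suc n. l n powr (1 / q) * t powr l n)" by (simp add: w_def sum_nonneg)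
  also have "\<dots> \<le> weight t" by (rule sum_le_weight[OF t])
  finally have "w * w powr (q - 1) \<le> kernel n t"
    unfolding kernel_def w_def[symmetric] using w0 q_ge_1 by (intro mult_left_mono powr_mono2) auto
  moreover have "w * w powr (q - 1) = w powr q"
    using w0 q_ge_1 powr_add[of w 1 "q - 1"] by simp
  moreover have "w powr q = l n * t powr (q * l n)"
    using l_pos[of n] q_ge_1 by (simp add: w_def powr_mult powr_powr mult.commute)
  ultimately show ?thesis by simp
qed

text \<open>Jensen's inequality with the weights \<open>l n powr (1 / q) * t powr l n\<close>.\<close>

lemma norm_muntz_sum_powr_le:
  fixes a :: "nat \<Rightarrow> 'a :: real_normed_field"
  assumes t: "0 \<le> t" "t < 1"
  shows "norm (muntz_sum l N a t) powr q \<le> (\<Sum>n<N. norm (a n) powr q / l n * kernel n t)"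
proof -
  define w where "w n = l n powr (1 / q) * t powr l n" for n
  define x where "x n = norm (a n) * l n powr - (1 / q)" for n
  have w0: "0 \<le> w n" for n by (simp add: w_def)
  have x0: "0 \<le> x n" for n by (simp add: x_def)
  have "norm (muntz_sum l N a t) \<le> (\<Sum>n<N. norm (a n) * t powr l n)"
    unfolding muntz_sum_def by (rule sum_norm_le) (simp add: norm_mult)
  also have "\<dots> = (\<Sum>n<N. w n * x n)"
    using l_pos by (intro sum.cong) (simp_all add: w_def x_def powr_minus field_simps less_imp_neq[symmetric])
  finally have "norm (muntz_sum l N a t) powr q \<le> (\<Sum>n<N. w n * x n) powr q"
    using q_ge_1 by (intro powr_mono2) auto
  also have "\<dots> \<le> (\<Sum>n<N. w n) powr (q - 1) * (\<Sum>n<N. w n * x n powr q)"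
    using q_ge_1 w0 x0 by (intro powr_sum_le_weighted) auto
  also have "\<dots> \<le> weight t powr (q - 1) * (\<Sum>n<N. w n * x n powr q)"
    using sum_le_weight[OF t, of N] w0 q_ge_1
    by (intro mult_right_mono powr_mono2 sum_nonneg mult_nonneg_nonneg) (auto simp: w_def)
  also have "\<dots> = (\<Sum>n<N. norm (a n) powr q / l n * kernel n t)"
  proof -
    have "x n powr q = norm (a n) powr q / l n" for n
    proof -
      have "(l n powr - (1 / q)) powr q = 1 / l n"
        using l_pos[of n] q_ge_1 by (subst powr_powr) (simp add: powr_minus divide_inverse)
      then show ?thesis by (simp add: x_def powr_mult)
    qed
    then show ?thesis unfolding sum_distrib_left by (intro sum.cong) (simp_all add: kernel_def w_def)
  qed
  finally show ?thesis .
qed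

end

section \<open>Integrals of kernels, series and monomials against the measure\<close>

locale muntz_measure = lacunary_exponent + borel_measure_unit_interval
begin

text \<open>The weight to the power \<open>q - 1\<close> costs \<open>(1 - t) powr - \<beta>\<close>
  with \<open>\<beta> = (q - 1) / q < 1\<close>. The shell estimate then yields
  \<open>l n powr (\<beta> - 1)\<close>, which cancels the factor \<open>l n powr (1 / q)\<close>,
  so the bound is uniform in n.\<close>

lemma nn_integral_kernel_near:
  assumes \<delta>: "0 < \<delta>" "\<delta> < 1" and s: "0 \<le> s"
    and sub: "sublinear_upto \<delta> s"
  shows "(\<integral>\<^sup>+ t. ennreal (kernel n t) * indicator {1 - \<delta>..<1} t \<partial>\<mu>) \<le> ennreal (kernel_const * s)"
proof -
  define \<beta> where "\<beta> = (q - 1) / q"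
  have \<beta>: "0 \<le> \<beta>" "\<beta> < 1" using q_ge_1 by (auto simp: \<beta>_def)
  define c where "c = lac_const (1 / q) powr (q - 1) * l n powr (1 / q)"
  have c: "0 \<le> c" by (simp add: c_def)
  have "(\<integral>\<^sup>+ t. ennreal (kernel n t) * indicator {1 - \<delta>..<1} t \<partial>\<mu>)
      \<le> (\<integral>\<^sup>+ t. ennreal c * (ennreal (t powr l n * (1 - t) powr - \<beta>) * indicator {1 - \<delta>..<1} t) \<partial>\<mu>)"
  proof (intro nn_integral_mono)
    fix t assume "t \<in> space \<mu>"
    then have t: "0 \<le> t" "t < 1" by auto
    have "kernel n t \<le> l n powr (1 / q) * t powr l n * (lac_const (1 / q) powr (q - 1) * (1 - t) powr - \<beta>)"
      unfolding kernel_def \<beta>_def by (intro mult_left_mono weight_powr_le t) auto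
    also have "\<dots> = c * (t powr l n * (1 - t) powr - \<beta>)" by (simp add: c_def)
    finally have "ennreal (kernel n t) \<le> ennreal c * ennreal (t powr l n * (1 - t) powr - \<beta>)"
      using c by (simp add: ennreal_leI flip: ennreal_mult)
    then show "ennreal (kernel n t) * indicator {1 - \<delta>..<1} t
        \<le> ennreal c * (ennreal (t powr l n * (1 - t) powr - \<beta>) * indicator {1 - \<delta>..<1} t)"
      by (simp add: mult_right_mono flip: mult.assoc)
  qed
  also have "\<dots> = ennreal c * (\<integral>\<^sup>+ t. ennreal (t powr l n * (1 - t) powr - \<beta>) * indicator {1 - \<delta>..<1} t \<partial>\<mu>)"
    by (rule nn_integral_cmult) measurable
  also have "\<dots> \<le> ennreal c * ennreal (shell_const \<beta> * s * l n powr (\<beta> - 1))"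
    by (intro mult_left_mono nn_integral_shells_le \<delta> s sub \<beta> l_pos) auto
  also have "\<dots> = ennreal (c * (shell_const \<beta> * s * l n powr (\<beta> - 1)))"
    using c s shell_const_pos[OF \<beta>(2)] by (simp add: ennreal_mult)
  also have "c * (shell_const \<beta> * s * l n powr (\<beta> - 1)) = kernel_const * s * (l n powr (1 / q) * l n powr (\<beta> - 1))"
    by (simp add: c_def kernel_const_def \<beta>_def mult_ac)
  also have "l n powr (1 / q) * l n powr (\<beta> - 1) = 1"
    using l_pos[of n] q_ge_1 by (simp add: \<beta>_def diff_divide_distrib flip: powr_add)
  finally show ?thesis by simp
qed

text \<open>Jensen's bound is integrated term by term; the kernel integrals are uniformly bounded,
  so the coefficients enter only through V. Fatou's lemma passes from partial sums to the series, an
  upper bound being all that is wanted.\<close>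

lemma nn_integral_series_near:
  fixes a :: "nat \<Rightarrow> 'a :: {real_normed_field, euclidean_space}"
  assumes \<delta>: "0 < \<delta>" "\<delta> < 1" and s: "0 \<le> s"
    and sub: "sublinear_upto \<delta> s"
    and a: "coeff_bound l q V a"
  shows "Lq_int_on q \<mu> {1 - \<delta>..<1} (muntz_series l a)
    \<le> ennreal (kernel_const * s * V)"
proof -
  define F where "F N t = ennreal (norm (muntz_sum l N a t) powr q) * indicator {1 - \<delta>..<1} t" for N t
  have [measurable]: "F N \<in> borel_measurable borel" for N unfolding F_def by measurable
  have V: "0 \<le> V" using a by (rule coeff_bound_nonneg)
  have "(\<integral>\<^sup>+ t. F N t \<partial>\<mu>) \<le> ennreal (kernel_const * s * V)" for N
  proof -
    have "(\<integral>\<^sup>+ t. F N t \<partial>\<mu>) \<le> (\<integral>\<^sup>+ t. (\<Sum>n<N. ennreal (norm (a n) powr q / l n) * (ennreal (kernel n t) * indicator {1 - \<delta>..<1} t)) \<partial>\<mu>)"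
    proof (intro nn_integral_mono)
      fix t assume "t \<in> space \<mu>"
      then have t: "0 \<le> t" "t < 1" by auto
      have nn: "0 \<le> norm (a n) powr q / l n" for n using l_pos[of n] by simp
      have "ennreal (norm (muntz_sum l N a t) powr q) \<le> ennreal (\<Sum>n<N. norm (a n) powr q / l n * kernel n t)"
        by (intro ennreal_leI norm_muntz_sum_powr_le t)
      also have "\<dots> = (\<Sum>n<N. ennreal (norm (a n) powr q / l n * kernel n t))"
        by (intro sum_ennreal[symmetric] mult_nonneg_nonneg nn kernel_nonneg)
      also have "\<dots> = (\<Sum>n<N. ennreal (norm (a n) powr q / l n) * ennreal (kernel n t))"
        by (intro sum.cong refl ennreal_mult nn kernel_nonneg)
      finally show "F N t \<le> (\<Sum>n<N. ennreal (norm (a n) powr q / l n) * (ennreal (kernel n t) * indicator {1 - \<delta>..<1} t))"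
        by (cases "t \<in> {1 - \<delta>..<1}") (simp_all add: F_def)
    qed
    also have "\<dots> = (\<Sum>n<N. ennreal (norm (a n) powr q / l n) * (\<integral>\<^sup>+ t. ennreal (kernel n t) * indicator {1 - \<delta>..<1} t \<partial>\<mu>))"
      by (subst nn_integral_sum, measurable, intro sum.cong refl nn_integral_cmult, measurable)
    also have "\<dots> \<le> (\<Sum>n<N. ennreal (norm (a n) powr q / l n) * ennreal (kernel_const * s))"
      by (intro sum_mono mult_left_mono nn_integral_kernel_near \<delta> s sub) auto
    also have "\<dots> = ennreal ((\<Sum>n<N. norm (a n) powr q / l n) * (kernel_const * s))"
      using l_pos kernel_const_pos s
      by (simp add: ennreal_mult sum_nonneg less_imp_le flip: sum_distrib_right)
    also have "\<dots> \<le> ennreal (V * (kernel_const * s))"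
      using a kernel_const_pos s by (intro ennreal_leI mult_right_mono) (auto simp: coeff_bound_def)
    finally show ?thesis by (simp add: mult_ac)
  qed
  then have "liminf (\<lambda>N. \<integral>\<^sup>+ t. F N t \<partial>\<mu>) \<le> ennreal (kernel_const * s * V)"
    by (intro Liminf_le always_eventually) auto
  moreover have "(\<integral>\<^sup>+ t. liminf (\<lambda>N. F N t) \<partial>\<mu>) \<le> liminf (\<lambda>N. \<integral>\<^sup>+ t. F N t \<partial>\<mu>)"
    by (rule nn_integral_liminf) measurable
  moreover have "(\<integral>\<^sup>+ t. liminf (\<lambda>N. F N t) \<partial>\<mu>)
      = Lq_int_on q \<mu> {1 - \<delta>..<1} (muntz_series l a)"
  proof (intro nn_integral_cong)
    fix t assume "t \<in> space \<mu>"
    then have t: "0 \<le> t" "t < 1" by auto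
    have "(\<lambda>N. muntz_sum l N a t) \<longlonglongrightarrow> muntz_series l a t"
      unfolding muntz_sum_def by (rule summable_LIMSEQ[OF coeff_bound_summable(1)[OF a t]])
    then have "(\<lambda>N. ennreal (norm (muntz_sum l N a t) powr q)) \<longlonglongrightarrow> ennreal (norm (muntz_series l a t) powr q)"
      using q_ge_1 by (intro tendsto_ennrealI tendsto_powr' tendsto_norm tendsto_const) auto
    then show "liminf (\<lambda>N. F N t) = ennreal (norm (muntz_series l a t) powr q) * indicator {1 - \<delta>..<1} t"
      unfolding F_def by (cases "t \<in> {1 - \<delta>..<1}") (auto intro!: lim_imp_Liminf simp: Liminf_const)
  qed
  ultimately show ?thesis by simp
qed

text \<open>Away from 1 the integrands are dominated by terms of a convergent series, evaluated at
  \<open>1 - \<delta>\<close>. These tend to 0 uniformly in t, and the measure is finite.\<close>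

lemma eventually_nn_integral_le_near:
  assumes \<delta>: "0 < \<delta>" "\<delta> < 1" and \<gamma>: "0 < \<gamma>" "\<gamma> \<le> 1" and A: "0 \<le> A" and e: "0 < e"
    and [measurable]: "\<And>n. f n \<in> borel_measurable borel"
    and far: "\<And>n t. 0 \<le> t \<Longrightarrow> t < 1 - \<delta> \<Longrightarrow> f n t \<le> A * (l n powr \<gamma> * (1 - \<delta>) powr l n)"
  shows "\<forall>\<^sub>F n in sequentially. (\<integral>\<^sup>+ t. ennreal (f n t) \<partial>\<mu>)
    \<le> (\<integral>\<^sup>+ t. ennreal (f n t) * indicator {1 - \<delta>..<1} t \<partial>\<mu>) + ennreal e"
proof -
  define m where "m = measure \<mu> (space \<mu>)"
  define c where "c n = A * (l n powr \<gamma> * (1 - \<delta>) powr l n)" for n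
  have c: "0 \<le> c n" for n using A by (simp add: c_def)
  have "(\<lambda>n. c n * m) \<longlonglongrightarrow> A * 0 * m"
    unfolding c_def using \<delta> \<gamma> by (intro tendsto_intros summable_LIMSEQ_zero summable_powr) auto
  then have "(\<lambda>n. c n * m) \<longlonglongrightarrow> 0" by simp
  then have "\<forall>\<^sub>F n in sequentially. c n * m < e" using e by (rule order_tendstoD(2))
  then show ?thesis
  proof eventually_elim
    case (elim n)
    have "(\<integral>\<^sup>+ t. ennreal (f n t) \<partial>\<mu>)
        \<le> (\<integral>\<^sup>+ t. ennreal (f n t) * indicator {1 - \<delta>..<1} t + ennreal (c n) \<partial>\<mu>)"
    proof (intro nn_integral_mono)
      fix t assume "t \<in> space \<mu>"
      then show "ennreal (f n t) \<le> ennreal (f n t) * indicator {1 - \<delta>..<1} t + ennreal (c n)"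
        using far[of t n] by (cases "t < 1 - \<delta>") (auto simp: c_def ennreal_leI)
    qed
    also have "\<dots> = (\<integral>\<^sup>+ t. ennreal (f n t) * indicator {1 - \<delta>..<1} t \<partial>\<mu>) + (\<integral>\<^sup>+ t. ennreal (c n) \<partial>\<mu>)"
      by (rule nn_integral_add) measurable
    also have "(\<integral>\<^sup>+ t. ennreal (c n) \<partial>\<mu>) = ennreal (c n * m)"
      using c[of n] by (simp add: m_def emeasure_eq_measure ennreal_mult)
    also have "\<dots> \<le> ennreal e" using elim by (intro ennreal_leI) simp
    finally show ?case by (simp add: add_left_mono)
  qed
qed

lemma limsup_kernel_le:
  "limsup (\<lambda>n. \<integral>\<^sup>+ t. ennreal (kernel n t) \<partial>\<mu>) \<le> ennreal kernel_const * boundary_density \<mu>"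
proof (rule Limsup_le_boundary_density[OF kernel_const_pos])
  fix \<delta> s e :: real
  assume \<delta>: "0 < \<delta>" "\<delta> < 1" and s: "0 \<le> s" and e: "0 < e"
    and sub: "sublinear_upto \<delta> s"
  define A where "A = lac_const (1 / q) powr (q - 1) * \<delta> powr - ((q - 1) / q)"
  have "\<forall>\<^sub>F n in sequentially. (\<integral>\<^sup>+ t. ennreal (kernel n t) \<partial>\<mu>)
      \<le> (\<integral>\<^sup>+ t. ennreal (kernel n t) * indicator {1 - \<delta>..<1} t \<partial>\<mu>) + ennreal e"
  proof (rule eventually_nn_integral_le_near[OF \<delta> _ _ _ e, where \<gamma>="1 / q" and A=A])
    fix n t assume t: "0 \<le> t" "t < 1 - \<delta>"
    have "weight t powr (q - 1) \<le> lac_const (1 / q) powr (q - 1) * (1 - t) powr - ((q - 1) / q)"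
      using t \<delta> by (intro weight_powr_le) auto
    also have "\<dots> \<le> A"
      unfolding A_def using t \<delta> q_ge_1 by (intro mult_left_mono powr_mono2') auto
    finally have "kernel n t \<le> (l n powr (1 / q) * (1 - \<delta>) powr l n) * A"
      unfolding kernel_def using t \<delta> l_pos[of n] q_ge_1
      by (intro mult_mono powr_mono2) auto
    then show "kernel n t \<le> A * (l n powr (1 / q) * (1 - \<delta>) powr l n)" by (simp add: mult.commute)
  qed (use q_ge_1 in \<open>auto simp: A_def\<close>)
  then show "\<forall>\<^sub>F n in sequentially. (\<integral>\<^sup>+ t. ennreal (kernel n t) \<partial>\<mu>) \<le> ennreal (kernel_const * s + e)"
  proof eventually_elim
    case (elim n)
    also have "(\<integral>\<^sup>+ t. ennreal (kernel n t) * indicator {1 - \<delta>..<1} t \<partial>\<mu>) + ennreal e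
        \<le> ennreal (kernel_const * s) + ennreal e"
      by (intro add_right_mono nn_integral_kernel_near \<delta> s sub)
    finally show ?case using kernel_const_pos s e by (simp add: ennreal_plus)
  qed
qed

lemma limsup_monomial_le:
  "limsup (\<lambda>n. \<integral>\<^sup>+ t. ennreal (l n * t powr l n) \<partial>\<mu>) \<le> ennreal (shell_const 0) * boundary_density \<mu>"
proof (rule Limsup_le_boundary_density[OF shell_const_pos])
  fix \<delta> s e :: real
  assume \<delta>: "0 < \<delta>" "\<delta> < 1" and s: "0 \<le> s" and e: "0 < e"
    and sub: "sublinear_upto \<delta> s"
  have near: "(\<integral>\<^sup>+ t. ennreal (l n * t powr l n) * indicator {1 - \<delta>..<1} t \<partial>\<mu>) \<le> ennreal (shell_const 0 * s)" for n
  proof -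
    \<comment> \<open>The factor \<open>(1 - t) powr - 0\<close>, equal to 1 on the interval, is
      inserted to match the shell estimate with \<beta> = 0.\<close>
    have "(\<integral>\<^sup>+ t. ennreal (l n * t powr l n) * indicator {1 - \<delta>..<1} t \<partial>\<mu>)
        = (\<integral>\<^sup>+ t. ennreal (l n) * (ennreal (t powr l n * (1 - t) powr - 0) * indicator {1 - \<delta>..<1} t) \<partial>\<mu>)"
      using l_pos[of n] by (intro nn_integral_cong) (auto simp: ennreal_mult indicator_def)
    also have "\<dots> = ennreal (l n) * (\<integral>\<^sup>+ t. ennreal (t powr l n * (1 - t) powr - 0) * indicator {1 - \<delta>..<1} t \<partial>\<mu>)"
      by (rule nn_integral_cmult) measurable
    also have "\<dots> \<le> ennreal (l n) * ennreal (shell_const 0 * s * l n powr (0 - 1))"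
      by (intro mult_left_mono nn_integral_shells_le \<delta> s sub l_pos) auto
    also have "\<dots> = ennreal (l n * (shell_const 0 * s * l n powr (0 - 1)))"
      using l_pos[of n] s shell_const_pos[of 0] by (intro ennreal_mult[symmetric] mult_nonneg_nonneg) auto
    also have "l n * (shell_const 0 * s * l n powr (0 - 1)) = shell_const 0 * s"
      using l_pos[of n] by (simp add: powr_minus)
    finally show ?thesis .
  qed
  have "\<forall>\<^sub>F n in sequentially. (\<integral>\<^sup>+ t. ennreal (l n * t powr l n) \<partial>\<mu>)
      \<le> (\<integral>\<^sup>+ t. ennreal (l n * t powr l n) * indicator {1 - \<delta>..<1} t \<partial>\<mu>) + ennreal e"
  proof (rule eventually_nn_integral_le_near[OF \<delta> _ _ _ e, where \<gamma>=1 and A=1])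
    fix n t assume t: "0 \<le> t" "t < 1 - \<delta>"
    then show "l n * t powr l n \<le> 1 * (l n powr 1 * (1 - \<delta>) powr l n)"
      using l_pos[of n] by (simp add: powr_mono2)
  qed auto
  then show "\<forall>\<^sub>F n in sequentially. (\<integral>\<^sup>+ t. ennreal (l n * t powr l n) \<partial>\<mu>) \<le> ennreal (shell_const 0 * s + e)"
  proof eventually_elim
    case (elim n)
    also have "(\<integral>\<^sup>+ t. ennreal (l n * t powr l n) * indicator {1 - \<delta>..<1} t \<partial>\<mu>) + ennreal e
        \<le> ennreal (shell_const 0 * s) + ennreal e"
      by (intro add_right_mono near)
    finally show ?case using shell_const_pos[of 0] s e by (simp add: ennreal_plus)
  qed
qed simp

text \<open>On this interval t is at least 1 / 2, because \<open>l n \<ge> 2\<close>, so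
  \<open>- ln t \<le> (1 - t) / t \<le> 2 / l n\<close> and the power of t is at least
  \<open>exp (- 2 * p)\<close>. The parameter p allows both plain monomials and their q-th
  powers.\<close>

lemma emeasure_le_nn_integral_monomial:
  assumes n: "2 \<le> l n" and p: "0 \<le> p"
  shows "ennreal (exp (- 2 * p) * l n) * emeasure \<mu> {1 - 1 / l n..<1} \<le> (\<integral>\<^sup>+ t. ennreal (l n * t powr (p * l n)) \<partial>\<mu>)"
proof -
  have "1 / l n \<le> 1" using n by simp
  then have sets: "{1 - 1 / l n..<1} \<in> sets \<mu>" by (intro Ico_in_sets_mu) simp
  have "ennreal (exp (- 2 * p) * l n) * emeasure \<mu> {1 - 1 / l n..<1}
      = (\<integral>\<^sup>+ t. ennreal (exp (- 2 * p) * l n) * indicator {1 - 1 / l n..<1} t \<partial>\<mu>)"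
    using sets by (rule nn_integral_cmult_indicator[symmetric])
  also have "\<dots> \<le> (\<integral>\<^sup>+ t. ennreal (l n * t powr (p * l n)) \<partial>\<mu>)"
  proof (intro nn_integral_mono)
    fix t
    show "ennreal (exp (- 2 * p) * l n) * indicator {1 - 1 / l n..<1} t \<le> ennreal (l n * t powr (p * l n))"
    proof (cases "t \<in> {1 - 1 / l n..<1}")
      case True
      have "1 / l n \<le> 1 / 2" using n by (intro divide_left_mono) auto
      then have t: "1 / 2 \<le> t" using True by auto
      have "ln (1 / t) \<le> 1 / t - 1" using t by (intro ln_le_minus_one) auto
      also have "\<dots> = (1 - t) / t" using t by (simp add: field_simps)
      also have "\<dots> \<le> (1 / l n) / (1 / 2)" using True t n by (intro frac_le) auto
      finally have "- ln t \<le> 2 / l n" using t by (simp add: ln_div)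
      then have "- (2 * p) \<le> p * l n * ln t"
        using n p mult_left_mono[of "- (2 / l n)" "ln t" "p * l n"] by simp
      then have "exp (- 2 * p) \<le> t powr (p * l n)" using t by (simp add: powr_def)
      then show ?thesis using True n by (simp add: ennreal_leI mult.commute)
    qed simp
  qed
  finally show ?thesis .
qed

text \<open>A small \<epsilon> lies between two consecutive values of \<open>1 / l n\<close>. The
  interval for \<epsilon> is contained in that for the larger value, which exceeds \<epsilon> by a
  factor of at most R.\<close>

lemma boundary_density_le_limsup:
  assumes R: "\<And>n. l (Suc n) \<le> R * l n" and c: "0 < c"
    and J: "\<forall>\<^sub>F n in sequentially. ennreal (c * l n) * emeasure \<mu> {1 - 1 / l n..<1} \<le> J n"
  shows "boundary_density \<mu> \<le> ennreal (R / c) * limsup J"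
proof -
  have R0: "0 < R" using R[of 0] l_pos[of 0] l_pos[of 1] by (smt (verit) One_nat_def mult_nonpos_nonneg)
  show ?thesis
  proof (cases "limsup J")
    case (real x)
    have "boundary_density \<mu> \<le> ennreal (R / c * x)"
    proof (rule boundary_density_leI)
      fix e :: real assume e: "0 < e"
      \<comment> \<open>Chosen so that \<open>y / c * R\<close> equals
        \<open>R / c * x + e\<close>.\<close>
      define y where "y = x + c / R * e"
      have y: "x < y" "0 \<le> y" using e c R0 real by (auto simp: y_def)
      have "limsup J < ennreal y" using real y by (simp add: ennreal_less_iff)
      then have "\<forall>\<^sub>F n in sequentially. J n < ennreal y" by (rule Limsup_lessD)
      moreover have "\<forall>\<^sub>F n in sequentially. 1 \<le> l n" using l_at_top by (simp add: filterlim_at_top)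
      ultimately have "\<forall>\<^sub>F n in sequentially. J n < ennreal y \<and> 1 \<le> l n \<and>
          ennreal (c * l n) * emeasure \<mu> {1 - 1 / l n..<1} \<le> J n"
        using J by eventually_elim simp
      then obtain N where N: "\<And>n. N \<le> n \<Longrightarrow> J n < ennreal y \<and> 1 \<le> l n \<and>
          ennreal (c * l n) * emeasure \<mu> {1 - 1 / l n..<1} \<le> J n"
        by (auto simp: eventually_sequentially)
      show "\<forall>\<^sub>F \<epsilon> in at_right 0. measure \<mu> {1 - \<epsilon>..<1} \<le> (R / c * x + e) * \<epsilon>"
        unfolding eventually_at_right_field
      proof (intro exI[of _ "1 / l N"] conjI allI impI)
        fix \<epsilon> :: real assume \<epsilon>: "0 < \<epsilon>" "\<epsilon> < 1 / l N"
        obtain m where "1 / \<epsilon> < l m"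
          using l_at_top unfolding filterlim_at_top_dense eventually_sequentially by blast
        define k where "k = (LEAST m. 1 / \<epsilon> < l m)"
        have k: "1 / \<epsilon> < l k" unfolding k_def using \<open>1 / \<epsilon> < l m\<close> by (rule LeastI)
        have "l N < 1 / \<epsilon>" using \<epsilon> l_pos[of N] by (simp add: field_simps)
        then have "N < k" using k l_mono[of k N] by (meson less_trans not_less order.strict_trans1)
        then obtain n where n: "k = Suc n" "N \<le> n" by (cases k) auto
        have "\<not> 1 / \<epsilon> < l n" using not_less_Least[of n "\<lambda>m. 1 / \<epsilon> < l m"] n(1) by (simp add: k_def[symmetric])
        then have \<epsilon>n: "\<epsilon> \<le> 1 / l n" using \<epsilon> l_pos[of n] by (simp add: field_simps)
        have "1 / \<epsilon> < R * l n" using k R[of n] n(1) by simp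
        then have \<epsilon>R: "1 / l n \<le> R * \<epsilon>" using \<epsilon> l_pos[of n] by (simp add: field_simps)
        have l1: "1 \<le> l n" using N[OF n(2)] by simp
        have "ennreal (c * l n * measure \<mu> {1 - 1 / l n..<1}) = ennreal (c * l n) * emeasure \<mu> {1 - 1 / l n..<1}"
          using c l_pos[of n] by (simp add: emeasure_eq_measure ennreal_mult)
        also have "\<dots> \<le> ennreal y" using N[OF n(2)] by (blast intro: order_trans less_imp_le)
        finally have "c * l n * measure \<mu> {1 - 1 / l n..<1} \<le> y" using y by (simp add: ennreal_le_iff)
        then have "measure \<mu> {1 - 1 / l n..<1} \<le> y / c * (1 / l n)" using c l_pos[of n] by (simp add: field_simps)
        also have "\<dots> \<le> y / c * (R * \<epsilon>)" using y c \<epsilon>R by (intro mult_left_mono) auto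
        also have "\<dots> = (R / c * x + e) * \<epsilon>" using c R0 by (simp add: y_def field_simps)
        finally have "measure \<mu> {1 - 1 / l n..<1} \<le> (R / c * x + e) * \<epsilon>" .
        moreover have "measure \<mu> {1 - \<epsilon>..<1} \<le> measure \<mu> {1 - 1 / l n..<1}"
          using \<epsilon>n l1 by (intro finite_measure_mono Ico_in_sets_mu) auto
        ultimately show "measure \<mu> {1 - \<epsilon>..<1} \<le> (R / c * x + e) * \<epsilon>" by simp
      qed (use l_pos[of N] in simp)
    qed (use R0 c real in simp)
    also have "ennreal (R / c * x) = ennreal (R / c) * ennreal x"
      using R0 c real by (intro ennreal_mult) auto
    finally show ?thesis by (simp only: real)
  next
    case top
    then show ?thesis using R0 c by (simp add: ennreal_mult_top)
  qed
qed

lemma boundary_density_le_limsup_monomial: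
  assumes R: "\<And>n. l (Suc n) \<le> R * l n" and p: "0 \<le> p"
  shows "boundary_density \<mu> \<le> ennreal (R / exp (- 2 * p)) * limsup (\<lambda>n. \<integral>\<^sup>+ t. ennreal (l n * t powr (p * l n)) \<partial>\<mu>)"
proof (rule boundary_density_le_limsup[OF R])
  have "\<forall>\<^sub>F n in sequentially. 2 \<le> l n" using l_at_top by (simp add: filterlim_at_top)
  then show "\<forall>\<^sub>F n in sequentially. ennreal (exp (- 2 * p) * l n) * emeasure \<mu> {1 - 1 / l n..<1}
      \<le> (\<integral>\<^sup>+ t. ennreal (l n * t powr (p * l n)) \<partial>\<mu>)"
    by eventually_elim (rule emeasure_le_nn_integral_monomial[OF _ p])
qed simp

end

section \<open>The embedding operator\<close>

context lacunary_exponent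
begin

text \<open>Fixed by choice where no measure is in scope, so that constants built from it are the
  same for all measures.\<close>

definition rep_const :: "'a :: {real_normed_field, euclidean_space} itself \<Rightarrow> real" where
  "rep_const _ = (SOME C. 0 < C \<and> (\<forall>(f :: real \<Rightarrow> 'a)\<in>muntz_space q l. \<forall>B\<ge>0.
     Lq_int q unit_interval_measure f \<le> ennreal B \<longrightarrow> (\<exists>a. muntz_rep l f a \<and> coeff_bound l q (C * B) a)))"

lemma rep_const:
  fixes f :: "real \<Rightarrow> 'a :: {real_normed_field, euclidean_space}"
  shows "0 < rep_const TYPE('a)"
    and "f \<in> muntz_space q l \<Longrightarrow> 0 \<le> B \<Longrightarrow> Lq_int q unit_interval_measure f \<le> ennreal B \<Longrightarrow>
      \<exists>a. muntz_rep l f a \<and> coeff_bound l q (rep_const TYPE('a) * B) a"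
proof -
  have "\<exists>C>0. \<forall>(f :: real \<Rightarrow> 'a)\<in>muntz_space q l. \<forall>B\<ge>0.
      Lq_int q unit_interval_measure f \<le> ennreal B \<longrightarrow> (\<exists>a. muntz_rep l f a \<and> coeff_bound l q (C * B) a)"
    by (rule muntz_space_rep)
  from someI_ex[OF this]
  show "0 < rep_const TYPE('a)" "f \<in> muntz_space q l \<Longrightarrow> 0 \<le> B \<Longrightarrow> Lq_int q unit_interval_measure f \<le> ennreal B \<Longrightarrow>
      \<exists>a. muntz_rep l f a \<and> coeff_bound l q (rep_const TYPE('a) * B) a"
    unfolding rep_const_def by blast+
qed

lemma muntz_space_obtain_rep:
  fixes f :: "real \<Rightarrow> 'a :: {real_normed_field, euclidean_space}"
  assumes "f \<in> muntz_space q l"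
  obtains a V where "muntz_rep l f a" "coeff_bound l q V a"
proof -
  have "Lq_int q unit_interval_measure f < \<infinity>"
    using assms q_ge_1 Lq_norm_finite_iff[of q unit_interval_measure f] by (simp add: muntz_space_def Lq_space_def)
  then obtain B where "0 \<le> B" "Lq_int q unit_interval_measure f = ennreal B"
    by (cases "Lq_int q unit_interval_measure f") auto
  then show ?thesis using rep_const(2)[OF assms, of B] that by auto
qed

lemma muntz_embedding_eq:
  "muntz_rep l f a \<Longrightarrow> muntz_embedding l f x = muntz_series l a x"
  by (simp add: muntz_embedding_def muntz_coeffs_eq)

lemma measurable_muntz_embedding [measurable]:
  "muntz_embedding l (f :: real \<Rightarrow> 'a :: {real_normed_field, euclidean_space}) \<in> borel_measurable borel"
  unfolding muntz_embedding_def by measurable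

text \<open>The factor \<open>l n powr (1 / q)\<close> balances the decay of the norm of the
  monomial: the integral of the q-th power is \<open>l n / (q * l n + 1)\<close>, at most 1 for
  every n.\<close>

definition unit_monomial :: "nat \<Rightarrow> real \<Rightarrow> 'a :: {real_normed_field, euclidean_space}" where
  "unit_monomial n t = of_real (l n powr (1 / q) * t powr l n)"

lemma norm_unit_monomial_powr: "norm (unit_monomial n t :: 'a :: {real_normed_field, euclidean_space}) powr q = l n * t powr (q * l n)"
  using l_pos[of n] q_ge_1 by (simp add: unit_monomial_def norm_mult powr_mult powr_powr mult.commute)

lemma measurable_unit_monomial [measurable]: "unit_monomial n \<in> borel_measurable borel"
  unfolding unit_monomial_def by measurable

lemma Lq_int_unit_monomial_le:
  "Lq_int q unit_interval_measure (unit_monomial n :: real \<Rightarrow> 'a :: {real_normed_field, euclidean_space}) \<le> 1"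
proof -
  have p: "0 < q * l n" using l_pos[of n] q_ge_1 by simp
  have "((\<lambda>t. l n * t powr (q * l n)) has_integral l n * (1 powr (q * l n + 1) / (q * l n + 1))) {0..1}"
    using p by (intro has_integral_mult_right has_integral_powr_from_0) auto
  then have "(\<integral>\<^sup>+ t. ennreal (l n * t powr (q * l n)) * indicator {0..1} t \<partial>lborel) = ennreal (l n / (q * l n + 1))"
    using l_pos[of n] by (subst nn_integral_has_integral_lebesgue') auto
  then have "Lq_int q unit_interval_measure (unit_monomial n :: real \<Rightarrow> 'a) = ennreal (l n / (q * l n + 1))"
    by (simp add: Lq_int_def nn_integral_unit_interval norm_unit_monomial_powr)
  also have "\<dots> \<le> 1"
  proof -
    have "l n \<le> q * l n + 1"
      using l_pos[of n] q_ge_1 mult_right_mono[of 1 q "l n"] by linarith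
    then have "l n / (q * l n + 1) \<le> 1" using p by (subst divide_le_eq_1_pos) auto
    then show ?thesis by simp
  qed
  finally show ?thesis .
qed

lemma unit_monomial_in_muntz_space:
  "(unit_monomial n :: real \<Rightarrow> 'a :: {real_normed_field, euclidean_space}) \<in> muntz_space q l"
proof -
  let ?f = "unit_monomial n :: real \<Rightarrow> 'a"
  define a :: "nat \<Rightarrow> 'a" where "a m = (if m = n then of_real (l n powr (1 / q)) else 0)" for m
  have "?f = (\<lambda>t. \<Sum>m<Suc n. a m * of_real (t powr l m))"
    unfolding fun_eq_iff by (simp add: a_def unit_monomial_def)
  then have "?f \<in> muntz_polynomials l" unfolding muntz_polynomials_def by blast
  moreover have "Lq_norm q unit_interval_measure (\<lambda>t. ?f t - ?f t) = 0"
    using q_ge_1 by (simp add: Lq_norm_def)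
  ultimately have "\<forall>e>0. \<exists>p\<in>muntz_polynomials l. Lq_norm q unit_interval_measure (\<lambda>t. ?f t - p t) < e"
    by (intro allI impI bexI[of _ ?f]) auto
  moreover have "Lq_norm q unit_interval_measure ?f < \<infinity>"
    using Lq_int_unit_monomial_le[of n, where 'a='a] q_ge_1
    by (auto simp: Lq_norm_finite_iff intro: le_less_trans)
  ultimately show ?thesis by (simp add: muntz_space_def Lq_space_def)
qed

lemma muntz_rep_unit_monomial:
  "muntz_rep l (unit_monomial n :: real \<Rightarrow> 'a :: {real_normed_field, euclidean_space}) (\<lambda>m. if m = n then of_real (l n powr (1 / q)) else 0)"
proof -
  have "(\<lambda>m. (if m = n then of_real (l n powr (1 / q)) else 0) * of_real (x powr l m)) sums (unit_monomial n x :: 'a)" for x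
    using sums_single[of n "\<lambda>m. of_real (l n powr (1 / q)) * of_real (x powr l m) :: 'a"]
    by (simp add: unit_monomial_def if_distrib[of "\<lambda>z. z * _"] cong: if_cong)
  then show ?thesis
    unfolding muntz_rep_def by (intro conjI ballI AE_I2 impI) (simp_all add: sums_iff)
qed

lemma muntz_embedding_unit_monomial:
  "muntz_embedding l (unit_monomial n :: real \<Rightarrow> 'a :: {real_normed_field, euclidean_space}) x = unit_monomial n x"
proof -
  have "(\<lambda>m. (if m = n then of_real (l n powr (1 / q)) else 0) * of_real (x powr l m)) sums (unit_monomial n x :: 'a)"
    using sums_single[of n "\<lambda>m. of_real (l n powr (1 / q)) * of_real (x powr l m) :: 'a"]
    by (simp add: unit_monomial_def if_distrib[of "\<lambda>z. z * _"] cong: if_cong)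
  then show ?thesis by (simp add: muntz_embedding_eq[OF muntz_rep_unit_monomial] sums_iff)
qed

lemma unit_monomial_tendsto_0:
  assumes "0 \<le> t" "t < 1" "strict_mono s"
  shows "(\<lambda>i. norm (unit_monomial (s i) t :: 'a :: {real_normed_field, euclidean_space})) \<longlonglongrightarrow> 0"
proof -
  have "(\<lambda>n. l n powr (1 / q) * t powr l n) \<longlonglongrightarrow> 0"
    using assms q_ge_1 by (intro summable_LIMSEQ_zero summable_powr) auto
  from LIMSEQ_subseq_LIMSEQ[OF this assms(3)] show ?thesis
    by (simp add: unit_monomial_def norm_mult o_def)
qed

text \<open>Each coefficient stays in a bounded set of a finite-dimensional space, so a diagonal
  argument applies.\<close>

lemma coefficients_subsequence:
  fixes b :: "nat \<Rightarrow> nat \<Rightarrow> 'a :: euclidean_space"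
  assumes b: "\<And>n. coeff_bound l q V (b n)"
  obtains s a where "strict_mono s" "\<And>j. (\<lambda>n. b (s n) j) \<longlonglongrightarrow> a j" "coeff_bound l q V a"
proof -
  interpret subseqs "\<lambda>j s. convergent (\<lambda>n. b (s n) j)"
  proof
    fix j and s :: "nat \<Rightarrow> nat"
    have "bounded (range (\<lambda>n. b (s n) j))"
      using coeff_bound_norm_le[OF b] by (intro boundedI[where B="V powr (1 / q) * l j powr (1 / q)"]) auto
    then obtain r' x where "strict_mono (r' :: nat \<Rightarrow> nat)" "((\<lambda>n. b (s n) j) \<circ> r') \<longlonglongrightarrow> x"
      using bounded_imp_convergent_subsequence by blast
    then show "\<exists>r'. strict_mono r' \<and> convergent (\<lambda>n. b ((s \<circ> r') n) j)"
      by (auto simp: convergent_def o_def)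
  qed
  \<comment> \<open>The diagonal sequence is a subsequence of the j-th extracted one only after
    discarding an initial segment, which does not affect convergence.\<close>
  have tail: "convergent (\<lambda>n. b ((diagseq \<circ> (+) (Suc j)) n) j)" for j
  proof (rule diagseq_holds)
    fix r' s :: "nat \<Rightarrow> nat" and n
    assume "strict_mono r'" "convergent (\<lambda>i. b (s i) n)"
    then show "convergent (\<lambda>i. b ((s \<circ> r') i) n)"
      using convergent_subseq_convergent[of "\<lambda>i. b (s i) n" r'] by (simp add: o_def)
  qed
  have "convergent (\<lambda>n. b (diagseq n) j)" for j
    using tail[of j] convergent_ignore_initial_segment[of "\<lambda>n. b (diagseq n) j" "Suc j"] by (simp add: o_def add.commute)
  then have a: "(\<lambda>n. b (diagseq n) j) \<longlonglongrightarrow> lim (\<lambda>n. b (diagseq n) j)" for j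
    by (simp add: convergent_LIMSEQ_iff)
  have "coeff_bound l q V (\<lambda>j. lim (\<lambda>n. b (diagseq n) j))"
    by (rule coeff_bound_limit[OF _ a]) (simp add: b)
  then show ?thesis by (rule that[OF subseq_diagseq a])
qed

end

section \<open>Far and near parts, and truncations of the embedding\<close>

context muntz_measure
begin

lemma Lq_int_eq_far_near:
  assumes [measurable]: "f \<in> borel_measurable \<mu>" and "0 < \<delta>" "\<delta> < 1"
  shows "Lq_int q \<mu> f = Lq_int_on q \<mu> {..<1 - \<delta>} f
    + Lq_int_on q \<mu> {1 - \<delta>..<1} f"
proof -
  have "Lq_int q \<mu> f = (\<integral>\<^sup>+ t. ennreal (norm (f t) powr q) * indicator {..<1 - \<delta>} t
      + ennreal (norm (f t) powr q) * indicator {1 - \<delta>..<1} t \<partial>\<mu>)"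
    unfolding Lq_int_def by (intro nn_integral_cong) (auto simp: indicator_def)
  also have "\<dots> = Lq_int_on q \<mu> {..<1 - \<delta>} f
    + Lq_int_on q \<mu> {1 - \<delta>..<1} f"
    by (rule nn_integral_add) measurable
  finally show ?thesis .
qed

definition far_bound :: "real \<Rightarrow> real \<Rightarrow> real" where
  "far_bound V \<delta> = V powr (1 / q) * lac_const (1 / q) * \<delta> powr - (1 / q)"

lemma norm_series_far:
  fixes a :: "nat \<Rightarrow> 'a :: {real_normed_field, banach}"
  assumes a: "coeff_bound l q V a" and \<delta>: "0 < \<delta>" and t: "0 \<le> t" "t < 1 - \<delta>"
  shows "norm (muntz_series l a t) \<le> far_bound V \<delta>"
proof -
  have t1: "t < 1" using t \<delta> by simp
  have "norm (muntz_series l a t) \<le> V powr (1 / q) * lac_const (1 / q) * (1 - t) powr - (1 / q)"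
    by (rule coeff_bound_summable(2)[OF a t(1) t1])
  also have "\<dots> \<le> far_bound V \<delta>"
    unfolding far_bound_def using t \<delta> q_ge_1 lac_const_pos[of "1 / q"]
    by (intro mult_left_mono powr_mono2') auto
  finally show ?thesis .
qed

lemma nn_integral_series_far:
  fixes a :: "nat \<Rightarrow> 'a :: {real_normed_field, euclidean_space}"
  assumes a: "coeff_bound l q V a" and \<delta>: "0 < \<delta>"
  shows "Lq_int_on q \<mu> {..<1 - \<delta>} (muntz_series l a) < \<infinity>"
proof -
  have "Lq_int_on q \<mu> {..<1 - \<delta>} (muntz_series l a)
      \<le> (\<integral>\<^sup>+ t. ennreal (far_bound V \<delta> powr q) \<partial>\<mu>)"
  proof (intro nn_integral_mono)
    fix t assume "t \<in> space \<mu>"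
    then show "ennreal (norm (muntz_series l a t) powr q) * indicator {..<1 - \<delta>} t \<le> ennreal (far_bound V \<delta> powr q)"
      using norm_series_far[OF a \<delta>, of t] q_ge_1
      by (auto simp: indicator_def intro!: ennreal_leI powr_mono2)
  qed
  also have "\<dots> < \<infinity>" by (simp add: emeasure_eq_measure ennreal_mult_less_top)
  finally show ?thesis .
qed

lemma Lq_int_series_finite:
  fixes a :: "nat \<Rightarrow> 'a :: {real_normed_field, euclidean_space}"
  assumes a: "coeff_bound l q V a" and fin: "boundary_density \<mu> < \<infinity>"
  shows "Lq_int q \<mu> (\<lambda>t. \<Sum>n. a n * of_real (t powr l n)) < \<infinity>"
proof -
  obtain x where x: "0 \<le> x" "boundary_density \<mu> = ennreal x" using fin by (cases "boundary_density \<mu>") auto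
  then have "boundary_density \<mu> < ennreal (x + 1)" by (simp add: ennreal_less_iff)
  then obtain \<delta> where \<delta>: "0 < \<delta>" "\<delta> < 1"
    and sub: "sublinear_upto \<delta> (x + 1)"
    by (rule boundary_density_lessD) blast
  have "Lq_int_on q \<mu> {1 - \<delta>..<1} (muntz_series l a)
      \<le> ennreal (kernel_const * (x + 1) * V)"
    by (rule nn_integral_series_near[OF \<delta> _ sub a]) (use x in auto)
  also have "\<dots> < \<infinity>" by simp
  finally show ?thesis
    using nn_integral_series_far[OF a \<delta>(1)] \<delta> by (subst Lq_int_eq_far_near[OF _ \<delta>]) auto
qed

abbreviation muntz_compact ::
    "((real \<Rightarrow> 'a :: {real_normed_field, euclidean_space}) \<Rightarrow> real \<Rightarrow> 'a) \<Rightarrow> bool" where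
  "muntz_compact \<equiv> Lq_compact_operator q unit_interval_measure (muntz_space q l) \<mu>"

abbreviation muntz_norm ::
    "((real \<Rightarrow> 'a :: {real_normed_field, euclidean_space}) \<Rightarrow> real \<Rightarrow> 'a) \<Rightarrow> ennreal" where
  "muntz_norm \<equiv> Lq_operator_norm q unit_interval_measure (muntz_space q l) \<mu>"

text \<open>With \<open>A = {..<1 - \<delta>}\<close> this is a compact approximant, with
  \<open>A = UNIV\<close> the embedding itself, so linearity is proved once for both.\<close>

definition truncated_embedding ::
    "real set \<Rightarrow> (real \<Rightarrow> 'a :: {real_normed_field, euclidean_space}) \<Rightarrow> real \<Rightarrow> 'a" where
  "truncated_embedding A f x = (if x \<in> A then muntz_embedding l f x else 0)"

lemma measurable_truncated_embedding [measurable]: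
  assumes [measurable]: "A \<in> sets borel"
  shows "truncated_embedding A f \<in> borel_measurable borel"
  unfolding truncated_embedding_def by measurable

lemma truncated_embedding_linear:
  assumes A: "A \<in> sets borel"
    and fin: "\<And>f :: real \<Rightarrow> 'a :: {real_normed_field, euclidean_space}. f \<in> muntz_space q l \<Longrightarrow> Lq_int q \<mu> (truncated_embedding A f) < \<infinity>"
  shows "Lq_linear_operator q unit_interval_measure (muntz_space q l) \<mu>
    (truncated_embedding A :: (real \<Rightarrow> 'a) \<Rightarrow> real \<Rightarrow> 'a)"
  unfolding Lq_linear_operator_def
proof (intro conjI ballI allI impI)
  fix f :: "real \<Rightarrow> 'a" assume f: "f \<in> muntz_space q l"
  show "truncated_embedding A f \<in> Lq_space q \<mu>"
    using fin[OF f] A q_ge_1 by (simp add: Lq_space_def Lq_norm_finite_iff measurable_mu measurable_truncated_embedding del: space_mu)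
  obtain a where a: "muntz_rep l f a" using muntz_space_obtain_rep[OF f] by blast
  {
    fix g :: "real \<Rightarrow> 'a" assume "AE t in unit_interval_measure. f t = g t"
    then have "muntz_rep l g a" by (rule muntz_rep_cong_AE[OF a])
    then show "AE x in \<mu>. truncated_embedding A f x = truncated_embedding A g x"
      using a by (simp add: truncated_embedding_def muntz_embedding_eq)
  }
  {
    fix g :: "real \<Rightarrow> 'a" assume g: "g \<in> muntz_space q l"
    obtain b where b: "muntz_rep l g b" using muntz_space_obtain_rep[OF g] by blast
    show "AE x in \<mu>. truncated_embedding A (\<lambda>t. f t + g t) x = truncated_embedding A f x + truncated_embedding A g x"
    proof (rule AE_I2)
      fix x assume "x \<in> space \<mu>"
      then have "summable (\<lambda>n. a n * of_real (x powr l n))" "summable (\<lambda>n. b n * of_real (x powr l n))"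
        using a b by (auto simp: muntz_rep_def)
      then show "truncated_embedding A (\<lambda>t. f t + g t) x = truncated_embedding A f x + truncated_embedding A g x"
        by (simp add: truncated_embedding_def muntz_embedding_eq[OF a] muntz_embedding_eq[OF b]
            muntz_embedding_eq[OF muntz_rep_add[OF a b]] suminf_add distrib_right)
    qed
  }
  {
    fix c :: 'a
    show "AE x in \<mu>. truncated_embedding A (\<lambda>t. c * f t) x = c * truncated_embedding A f x"
    proof (rule AE_I2)
      fix x assume "x \<in> space \<mu>"
      then have "summable (\<lambda>n. a n * of_real (x powr l n))" using a by (auto simp: muntz_rep_def)
      then show "truncated_embedding A (\<lambda>t. c * f t) x = c * truncated_embedding A f x"
        by (simp add: truncated_embedding_def muntz_embedding_eq[OF a]
            muntz_embedding_eq[OF muntz_rep_mult[OF a]] suminf_mult mult.assoc)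
    qed
  }
qed

end

section \<open>Compactness, and the essential norm from both sides\<close>

context muntz_measure
begin

text \<open>Dominated convergence: on [0, 1 - \<delta>) both series obey the bound
  \<open>far_bound V \<delta>\<close>, and constants are integrable for a finite measure.\<close>

lemma nn_integral_series_far_tendsto:
  fixes a :: "nat \<Rightarrow> 'a :: {real_normed_field, euclidean_space}"
  assumes b: "\<And>n. coeff_bound l q V (b n)" and a: "coeff_bound l q V a"
    and lim: "\<And>j. (\<lambda>n. b n j) \<longlonglongrightarrow> a j" and \<delta>: "0 < \<delta>"
  shows "(\<lambda>n. \<integral>\<^sup>+ t. ennreal (norm (muntz_series l (b n) t - muntz_series l a t) powr q)
      * indicator {..<1 - \<delta>} t \<partial>\<mu>) \<longlonglongrightarrow> 0"
proof -
  define d where "d n t = ennreal (norm (muntz_series l (b n) t - muntz_series l a t) powr q)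
      * indicator {..<1 - \<delta>} t" for n t
  have [measurable]: "d n \<in> borel_measurable borel" for n unfolding d_def by measurable
  have "(\<lambda>n. \<integral>\<^sup>+ t. d n t \<partial>\<mu>) \<longlonglongrightarrow> (\<integral>\<^sup>+ t. 0 \<partial>\<mu>)"
  proof (rule nn_integral_dominated_convergence[where w="\<lambda>_. ennreal ((2 * far_bound V \<delta>) powr q)"])
    show "AE t in \<mu>. d n t \<le> ennreal ((2 * far_bound V \<delta>) powr q)" for n
    proof (rule AE_I2)
      fix t assume "t \<in> space \<mu>"
      then have t: "0 \<le> t" by simp
      show "d n t \<le> ennreal ((2 * far_bound V \<delta>) powr q)"
      proof (cases "t < 1 - \<delta>")
        case True
        have "norm (muntz_series l (b n) t - muntz_series l a t)
            \<le> norm (muntz_series l (b n) t) + norm (muntz_series l a t)"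
          by (rule norm_triangle_ineq4)
        also have "\<dots> \<le> 2 * far_bound V \<delta>"
          using norm_series_far[OF b \<delta> t True, of n] norm_series_far[OF a \<delta> t True] by simp
        finally show ?thesis
          using q_ge_1 by (auto simp: d_def indicator_def intro!: ennreal_leI powr_mono2)
      qed (simp add: d_def)
    qed
    show "AE t in \<mu>. (\<lambda>n. d n t) \<longlonglongrightarrow> 0"
    proof (rule AE_I2)
      fix t assume "t \<in> space \<mu>"
      then have t: "0 \<le> t" "t < 1" by auto
      have "(\<lambda>n. (muntz_series l (b n) t) - (muntz_series l a t)) \<longlonglongrightarrow> 0"
        using muntz_series_tendsto[OF b lim t] by (simp add: LIM_zero)
      then have "(\<lambda>n. norm (muntz_series l (b n) t - muntz_series l a t) powr q) \<longlonglongrightarrow> 0 powr q"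
        using q_ge_1 by (intro tendsto_powr' tendsto_norm_zero tendsto_const) auto
      then have "(\<lambda>n. ennreal (norm (muntz_series l (b n) t - muntz_series l a t) powr q)) \<longlonglongrightarrow> ennreal 0"
        by (intro tendsto_ennrealI) simp
      then show "(\<lambda>n. d n t) \<longlonglongrightarrow> 0"
        unfolding d_def by (cases "t < 1 - \<delta>") auto
    qed
  qed (auto simp: emeasure_eq_measure ennreal_mult_less_top)
  then show ?thesis by (simp add: d_def)
qed

lemma nn_integral_series_diff_near:
  fixes a b :: "nat \<Rightarrow> 'a :: {real_normed_field, euclidean_space}"
  assumes \<delta>: "0 < \<delta>" "\<delta> < 1" and s: "0 \<le> s"
    and sub: "sublinear_upto \<delta> s"
    and a: "coeff_bound l q V a" and b: "coeff_bound l q V b"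
  shows "Lq_int_on q \<mu> {1 - \<delta>..<1} (\<lambda>t. muntz_series l b t - muntz_series l a t) \<le> ennreal (kernel_const * s * (2 powr q * (V + V)))"
proof -
  have "Lq_int_on q \<mu> {1 - \<delta>..<1} (\<lambda>t. muntz_series l b t - muntz_series l a t)
    = Lq_int_on q \<mu> {1 - \<delta>..<1} (\<lambda>t. \<Sum>j. (b j - a j) * of_real (t powr l j))"
  proof (intro nn_integral_cong)
    fix t assume "t \<in> space \<mu>"
    then have t: "0 \<le> t" "t < 1" by auto
    have "muntz_series l b t - muntz_series l a t
        = (\<Sum>j. (b j - a j) * of_real (t powr l j))"
      using coeff_bound_summable(1)[OF a t] coeff_bound_summable(1)[OF b t]
      by (simp add: suminf_diff left_diff_distrib)
    then show "ennreal (norm (muntz_series l b t - muntz_series l a t) powr q)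
        * indicator {1 - \<delta>..<1} t
      = ennreal (norm (\<Sum>j. (b j - a j) * of_real (t powr l j)) powr q) * indicator {1 - \<delta>..<1} t" by simp
  qed
  also have "\<dots> \<le> ennreal (kernel_const * s * (2 powr q * (V + V)))"
    by (rule nn_integral_series_near[OF \<delta> s sub coeff_bound_diff[OF b a]])
  finally show ?thesis .
qed

lemma Lq_int_truncated_far_finite:
  fixes f :: "real \<Rightarrow> 'a :: {real_normed_field, euclidean_space}"
  assumes f: "f \<in> muntz_space q l" and \<delta>: "0 < \<delta>"
  shows "Lq_int q \<mu> (truncated_embedding {..<1 - \<delta>} f) < \<infinity>"
proof -
  obtain a V where a: "muntz_rep l f a" "coeff_bound l q V a" using muntz_space_obtain_rep[OF f] .
  have "Lq_int q \<mu> (truncated_embedding {..<1 - \<delta>} f)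
      = Lq_int_on q \<mu> {..<1 - \<delta>} (muntz_series l a)"
    unfolding Lq_int_def using q_ge_1
    by (intro nn_integral_cong) (simp add: truncated_embedding_def muntz_embedding_eq[OF a(1)])
  then show ?thesis using nn_integral_series_far[OF a(2) \<delta>] by simp
qed

lemma unit_ball_subsequence:
  fixes F :: "nat \<Rightarrow> real \<Rightarrow> 'a :: {real_normed_field, euclidean_space}"
  assumes F: "\<And>n. F n \<in> muntz_space q l \<and> Lq_norm q unit_interval_measure (F n) \<le> 1"
  obtains s b a where "strict_mono s" "\<And>n. muntz_rep l (F n) (b n)"
    "\<And>n. coeff_bound l q (rep_const TYPE('a)) (b (s n))" "coeff_bound l q (rep_const TYPE('a)) a"
    "\<And>j. (\<lambda>n. b (s n) j) \<longlonglongrightarrow> a j"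
proof -
  have "\<exists>a. muntz_rep l (F n) a \<and> coeff_bound l q (rep_const TYPE('a) * 1) a" for n
    using F[of n] q_ge_1 by (intro rep_const(2)) (auto simp: Lq_norm_le_1_iff)
  then obtain b where b: "\<And>n. muntz_rep l (F n) (b n)" "\<And>n. coeff_bound l q (rep_const TYPE('a)) (b n)"
    by (simp add: mult_1_right) metis
  obtain s a where s: "strict_mono s" and lim: "\<And>j. (\<lambda>n. b (s n) j) \<longlonglongrightarrow> a j"
    and a: "coeff_bound l q (rep_const TYPE('a)) a"
    by (rule coefficients_subsequence[where b=b and V="rep_const TYPE('a)"]; use b(2) in blast)
  show ?thesis by (rule that[of s b a]) (fact s b a lim)+
qed

lemma truncated_embedding_compact:
  assumes \<delta>: "0 < \<delta>"
  shows "muntz_compact (truncated_embedding {..<1 - \<delta>} :: (real \<Rightarrow> 'a :: {real_normed_field, euclidean_space}) \<Rightarrow> real \<Rightarrow> 'a)"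
  unfolding Lq_compact_operator_def
proof (intro conjI allI impI)
  let ?K = "truncated_embedding {..<1 - \<delta>} :: (real \<Rightarrow> 'a) \<Rightarrow> real \<Rightarrow> 'a"
  show "Lq_linear_operator q unit_interval_measure (muntz_space q l) \<mu> ?K"
    using Lq_int_truncated_far_finite[OF _ \<delta>] by (intro truncated_embedding_linear) auto
  fix F :: "nat \<Rightarrow> real \<Rightarrow> 'a"
  assume F: "\<forall>n. F n \<in> muntz_space q l \<and> Lq_norm q unit_interval_measure (F n) \<le> 1"
  let ?V = "rep_const TYPE('a)"
  obtain s b a where s: "strict_mono s" and rep: "\<And>n. muntz_rep l (F n) (b n)"
    and b: "\<And>n. coeff_bound l q ?V (b (s n))" and a: "coeff_bound l q ?V a"
    and lim: "\<And>j. (\<lambda>n. b (s n) j) \<longlonglongrightarrow> a j"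
    by (rule unit_ball_subsequence[where F=F]; use F in blast)
  define g where "g t = (if t \<in> {..<1 - \<delta>} then (muntz_series l a t) else 0)" for t
  have gm: "g \<in> borel_measurable \<mu>" unfolding g_def by measurable
  have "Lq_int q \<mu> g = Lq_int_on q \<mu> {..<1 - \<delta>} (muntz_series l a)"
    unfolding Lq_int_def using q_ge_1 by (intro nn_integral_cong) (simp add: g_def)
  then have "Lq_int q \<mu> g < top" using nn_integral_series_far[OF a \<delta>] by simp
  then have gL: "g \<in> Lq_space q \<mu>" using gm q_ge_1 by (simp add: Lq_space_def Lq_norm_finite_iff)
  have "Lq_int q \<mu> (\<lambda>x. ?K (F (s n)) x - g x) = Lq_int_on q \<mu> {..<1 - \<delta>} (\<lambda>t. muntz_series l (b (s n)) t - muntz_series l a t)" for n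
    unfolding Lq_int_def using q_ge_1
    by (intro nn_integral_cong) (simp add: g_def truncated_embedding_def muntz_embedding_eq[OF rep])
  then have "(\<lambda>n. Lq_int q \<mu> (\<lambda>x. ?K (F (s n)) x - g x)) \<longlonglongrightarrow> 0"
    using nn_integral_series_far_tendsto[OF b a lim \<delta>] by simp
  then have "(\<lambda>n. Lq_norm q \<mu> (\<lambda>x. ?K (F (s n)) x - g x)) \<longlonglongrightarrow> 0"
    using q_ge_1 by (simp add: Lq_norm_eq tendsto_ennroot_0_iff)
  with s gL show "\<exists>g\<in>Lq_space q \<mu>. \<exists>s. strict_mono s \<and> (\<lambda>n. Lq_norm q \<mu> (\<lambda>x. ?K (F (s n)) x - g x)) \<longlonglongrightarrow> 0"
    by blast
qed

text \<open>The subsequence is extracted from the coefficients alone, so it serves every \<delta> at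
  once. Vanishing density makes the near part small uniformly in n, and the far part tends to 0; no
  limit of compact operators has to be formed.\<close>

lemma muntz_embedding_compact:
  assumes zero: "boundary_density \<mu> = 0"
  shows "muntz_compact (muntz_embedding l :: (real \<Rightarrow> 'a :: {real_normed_field, euclidean_space}) \<Rightarrow> real \<Rightarrow> 'a)"
  unfolding Lq_compact_operator_def
proof (intro conjI allI impI)
  let ?T = "muntz_embedding l :: (real \<Rightarrow> 'a) \<Rightarrow> real \<Rightarrow> 'a"
  have T: "truncated_embedding UNIV = ?T" by (simp add: truncated_embedding_def fun_eq_iff)
  have "Lq_int q \<mu> (?T f) < \<infinity>" if f: "f \<in> muntz_space q l" for f
  proof -
    obtain a V where a: "muntz_rep l f a" "coeff_bound l q V a" using muntz_space_obtain_rep[OF f] .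
    have "?T f = (\<lambda>t. \<Sum>n. a n * of_real (t powr l n))" by (simp add: fun_eq_iff muntz_embedding_eq[OF a(1)])
    then show ?thesis using Lq_int_series_finite[OF a(2)] zero by simp
  qed
  then show "Lq_linear_operator q unit_interval_measure (muntz_space q l) \<mu> ?T"
    using truncated_embedding_linear[of UNIV, where 'a='a, unfolded T] by simp
  fix F :: "nat \<Rightarrow> real \<Rightarrow> 'a"
  assume F: "\<forall>n. F n \<in> muntz_space q l \<and> Lq_norm q unit_interval_measure (F n) \<le> 1"
  let ?V = "rep_const TYPE('a)"
  obtain s b a where s: "strict_mono s" and rep: "\<And>n. muntz_rep l (F n) (b n)"
    and b: "\<And>n. coeff_bound l q ?V (b (s n))" and a: "coeff_bound l q ?V a"
    and lim: "\<And>j. (\<lambda>n. b (s n) j) \<longlonglongrightarrow> a j"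
    by (rule unit_ball_subsequence[where F=F]; use F in blast)
  define g where "g t = muntz_series l a t" for t
  have [measurable]: "g \<in> borel_measurable borel" unfolding g_def by measurable
  have "Lq_int q \<mu> g < top" unfolding g_def using Lq_int_series_finite[OF a] zero by simp
  then have gL: "g \<in> Lq_space q \<mu>" using q_ge_1 by (simp add: Lq_space_def Lq_norm_finite_iff measurable_mu)
  define d where "d n t = ?T (F (s n)) t - g t" for n t
  have [measurable]: "d n \<in> borel_measurable borel" for n unfolding d_def by measurable
  have d: "d n t = muntz_series l (b (s n)) t - (muntz_series l a t)" for n t
    by (simp add: d_def g_def muntz_embedding_eq[OF rep])
  have "(\<lambda>n. Lq_int q \<mu> (d n)) \<longlonglongrightarrow> 0"
  proof (rule order_tendstoI)
    fix e :: ennreal assume "0 < e"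
    then obtain z where z: "0 < z" "z < e" using dense by blast
    then obtain e' where "z = ennreal e'" "0 \<le> e'" by (cases z) auto
    with z have e': "0 < e'" "ennreal e' < e" by auto
    define c where "c = kernel_const * (2 powr q * (?V + ?V))"
    have c: "0 < c" using kernel_const_pos rep_const(1)[where 'a='a] by (simp add: c_def add_pos_pos)
    \<comment> \<open>With this value \<open>c * s' = e' / 2\<close>, so the near part takes half of
      the tolerance.\<close>
    define s' where "s' = e' / (2 * c)"
    have s': "0 < s'" using e' c by (simp add: s'_def)
    then have "boundary_density \<mu> < ennreal s'" using zero by simp
    then obtain \<delta> where \<delta>: "0 < \<delta>" "\<delta> < 1"
      and sub: "sublinear_upto \<delta> s'"
      by (rule boundary_density_lessD) blast
    have near: "Lq_int_on q \<mu> {1 - \<delta>..<1} (d n) \<le> ennreal (e' / 2)" for n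
    proof -
      have "Lq_int_on q \<mu> {1 - \<delta>..<1} (d n)
          \<le> ennreal (kernel_const * s' * (2 powr q * (?V + ?V)))"
        unfolding d by (rule nn_integral_series_diff_near[OF \<delta> _ sub a b]) (use s' in auto)
      also have "kernel_const * s' * (2 powr q * (?V + ?V)) = c * s'" by (simp add: c_def)
      also have "c * s' = e' / 2" using c by (simp add: s'_def)
      finally show ?thesis .
    qed
    have far: "\<forall>\<^sub>F n in sequentially. Lq_int_on q \<mu> {..<1 - \<delta>} (d n) < ennreal (e' / 2)"
      using nn_integral_series_far_tendsto[OF b a lim \<delta>(1)] e' unfolding d by (intro order_tendstoD(2)) auto
    then show "\<forall>\<^sub>F n in sequentially. Lq_int q \<mu> (d n) < e"
    proof eventually_elim
      case (elim n)
      have "Lq_int q \<mu> (d n) = Lq_int_on q \<mu> {..<1 - \<delta>} (d n)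
          + Lq_int_on q \<mu> {1 - \<delta>..<1} (d n)"
        by (rule Lq_int_eq_far_near[OF _ \<delta>]) measurable
      also have "\<dots> \<le> ennreal (e' / 2) + ennreal (e' / 2)" using elim near[of n] by (intro add_mono) auto
      also have "\<dots> = ennreal e'" using e' by (simp flip: ennreal_plus)
      finally show ?case using e'(2) by (rule le_less_trans)
    qed
  qed simp
  then have "(\<lambda>n. Lq_norm q \<mu> (\<lambda>x. ?T (F (s n)) x - g x)) \<longlonglongrightarrow> 0"
    using q_ge_1 by (simp add: Lq_norm_eq tendsto_ennroot_0_iff d_def[abs_def])
  with s gL show "\<exists>g\<in>Lq_space q \<mu>. \<exists>s. strict_mono s \<and> (\<lambda>n. Lq_norm q \<mu> (\<lambda>x. ?T (F (s n)) x - g x)) \<longlonglongrightarrow> 0"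
    by blast
qed

text \<open>The truncation to [0, 1 - \<delta>) is an admissible compact operator. What it leaves of
  the embedding lives on [1 - \<delta>, 1), where the series estimate is linear in s.\<close>

lemma essential_norm_le:
  "ennroot (1 / q) (embedding_essential_norm TYPE('a :: {real_normed_field, euclidean_space}) q l \<mu>)
    \<le> ennreal (kernel_const * rep_const TYPE('a)) * boundary_density \<mu>" (is "ennroot _ ?ess \<le> ennreal ?C * _")
proof (cases "boundary_density \<mu>")
  case (real x)
  have C: "0 < ?C" using kernel_const_pos rep_const(1)[where 'a='a] by simp
  have "ennroot (1 / q) ?ess \<le> ennreal (?C * x)"
  proof (rule ennreal_le_epsilon)
    fix e :: real assume e: "0 < e"
    define s where "s = x + e / ?C"
    have s: "0 \<le> s" "x < s" using real e C by (auto simp: s_def add_nonneg_nonneg)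
    have "boundary_density \<mu> < ennreal s" using real s by (simp add: ennreal_less_iff)
    then obtain \<delta> where \<delta>: "0 < \<delta>" "\<delta> < 1"
      and sub: "sublinear_upto \<delta> s"
      by (rule boundary_density_lessD) blast
    let ?T = "muntz_embedding l :: (real \<Rightarrow> 'a) \<Rightarrow> real \<Rightarrow> 'a"
    let ?K = "truncated_embedding {..<1 - \<delta>} :: (real \<Rightarrow> 'a) \<Rightarrow> real \<Rightarrow> 'a"
    have "?ess \<le> muntz_norm (\<lambda>f x. ?T f x - ?K f x)"
      unfolding embedding_essential_norm_def Lq_essential_norm_def
      by (rule INF_lower) (simp add: truncated_embedding_compact[OF \<delta>(1)])
    also have "\<dots> \<le> ennroot q (ennreal (?C * s))"
      unfolding Lq_operator_norm_def
    proof (rule SUP_least)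
      fix f :: "real \<Rightarrow> 'a" assume f: "f \<in> {f \<in> muntz_space q l. Lq_norm q unit_interval_measure f \<le> 1}"
      then have "Lq_int q unit_interval_measure f \<le> ennreal 1" using q_ge_1 by (simp add: Lq_norm_le_1_iff)
      then obtain a where a: "muntz_rep l f a" "coeff_bound l q (rep_const TYPE('a) * 1) a"
        using rep_const(2)[of f 1] f by auto
      have "Lq_int q \<mu> (\<lambda>x. ?T f x - ?K f x)
          = Lq_int_on q \<mu> {1 - \<delta>..<1} (muntz_series l a)"
        unfolding Lq_int_def using q_ge_1
        by (intro nn_integral_cong) (auto simp: truncated_embedding_def muntz_embedding_eq[OF a(1)] indicator_def)
      also have "\<dots> \<le> ennreal (kernel_const * s * (rep_const TYPE('a) * 1))"
        by (rule nn_integral_series_near[OF \<delta> s(1) sub a(2)])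
      finally show "Lq_norm q \<mu> (\<lambda>x. ?T f x - ?K f x) \<le> ennroot q (ennreal (?C * s))"
        unfolding Lq_norm_eq using q_ge_1 by (intro ennroot_mono) (auto simp: mult_ac)
    qed
    finally have "ennroot (1 / q) ?ess \<le> ennroot (1 / q) (ennroot q (ennreal (?C * s)))"
      using q_ge_1 by (intro ennroot_mono) auto
    also have "\<dots> = ennreal (?C * s)" using q_ge_1 by (simp add: ennroot_inverse)
    also have "?C * s = ?C * x + e"
    proof -
      have "c * (x + e / c) = c * x + e" if "0 < c" for c using that by (simp add: field_simps)
      from this[OF C] show ?thesis unfolding s_def .
    qed
    also have "ennreal (?C * x + e) = ennreal (?C * x) + ennreal e"
      using C e real by (intro ennreal_plus) auto
    finally show "ennroot (1 / q) ?ess \<le> ennreal (?C * x) + ennreal e" .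
  qed
  also have "ennreal (?C * x) = ennreal ?C * ennreal x" using C real by (intro ennreal_mult) auto
  finally show ?thesis by (simp only: real)
next
  case top
  have C: "0 < ?C" using kernel_const_pos rep_const(1)[where 'a='a] by simp
  have "ennreal c * top = (top :: ennreal)" if "0 < c" for c using that by (simp add: ennreal_mult_top)
  from this[OF C] show ?thesis by (simp only: \<open>boundary_density \<mu> = top\<close> top_greatest)
qed

text \<open>The normalised monomials tend to \<open>0\<close> pointwise, so by Fatou's lemma a cluster point \<open>g\<close> of their images
  under a compact operator \<open>K\<close> has norm at most a multiple of the norm of the difference of the embedding and \<open>K\<close>.\<close>

lemma limsup_monomial_le_operator_norm:
  fixes K :: "(real \<Rightarrow> 'a :: {real_normed_field, euclidean_space}) \<Rightarrow> real \<Rightarrow> 'a"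
  assumes K: "muntz_compact K"
  defines "M \<equiv> muntz_norm (\<lambda>f x. muntz_embedding l f x - K f x)"
  shows "limsup (\<lambda>n. \<integral>\<^sup>+ t. ennreal (l n * t powr (q * l n)) \<partial>\<mu>) \<le> ennreal (2 * 2 powr q * 2 powr q) * ennroot (1 / q) M"
proof -
  let ?U = unit_interval_measure
  define J where "J n = (\<integral>\<^sup>+ t. ennreal (l n * t powr (q * l n)) \<partial>\<mu>)" for n
  \<comment> \<open>The upper limit is realised along a subsequence before compactness is used, so
    the further subsequence that compactness selects keeps the same limit.\<close>
  obtain \<rho> where \<rho>: "strict_mono \<rho>" and J\<rho>: "(J \<circ> \<rho>) \<longlonglongrightarrow> limsup J"
    using limsup_subseq_lim[of J] by blast
  define F where "F i = (unit_monomial (\<rho> i) :: real \<Rightarrow> 'a)" for i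
  have F: "F i \<in> muntz_space q l \<and> Lq_norm q ?U (F i) \<le> 1" for i
    using q_ge_1 by (simp add: F_def Lq_norm_le_1_iff unit_monomial_in_muntz_space Lq_int_unit_monomial_le)
  obtain g s where g: "g \<in> Lq_space q \<mu>" and s: "strict_mono s"
    and lim: "(\<lambda>n. Lq_norm q \<mu> (\<lambda>x. K (F (s n)) x - g x)) \<longlonglongrightarrow> 0"
    using K F unfolding Lq_compact_operator_def by blast
  define N where "N = ennroot (1 / q) M"
  define G where "G i = F (s i)" for i
  define e where "e i = Lq_int q \<mu> (\<lambda>x. K (G i) x - g x)" for i
  have [measurable]: "g \<in> borel_measurable \<mu>" using g by (simp add: Lq_space_def)
  have [measurable]: "K (G i) \<in> borel_measurable \<mu>" for i
    using K F unfolding Lq_compact_operator_def Lq_linear_operator_def Lq_space_def G_def by blast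
  have Gb: "G i \<in> borel_measurable borel" for i unfolding G_def F_def by measurable
  then have [measurable]: "G i \<in> borel_measurable \<mu>" for i by (rule measurable_mu)
  have e_lim: "e \<longlonglongrightarrow> 0"
    using lim q_ge_1 by (simp add: Lq_norm_eq tendsto_ennroot_0_iff e_def[abs_def] G_def)
  have JG: "J (\<rho> (s i)) = Lq_int q \<mu> (G i)" for i
    by (simp add: J_def Lq_int_def G_def F_def norm_unit_monomial_powr)
  have TK: "Lq_int q \<mu> (\<lambda>x. G i x - K (G i) x) \<le> N" for i
  proof -
    have "Lq_norm q \<mu> (\<lambda>x. muntz_embedding l (G i) x - K (G i) x) \<le> M"
      unfolding M_def Lq_operator_norm_def using F by (intro SUP_upper) (simp add: G_def)
    then have "ennroot (1 / q) (ennroot q (Lq_int q \<mu> (\<lambda>x. G i x - K (G i) x))) \<le> N"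
      unfolding N_def using q_ge_1
      by (intro ennroot_mono) (auto simp: Lq_norm_eq G_def F_def muntz_embedding_unit_monomial)
    then show ?thesis using q_ge_1 by (simp add: ennroot_inverse)
  qed
  have d_le: "Lq_int q \<mu> (\<lambda>x. G i x - g x) \<le> ennreal (2 powr q) * (N + e i)" for i
  proof -
    have "Lq_int q \<mu> (\<lambda>x. G i x - g x)
        \<le> ennreal (2 powr q) * (Lq_int q \<mu> (\<lambda>x. G i x - K (G i) x) + Lq_int q \<mu> (\<lambda>x. K (G i) x - g x))"
    proof (rule Lq_int_add_le[OF q_ge_1])
      fix x
      show "norm (G i x - g x) \<le> norm (G i x - K (G i) x) + norm (K (G i) x - g x)"
        using norm_triangle_ineq[of "G i x - K (G i) x" "K (G i) x - g x"] by simp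
    qed measurable
    also have "\<dots> \<le> ennreal (2 powr q) * (N + e i)"
      unfolding e_def by (intro mult_left_mono add_right_mono TK) simp
    finally show ?thesis .
  qed
  have bound_lim: "(\<lambda>i. ennreal (2 powr q) * (N + e i)) \<longlonglongrightarrow> ennreal (2 powr q) * (N + 0)"
    by (intro ennreal_tendsto_cmult tendsto_add tendsto_const e_lim) simp
  have g_le: "Lq_int q \<mu> g \<le> ennreal (2 powr q) * N"
  proof -
    have "Lq_int q \<mu> g = (\<integral>\<^sup>+ t. liminf (\<lambda>i. ennreal (norm (G i t - g t) powr q)) \<partial>\<mu>)"
      unfolding Lq_int_def
    proof (intro nn_integral_cong)
      fix t assume "t \<in> space \<mu>"
      then have t: "0 \<le> t" "t < 1" by auto
      have "(\<lambda>i. norm (G i t)) \<longlonglongrightarrow> 0"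
        using unit_monomial_tendsto_0[OF t strict_mono_o[OF \<rho> s], where 'a='a] by (simp add: G_def F_def)
      then have "(\<lambda>i. G i t - g t) \<longlonglongrightarrow> 0 - g t"
        by (intro tendsto_diff tendsto_const) (simp add: tendsto_norm_zero_iff)
      then have "(\<lambda>i. norm (G i t - g t) powr q) \<longlonglongrightarrow> norm (0 - g t) powr q"
        using q_ge_1 by (intro tendsto_powr' tendsto_norm tendsto_const) auto
      then have "(\<lambda>i. ennreal (norm (G i t - g t) powr q)) \<longlonglongrightarrow> ennreal (norm (g t) powr q)"
        by (intro tendsto_ennrealI) simp
      then show "ennreal (norm (g t) powr q) = liminf (\<lambda>i. ennreal (norm (G i t - g t) powr q))"
        by (rule lim_imp_Liminf[OF sequentially_bot, symmetric])
    qed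
    also have "\<dots> \<le> liminf (\<lambda>i. Lq_int q \<mu> (\<lambda>x. G i x - g x))"
      unfolding Lq_int_def by (rule nn_integral_liminf) measurable
    also have "\<dots> \<le> liminf (\<lambda>i. ennreal (2 powr q) * (N + e i))"
      by (intro Liminf_mono always_eventually allI d_le)
    also have "\<dots> = ennreal (2 powr q) * (N + 0)"
      by (rule lim_imp_Liminf[OF _ bound_lim]) simp
    finally show ?thesis by simp
  qed
  \<comment> \<open>A second quasi-triangle inequality, around g. Together with the first it
    accounts for the two factors \<open>2 powr q\<close>; the remaining 2 comes from adding the
    equal limiting bounds for g and for the difference.\<close>
  have G_le: "J (\<rho> (s i)) \<le> ennreal (2 powr q) * (ennreal (2 powr q) * (N + e i) + ennreal (2 powr q) * N)" for i
  proof -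
    have "Lq_int q \<mu> (G i) \<le> ennreal (2 powr q) * (Lq_int q \<mu> (\<lambda>x. G i x - g x) + Lq_int q \<mu> g)"
    proof (rule Lq_int_add_le[OF q_ge_1])
      fix x
      show "norm (G i x) \<le> norm (G i x - g x) + norm (g x)"
        using norm_triangle_ineq[of "G i x - g x" "g x"] by simp
    qed measurable
    also have "\<dots> \<le> ennreal (2 powr q) * (ennreal (2 powr q) * (N + e i) + ennreal (2 powr q) * N)"
      by (intro mult_left_mono add_mono d_le g_le) simp
    finally show ?thesis by (simp add: JG)
  qed
  have "(\<lambda>i. J (\<rho> (s i))) \<longlonglongrightarrow> limsup J"
    using LIMSEQ_subseq_LIMSEQ[OF J\<rho> s] by (simp add: o_def)
  moreover have "(\<lambda>i. ennreal (2 powr q) * (ennreal (2 powr q) * (N + e i) + ennreal (2 powr q) * N))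
      \<longlonglongrightarrow> ennreal (2 powr q) * (ennreal (2 powr q) * (N + 0) + ennreal (2 powr q) * N)"
    by (intro ennreal_tendsto_cmult[OF _ tendsto_add[OF bound_lim tendsto_const]]) simp
  ultimately have "limsup J \<le> ennreal (2 powr q) * (ennreal (2 powr q) * (N + 0) + ennreal (2 powr q) * N)"
    using G_le by (intro LIMSEQ_le) auto
  also have "\<dots> = ennreal (2 * 2 powr q * 2 powr q) * N"
    by (simp add: ennreal_mult mult_2[symmetric] mult_ac)
  finally show ?thesis by (simp add: J_def[abs_def] N_def)
qed

end

section \<open>Uniform equivalences\<close>

lemma ennreal_cancel:
  assumes "0 < c"
  shows "ennreal (1 / c) * (ennreal c * z) = z" "ennreal c * (ennreal (1 / c) * z) = z"
  using assms by (simp_all flip: mult.assoc ennreal_mult)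

lemma approx_uniformlyI:
  assumes "0 < C" "0 < D" and "\<And>i. i \<in> S \<Longrightarrow> A i \<le> ennreal C * B i" "\<And>i. i \<in> S \<Longrightarrow> B i \<le> ennreal D * A i"
  shows "approx_uniformly S A B"
  unfolding approx_uniformly_def
proof (rule exI[of _ "1 / C"], rule exI[of _ D], intro conjI ballI)
  fix i assume i: "i \<in> S"
  have "ennreal (1 / C) * A i \<le> ennreal (1 / C) * (ennreal C * B i)"
    using assms(3)[OF i] by (rule mult_left_mono) simp
  also have "\<dots> = B i" using assms(1) by (rule ennreal_cancel)
  finally show "ennreal (1 / C) * A i \<le> B i" .
qed (use assms in auto)

lemma approx_uniformly_sym:
  assumes "approx_uniformly S A B"
  shows "approx_uniformly S B A"
proof -
  obtain c c' where c: "0 < c" "0 < c'" and AB: "\<And>i. i \<in> S \<Longrightarrow> ennreal c * A i \<le> B i" "\<And>i. i \<in> S \<Longrightarrow> B i \<le> ennreal c' * A i"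
    using assms unfolding approx_uniformly_def by blast
  show ?thesis
  proof (rule approx_uniformlyI[of c' "1 / c"])
    fix i assume i: "i \<in> S"
    have "A i = ennreal (1 / c) * (ennreal c * A i)" using c(1) by (rule ennreal_cancel(1)[symmetric])
    also have "\<dots> \<le> ennreal (1 / c) * B i" using AB(1)[OF i] by (rule mult_left_mono) simp
    finally show "A i \<le> ennreal (1 / c) * B i" .
  qed (use c AB in auto)
qed

lemma approx_uniformly_trans:
  assumes "approx_uniformly S A B" "approx_uniformly S B C"
  shows "approx_uniformly S A C"
proof -
  obtain c c' where c: "0 < c" "0 < c'" and AB: "\<And>i. i \<in> S \<Longrightarrow> ennreal c * A i \<le> B i" "\<And>i. i \<in> S \<Longrightarrow> B i \<le> ennreal c' * A i"
    using assms(1) unfolding approx_uniformly_def by blast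
  obtain d d' where d: "0 < d" "0 < d'" and BC: "\<And>i. i \<in> S \<Longrightarrow> ennreal d * B i \<le> C i" "\<And>i. i \<in> S \<Longrightarrow> C i \<le> ennreal d' * B i"
    using assms(2) unfolding approx_uniformly_def by blast
  show ?thesis
    unfolding approx_uniformly_def
  proof (intro exI conjI ballI)
    show "0 < d * c" "0 < d' * c'" using c d by auto
    fix i assume i: "i \<in> S"
    have "ennreal (d * c) * A i = ennreal d * (ennreal c * A i)" using c d by (simp add: ennreal_mult mult.assoc)
    also have "\<dots> \<le> ennreal d * B i" using AB(1)[OF i] by (rule mult_left_mono) simp
    also have "\<dots> \<le> C i" by (rule BC(1)[OF i])
    finally show "ennreal (d * c) * A i \<le> C i" .
    have "C i \<le> ennreal d' * B i" by (rule BC(2)[OF i])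
    also have "\<dots> \<le> ennreal d' * (ennreal c' * A i)" using AB(2)[OF i] by (rule mult_left_mono) simp
    also have "\<dots> = ennreal (d' * c') * A i" using c d by (simp add: ennreal_mult mult.assoc)
    finally show "C i \<le> ennreal (d' * c') * A i" .
  qed
qed

lemma approx_uniformly_ennroot:
  assumes q: "0 < q" and "approx_uniformly S A B"
  shows "approx_uniformly S (\<lambda>i. ennroot q (A i)) (\<lambda>i. ennroot q (B i))"
proof -
  obtain c c' where c: "0 < c" "0 < c'" and AB: "\<And>i. i \<in> S \<Longrightarrow> ennreal c * A i \<le> B i" "\<And>i. i \<in> S \<Longrightarrow> B i \<le> ennreal c' * A i"
    using assms(2) unfolding approx_uniformly_def by blast
  have "ennreal (c powr (1 / q)) * ennroot q (A i) \<le> ennroot q (B i) \<and>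
      ennroot q (B i) \<le> ennreal (c' powr (1 / q)) * ennroot q (A i)" if "i \<in> S" for i
    using AB[OF that] by (simp add: ennroot_mono q c flip: ennroot_mult)
  moreover have "0 < c powr (1 / q)" "0 < c' powr (1 / q)" using c by auto
  ultimately show ?thesis unfolding approx_uniformly_def by blast
qed

section \<open>Final comparisons for a single measure\<close>

context muntz_measure
begin

lemma limsup_muntz_D: "limsup (muntz_D q l \<mu>) = ennroot q (limsup (\<lambda>n. \<integral>\<^sup>+ t. ennreal (kernel n t) \<partial>\<mu>))"
  using q_ge_1 unfolding muntz_D_def kernel_def weight_def by (subst Limsup_ennroot[symmetric]) auto

lemma limsup_monomial_le_kernel:
  "limsup (\<lambda>n. \<integral>\<^sup>+ t. ennreal (l n * t powr (q * l n)) \<partial>\<mu>) \<le> limsup (\<lambda>n. \<integral>\<^sup>+ t. ennreal (kernel n t) \<partial>\<mu>)"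
  by (intro Limsup_mono always_eventually allI nn_integral_mono ennreal_leI kernel_ge) auto

lemma boundary_density_le_essential_norm:
  assumes R: "\<And>n. l (Suc n) \<le> R * l n"
  shows "boundary_density \<mu> \<le> ennreal (R / exp (- 2 * q) * (2 * 2 powr q * 2 powr q)) *
    ennroot (1 / q) (embedding_essential_norm TYPE('a :: {real_normed_field, euclidean_space}) q l \<mu>)"
    (is "_ \<le> ennreal ?C * ennroot _ ?ess")
proof -
  have "0 < R" using R[of 0] l_pos[of 0] l_pos[of 1] by (smt (verit) One_nat_def mult_nonpos_nonneg)
  then have C: "0 < ?C" by simp
  \<comment> \<open>The estimate is turned around, with the essential norm on the larger side, so
    that it can be checked against each compact operator separately and survives the
    infimum.\<close>
  have *: "ennroot q (ennreal (1 / ?C) * boundary_density \<mu>) \<le> ?ess"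
    unfolding embedding_essential_norm_def Lq_essential_norm_def
  proof (rule INF_greatest)
    fix K :: "(real \<Rightarrow> 'a) \<Rightarrow> real \<Rightarrow> 'a"
    assume "K \<in> {K. muntz_compact K}"
    then have K: "muntz_compact K" by simp
    define M where "M = muntz_norm (\<lambda>f x. muntz_embedding l f x - K f x)"
    have "boundary_density \<mu> \<le> ennreal (R / exp (- 2 * q)) * limsup (\<lambda>n. \<integral>\<^sup>+ t. ennreal (l n * t powr (q * l n)) \<partial>\<mu>)"
      using q_ge_1 by (intro boundary_density_le_limsup_monomial R) auto
    also have "\<dots> \<le> ennreal (R / exp (- 2 * q)) * (ennreal (2 * 2 powr q * 2 powr q) * ennroot (1 / q) M)"
      unfolding M_def by (intro mult_left_mono limsup_monomial_le_operator_norm K) simp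
    also have "\<dots> = ennreal ?C * ennroot (1 / q) M"
      using \<open>0 < R\<close> by (subst ennreal_mult) (auto simp: mult.assoc)
    finally have "ennreal (1 / ?C) * boundary_density \<mu> \<le> ennreal (1 / ?C) * (ennreal ?C * ennroot (1 / q) M)"
      by (rule mult_left_mono) simp
    also have "\<dots> = ennroot (1 / q) M" by (rule ennreal_cancel(1)[OF C])
    finally have "ennroot q (ennreal (1 / ?C) * boundary_density \<mu>) \<le> ennroot q (ennroot (1 / q) M)"
      using q_ge_1 by (intro ennroot_mono) auto
    then show "ennroot q (ennreal (1 / ?C) * boundary_density \<mu>)
        \<le> muntz_norm (\<lambda>f x. muntz_embedding l f x - K f x)"
      using q_ge_1 by (simp only: ennroot_inverse M_def)
  qed
  then have "ennroot (1 / q) (ennroot q (ennreal (1 / ?C) * boundary_density \<mu>)) \<le> ennroot (1 / q) ?ess"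
    using q_ge_1 by (intro ennroot_mono) auto
  then have "ennreal (1 / ?C) * boundary_density \<mu> \<le> ennroot (1 / q) ?ess"
    using q_ge_1 by (simp add: ennroot_inverse)
  then have "ennreal ?C * (ennreal (1 / ?C) * boundary_density \<mu>) \<le> ennreal ?C * ennroot (1 / q) ?ess"
    by (rule mult_left_mono) simp
  then show ?thesis by (simp only: ennreal_cancel(2)[OF C])
qed

text \<open>A compact embedding is its own best approximant, so its essential norm is 0 and the
  lower estimate forces the density to vanish.\<close>

lemma embedding_compact_iff:
  assumes R: "\<And>n. l (Suc n) \<le> R * l n"
  shows "embedding_compact TYPE('a :: {real_normed_field, euclidean_space}) q l \<mu> \<longleftrightarrow> vanishing_sublinear \<mu>"
proof
  assume "embedding_compact TYPE('a) q l \<mu>"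
  then have T: "muntz_compact (muntz_embedding l :: (real \<Rightarrow> 'a) \<Rightarrow> real \<Rightarrow> 'a)"
    by (simp add: embedding_compact_def)
  have "embedding_essential_norm TYPE('a) q l \<mu>
      \<le> muntz_norm (\<lambda>(f :: real \<Rightarrow> 'a) x. muntz_embedding l f x - muntz_embedding l f x)"
    unfolding embedding_essential_norm_def Lq_essential_norm_def by (rule INF_lower) (simp add: T)
  also have "\<dots> \<le> 0"
    unfolding Lq_operator_norm_def by (rule SUP_least) (simp add: Lq_norm_def)
  finally have "embedding_essential_norm TYPE('a) q l \<mu> = 0" by simp
  then show "vanishing_sublinear \<mu>"
    using boundary_density_le_essential_norm[OF R, where 'a='a] by (simp add: vanishing_sublinear_iff)
next
  assume "vanishing_sublinear \<mu>"
  then show "embedding_compact TYPE('a) q l \<mu>"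
    unfolding embedding_compact_def vanishing_sublinear_iff by (rule muntz_embedding_compact)
qed

end

theorem corollary5p8:
  fixes q :: real and \<Lambda> :: "nat \<Rightarrow> real" and S :: "real measure set"
  assumes "1 \<le> q"
    and "quasi_geometric \<Lambda>"
  defines "S \<equiv> {\<mu>. finite_borel_measure_on_unit_interval \<mu> \<and>
                    carleson_measure TYPE('a :: {real_normed_field, euclidean_space}) q \<Lambda> \<mu>}"
  shows
    "approx_uniformly S
       (\<lambda>\<mu>. embedding_essential_norm TYPE('a) q \<Lambda> \<mu>)
       (\<lambda>\<mu>. limsup (\<lambda>n. ennroot q (\<integral>\<^sup>+ t. ennreal (\<Lambda> n * t powr \<Lambda> n) \<partial>\<mu>)))
     \<and> approx_uniformly S
       (\<lambda>\<mu>. limsup (\<lambda>n. ennroot q (\<integral>\<^sup>+ t. ennreal (\<Lambda> n * t powr \<Lambda> n) \<partial>\<mu>)))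
       (\<lambda>\<mu>. ennroot q (Limsup (at_right 0) (\<lambda>\<epsilon>. emeasure \<mu> {1 - \<epsilon>..<1} / ennreal \<epsilon>)))
     \<and> approx_uniformly S
       (\<lambda>\<mu>. ennroot q (Limsup (at_right 0) (\<lambda>\<epsilon>. emeasure \<mu> {1 - \<epsilon>..<1} / ennreal \<epsilon>)))
       (\<lambda>\<mu>. limsup (\<lambda>n. muntz_D q \<Lambda> \<mu> n))
     \<and> (\<forall>\<mu>\<in>S. embedding_compact TYPE('a) q \<Lambda> \<mu> \<longleftrightarrow> vanishing_sublinear \<mu>)"
proof -
  obtain r R where \<Lambda>: "\<And>n. 0 < \<Lambda> n" "1 < r" "\<And>n. r \<le> \<Lambda> (Suc n) / \<Lambda> n" "\<And>n. \<Lambda> (Suc n) / \<Lambda> n \<le> R"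
    using assms(2) unfolding quasi_geometric_def by blast
  have R: "\<Lambda> (Suc n) \<le> R * \<Lambda> n" for n using \<Lambda>(1)[of n] \<Lambda>(4)[of n] by (simp add: divide_le_eq)
  have "r \<le> R" using \<Lambda>(3)[of 0] \<Lambda>(4)[of 0] by linarith
  then have R0: "0 < R" using \<Lambda>(2) by linarith
  \<comment> \<open>Interpreted before any measure is fixed: the constants used below are
    expressions of this context, of \<open>R\<close> and of the scalar type, hence uniform over
    S.\<close>
  interpret lacunary_exponent \<Lambda> r q
    using \<Lambda> assms(1) by unfold_locales (auto simp: le_divide_eq)
  have q: "0 < q" using assms(1) by simp
  have mm: "muntz_measure \<Lambda> r q \<mu>" if "\<mu> \<in> S" for \<mu>
    using that by unfold_locales (simp add: S_def)
  define I where "I \<mu> = limsup (\<lambda>n. \<integral>\<^sup>+ t. ennreal (\<Lambda> n * t powr \<Lambda> n) \<partial>\<mu>)" for \<mu>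
  define D where "D \<mu> = limsup (\<lambda>n. \<integral>\<^sup>+ t. ennreal (kernel n t) \<partial>\<mu>)" for \<mu>
  have I: "approx_uniformly S I boundary_density"
  proof (rule approx_uniformlyI[of "shell_const 0" "R / exp (- 2 * 1)"])
    fix \<mu> assume "\<mu> \<in> S"
    then interpret muntz_measure \<Lambda> r q \<mu> by (rule mm)
    show "I \<mu> \<le> ennreal (shell_const 0) * boundary_density \<mu>"
      unfolding I_def by (rule limsup_monomial_le)
    show "boundary_density \<mu> \<le> ennreal (R / exp (- 2 * 1)) * I \<mu>"
      using boundary_density_le_limsup_monomial[OF R, of 1] by (simp add: I_def)
  qed (use R0 in \<open>auto simp: shell_const_pos\<close>)
  have D: "approx_uniformly S boundary_density D"
  proof (rule approx_uniformlyI[of "R / exp (- 2 * q)" kernel_const])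
    fix \<mu> assume "\<mu> \<in> S"
    then interpret muntz_measure \<Lambda> r q \<mu> by (rule mm)
    \<comment> \<open>Here the exponent parameter is q, because the kernel dominates the q-th powers
      of the normalised monomials; for I it is 1.\<close>
    have "boundary_density \<mu> \<le> ennreal (R / exp (- 2 * q)) * limsup (\<lambda>n. \<integral>\<^sup>+ t. ennreal (\<Lambda> n * t powr (q * \<Lambda> n)) \<partial>\<mu>)"
      using q by (intro boundary_density_le_limsup_monomial R) auto
    also have "\<dots> \<le> ennreal (R / exp (- 2 * q)) * D \<mu>"
      unfolding D_def by (intro mult_left_mono limsup_monomial_le_kernel) simp
    finally show "boundary_density \<mu> \<le> ennreal (R / exp (- 2 * q)) * D \<mu>" .
    show "D \<mu> \<le> ennreal kernel_const * boundary_density \<mu>"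
      unfolding D_def by (rule limsup_kernel_le)
  qed (use R0 kernel_const_pos in auto)
  have E: "approx_uniformly S (\<lambda>\<mu>. ennroot (1 / q) (embedding_essential_norm TYPE('a) q \<Lambda> \<mu>)) boundary_density"
  proof (rule approx_uniformlyI)
    fix \<mu> assume "\<mu> \<in> S"
    then interpret muntz_measure \<Lambda> r q \<mu> by (rule mm)
    show "ennroot (1 / q) (embedding_essential_norm TYPE('a) q \<Lambda> \<mu>)
        \<le> ennreal (kernel_const * rep_const TYPE('a)) * boundary_density \<mu>"
      by (rule essential_norm_le)
    show "boundary_density \<mu> \<le> ennreal (R / exp (- 2 * q) * (2 * 2 powr q * 2 powr q)) *
        ennroot (1 / q) (embedding_essential_norm TYPE('a) q \<Lambda> \<mu>)"
      by (rule boundary_density_le_essential_norm[OF R])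
  qed (use R0 kernel_const_pos rep_const(1)[where 'a='a] in auto)
  have I_root: "limsup (\<lambda>n. ennroot q (\<integral>\<^sup>+ t. ennreal (\<Lambda> n * t powr \<Lambda> n) \<partial>\<mu>)) = ennroot q (I \<mu>)" for \<mu>
    unfolding I_def using q by (intro Limsup_ennroot) auto
  \<comment> \<open>The identity for \<open>muntz_D\<close> is at hand only for measures in S, so it
    is transported through the relation on S and not rewritten under the lambda.\<close>
  have D_root: "approx_uniformly S A (\<lambda>\<mu>. limsup (\<lambda>n. muntz_D q \<Lambda> \<mu> n)) \<longleftrightarrow> approx_uniformly S A (\<lambda>\<mu>. ennroot q (D \<mu>))" for A
  proof -
    have "limsup (\<lambda>n. muntz_D q \<Lambda> \<mu> n) = ennroot q (D \<mu>)" if "\<mu> \<in> S" for \<mu>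
      unfolding D_def by (rule muntz_measure.limsup_muntz_D[OF mm[OF that]])
    then show ?thesis by (simp add: approx_uniformly_def)
  qed
  have "approx_uniformly S (\<lambda>\<mu>. embedding_essential_norm TYPE('a) q \<Lambda> \<mu>) (\<lambda>\<mu>. ennroot q (I \<mu>))"
    using approx_uniformly_ennroot[OF q approx_uniformly_trans[OF E approx_uniformly_sym[OF I]]] q
    by (simp add: ennroot_inverse)
  moreover have "approx_uniformly S (\<lambda>\<mu>. ennroot q (I \<mu>)) (\<lambda>\<mu>. ennroot q (boundary_density \<mu>))"
    by (rule approx_uniformly_ennroot[OF q I])
  moreover have "approx_uniformly S (\<lambda>\<mu>. ennroot q (boundary_density \<mu>)) (\<lambda>\<mu>. ennroot q (D \<mu>))"
    by (rule approx_uniformly_ennroot[OF q D])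
  moreover have "embedding_compact TYPE('a) q \<Lambda> \<mu> \<longleftrightarrow> vanishing_sublinear \<mu>" if "\<mu> \<in> S" for \<mu>
    by (rule muntz_measure.embedding_compact_iff[OF mm[OF that] R])
  ultimately show ?thesis
    unfolding I_root D_root boundary_density_def by blast
qed

end
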